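(* Let $G$ be a group such that $H_1G$ is finitely generated. Then the natural maps $G\to\mathbb Z_\infty G\to\widehat G$ induce isomorphisms $$\nu_nG\cong\nu_n(\mathbb Z_\infty G)\cong\nu_n\widehat G$$ for every $n$, and the maps of the natural short exact sequence $$1\to{\varprojlim}^1 M_nG\to\mathbb Z_\infty G\to\widehat G\to1$$ define isomorphisms $$\gamma_\omega(\mathbb Z_\infty G)\cong{\varprojlim}^1M_nG,\qquad \nu_\omega(\mathbb Z_\infty G)\cong\widehat G.$$
   Context: $H_*G=H_*(G,\mathbb Z)$. For a group $G$: $\gamma_1G=G$, $\gamma_{n+1}G=[\gamma_nG,G]$, $\nu_nG=G/\gamma_{n+1}G$, $\gamma_\omega G=\bigcap_{n\ge1}\gamma_nG$, $\nu_\omega G=G/\gamma_\omega G$, and $\widehat G=\varprojlim\nu_nG$ is the pronilpotent completion. A free simplicial resolution of $G$ is a weak equivalence $F_\bullet\to G$ from a free simplicial group (each $F_n$ is free, with bases stable under degeneracies) to the constant simplicial group $G$. The $n$-th Baer invariant is $M_nG=\pi_1(\nu_nF_\bullet)$ (equivalently, for a free presentation $G=F/R$, $M_nG=(R\cap\gamma_{n+1}F)/\gamma_{n+1}(R,F)$ with $\gamma_1(R,F)=R$, $\gamma_{n+1}(R,F)=[\gamma_n(R,F),F]$). It is an abelian group, and the maps $\nu_{n+1}\to\nu_n$ make $(M_nG)_n$ an inverse system. $\mathbb Z_\infty G:=\pi_1(\mathbb Z_\infty BG)$, where $\mathbb Z_\infty X$ denotes the Bousfield–Kan $\mathbb Z$-completion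 of a space $X$. Using the model $\mathbb Z_\infty X_\bullet\simeq\overline{\mathcal W}(\widehat{\mathcal GX_\bullet})$ for a reduced simplicial set $X_\bullet$ ($\mathcal G$ is Kan's loop group, $\overline{\mathcal W}$ its right adjoint), one has $\mathbb Z_\infty G=\pi_0(\widehat F_\bullet)$ with $F_\bullet=\mathcal G\overline{\mathcal W}G$ a free simplicial resolution of $G$. The map $G\to\mathbb Z_\infty G$ is induced by $BG\to\mathbb Z_\infty BG$; the map $\mathbb Z_\infty G\to\widehat G$ is $\pi_0(\varprojlim\nu_nF_\bullet)\to\varprojlim\pi_0(\nu_nF_\bullet)=\varprojlim\nu_nG$; and the short exact sequence is Milnor's $\varprojlim^1$ sequence for the tower $\nu_nF_\bullet$. *)

theory Defs
  imports "HOL-Algebra.Free_Abelian_Groups"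
begin

section \<open>Lower central series, nilpotent quotients, pronilpotent completion\<close>

text \<open>Indices are shifted: \<open>lcs G n\<close> is the term $\gamma_{n+1}G$, so that \<open>lcs G 0\<close> is
  $\gamma_1 G = G$ and \<open>nu n G\<close> is $\nu_n G = G/\gamma_{n+1}G$.  Towers below are indexed by all
  natural numbers; their entry at 0 is the trivial group and affects neither the limit nor
  the derived limit.\<close>

primrec lcs :: "('a, 'b) monoid_scheme \<Rightarrow> nat \<Rightarrow> 'a set" where
  "lcs G 0 = carrier G"
| "lcs G (Suc n) = generate G
     (\<Union>h \<in> lcs G n. \<Union>g \<in> carrier G. {h \<otimes>\<^bsub>G\<^esub> g \<otimes>\<^bsub>G\<^esub> inv\<^bsub>G\<^esub> h \<otimes>\<^bsub>G\<^esub> inv\<^bsub>G\<^esub> g})"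

definition lcs_omega :: "('a, 'b) monoid_scheme \<Rightarrow> 'a set" where
  "lcs_omega G = (\<Inter>n. lcs G n)"

definition nu :: "nat \<Rightarrow> ('a, 'b) monoid_scheme \<Rightarrow> 'a set monoid" where
  "nu n G = G Mod lcs G n"

definition nu_omega :: "('a, 'b) monoid_scheme \<Rightarrow> 'a set monoid" where
  "nu_omega G = G Mod lcs_omega G"

text \<open>The map $G/M \to H/N$ induced by a homomorphism $f : G \to H$ with $f(M) \subseteq N$,
  on cosets: $Mx \mapsto N f(Mx) = N f(x)$.\<close>

definition coset_map :: "('b, 'c) monoid_scheme \<Rightarrow> 'b set \<Rightarrow> ('a \<Rightarrow> 'b) \<Rightarrow> 'a set \<Rightarrow> 'b set" where
  "coset_map H N f C = N <#>\<^bsub>H\<^esub> (f ` C)"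

definition nu_map :: "('b, 'c) monoid_scheme \<Rightarrow> nat \<Rightarrow> ('a \<Rightarrow> 'b) \<Rightarrow> 'a set \<Rightarrow> 'b set" where
  "nu_map H n f = coset_map H (lcs H n) f"

definition nu_proj :: "('a, 'b) monoid_scheme \<Rightarrow> nat \<Rightarrow> 'a set \<Rightarrow> 'a set" where
  "nu_proj G n = coset_map G (lcs G n) (\<lambda>x. x)"

text \<open>Limit and derived limit of a tower \<open>\<dots> \<rightarrow> A 2 \<rightarrow> A 1 \<rightarrow> A 0\<close> with bonding maps
  \<open>p n : A (Suc n) \<rightarrow> A n\<close>; the derived limit is only used for abelian groups, where it is the
  cokernel of $\mathrm{id} - \mathrm{shift}$ on the product.\<close>

definition inv_limit :: "(nat \<Rightarrow> 'a monoid) \<Rightarrow> (nat \<Rightarrow> 'a \<Rightarrow> 'a) \<Rightarrow> (nat \<Rightarrow> 'a) monoid" where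
  "inv_limit A p = (product_group UNIV A)
     \<lparr>carrier := {x \<in> carrier (product_group UNIV A). \<forall>n. p n (x (Suc n)) = x n}\<rparr>"

definition lim1 :: "(nat \<Rightarrow> 'a monoid) \<Rightarrow> (nat \<Rightarrow> 'a \<Rightarrow> 'a) \<Rightarrow> (nat \<Rightarrow> 'a) set monoid" where
  "lim1 A p = product_group UNIV A Mod
     ((\<lambda>x n. x n \<otimes>\<^bsub>A n\<^esub> inv\<^bsub>A n\<^esub> p n (x (Suc n))) ` carrier (product_group UNIV A))"

definition pronil :: "('a, 'b) monoid_scheme \<Rightarrow> (nat \<Rightarrow> 'a set) monoid" where
  "pronil G = inv_limit (\<lambda>n. nu n G) (nu_proj G)"

definition pronil_map ::
  "('b, 'c) monoid_scheme \<Rightarrow> ('a \<Rightarrow> 'b) \<Rightarrow> (nat \<Rightarrow> 'a set) \<Rightarrow> nat \<Rightarrow> 'b set" where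
  "pronil_map H f x = (\<lambda>n. nu_map H n f (x n))"

definition to_pronil :: "('a, 'b) monoid_scheme \<Rightarrow> 'a \<Rightarrow> nat \<Rightarrow> 'a set" where
  "to_pronil G g = (\<lambda>n. lcs G n #>\<^bsub>G\<^esub> g)"

definition fin_gen :: "('a, 'b) monoid_scheme \<Rightarrow> bool" where
  "fin_gen G \<longleftrightarrow> (\<exists>S. finite S \<and> S \<subseteq> carrier G \<and> generate G S = carrier G)"


section \<open>Free groups\<close>

text \<open>The free group on a set, realised by reduced words; the letter \<open>(x, True)\<close> is the generator
  \<open>x\<close> and \<open>(x, False)\<close> is its inverse.\<close>

type_synonym 'a word = "('a \<times> bool) list"

fun reduced :: "'a word \<Rightarrow> bool" where
  "reduced [] = True"
| "reduced [l] = True"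
| "reduced (l # m # w) = (\<not> (fst l = fst m \<and> snd l \<noteq> snd m) \<and> reduced (m # w))"

fun push :: "'a \<times> bool \<Rightarrow> 'a word \<Rightarrow> 'a word" where
  "push l [] = [l]"
| "push l (m # w) = (if fst l = fst m \<and> snd l \<noteq> snd m then w else l # m # w)"

definition free_group :: "'a set \<Rightarrow> 'a word monoid" where
  "free_group S = \<lparr>carrier = {w. reduced w \<and> fst ` set w \<subseteq> S},
                   monoid.mult = (\<lambda>u v. foldr push u v), one = []\<rparr>"

definition free_lift :: "('b, 'c) monoid_scheme \<Rightarrow> ('a \<Rightarrow> 'b) \<Rightarrow> 'a word \<Rightarrow> 'b" where
  "free_lift H f w =
     foldr (\<lambda>(x, b) h. (if b then f x else inv\<^bsub>H\<^esub> f x) \<otimes>\<^bsub>H\<^esub> h) w \<one>\<^bsub>H\<^esub>"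


section \<open>Simplicial sets, simplicial groups, homology and homotopy\<close>

text \<open>\<open>sface X n i\<close> is $d_i : X_n \to X_{n-1}$ and \<open>sdegen X n i\<close> is $s_i : X_n \to X_{n+1}$, both for
  $0 \le i \le n$; likewise for simplicial groups.\<close>

record 'a sset =
  simplices :: "nat \<Rightarrow> 'a set"
  sface :: "nat \<Rightarrow> nat \<Rightarrow> 'a \<Rightarrow> 'a"
  sdegen :: "nat \<Rightarrow> nat \<Rightarrow> 'a \<Rightarrow> 'a"

record 'a sgroup =
  grp :: "nat \<Rightarrow> 'a monoid"
  gface :: "nat \<Rightarrow> nat \<Rightarrow> 'a \<Rightarrow> 'a"
  gdegen :: "nat \<Rightarrow> nat \<Rightarrow> 'a \<Rightarrow> 'a"

definition boundary :: "'a sset \<Rightarrow> nat \<Rightarrow> ('a \<Rightarrow>\<^sub>0 int) \<Rightarrow> 'a \<Rightarrow>\<^sub>0 int" where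
  "boundary X n c = (if n = 0 then 0 else
     frag_extend (\<lambda>x. \<Sum>i\<le>n. frag_cmul ((-1) ^ i) (frag_of (sface X n i x))) c)"

definition homology :: "'a sset \<Rightarrow> nat \<Rightarrow> ('a \<Rightarrow>\<^sub>0 int) set monoid" where
  "homology X n =
     (free_Abelian_group (simplices X n))
       \<lparr>carrier := {c \<in> carrier (free_Abelian_group (simplices X n)). boundary X n c = 0}\<rparr>
     Mod (boundary X (Suc n) ` carrier (free_Abelian_group (simplices X (Suc n))))"

text \<open>Homotopy groups of a simplicial group via the Moore complex
  $N_n = \bigcap_{i<n} \ker d_i$ with differential $d_n$.\<close>

definition moore :: "'a sgroup \<Rightarrow> nat \<Rightarrow> 'a set" where
  "moore S n = {x \<in> carrier (grp S n). \<forall>i<n. gface S n i x = \<one>\<^bsub>grp S (n - 1)\<^esub>}"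

definition moore_cycles :: "'a sgroup \<Rightarrow> nat \<Rightarrow> 'a set" where
  "moore_cycles S n = {x \<in> moore S n. n > 0 \<longrightarrow> gface S n n x = \<one>\<^bsub>grp S (n - 1)\<^esub>}"

definition moore_bounds :: "'a sgroup \<Rightarrow> nat \<Rightarrow> 'a set" where
  "moore_bounds S n = gface S (Suc n) (Suc n) ` moore S (Suc n)"

definition hpi :: "nat \<Rightarrow> 'a sgroup \<Rightarrow> 'a set monoid" where
  "hpi n S = (grp S n)\<lparr>carrier := moore_cycles S n\<rparr> Mod moore_bounds S n"

text \<open>\<open>hpi_map n T f\<close> is the map on $\pi_n$ induced by a map of simplicial groups into \<open>T\<close> which is
  \<open>f\<close> in dimension \<open>n\<close>.\<close>

definition hpi_map :: "nat \<Rightarrow> 'b sgroup \<Rightarrow> ('a \<Rightarrow> 'b) \<Rightarrow> 'a set \<Rightarrow> 'b set" where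
  "hpi_map n T f = coset_map (grp T n) (moore_bounds T n) f"

definition snu :: "nat \<Rightarrow> 'a sgroup \<Rightarrow> 'a set sgroup" where
  "snu k S = \<lparr>grp = (\<lambda>m. nu k (grp S m)),
              gface = (\<lambda>m i. nu_map (grp S (m - 1)) k (gface S m i)),
              gdegen = (\<lambda>m i. nu_map (grp S (Suc m)) k (gdegen S m i))\<rparr>"

definition spronil :: "'a sgroup \<Rightarrow> (nat \<Rightarrow> 'a set) sgroup" where
  "spronil S = \<lparr>grp = (\<lambda>m. pronil (grp S m)),
                gface = (\<lambda>m i. pronil_map (grp S (m - 1)) (gface S m i)),
                gdegen = (\<lambda>m i. pronil_map (grp S (Suc m)) (gdegen S m i))\<rparr>"


section \<open>Milnor's sequence for the tower of nilpotent quotients of a simplicial group\<close>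

definition pi1_tower :: "'a sgroup \<Rightarrow> nat \<Rightarrow> 'a set set monoid" where
  "pi1_tower S n = hpi 1 (snu n S)"

definition pi1_tower_map :: "'a sgroup \<Rightarrow> nat \<Rightarrow> 'a set set \<Rightarrow> 'a set set" where
  "pi1_tower_map S n = hpi_map 1 (snu n S) (nu_proj (grp S 1) n)"

text \<open>The connecting map $\varprojlim^1 \pi_1(\nu_n S) \to \pi_0(\varprojlim \nu_n S)$.  Let a class
  \<open>\<xi>\<close> be represented by \<open>(x n)\<close> with $x_n \in \pi_1(\nu_n S)$.  Choose $y_n \in N_1(\nu_n S)$ such
  that the cycle $p(y_{n+1})^{-1} y_n$ represents $x_n$, for all $n$; then $(d_1 y_n)_n$ lies in
  $\varprojlim \nu_n S_0$ and its class in $\pi_0$ is the image of \<open>\<xi>\<close>.  The definition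
  collects the results of all such choices, which form exactly one coset, that is, one element of
  $\pi_0$.\<close>

definition milnor_delta :: "'a sgroup \<Rightarrow> (nat \<Rightarrow> 'a set set) set \<Rightarrow> (nat \<Rightarrow> 'a set) set" where
  "milnor_delta S \<xi> = {(\<lambda>n. gface (snu n S) 1 1 (y n)) | x y.
     x \<in> \<xi> \<and>
     (\<forall>n. y n \<in> moore (snu n S) 1 \<and>
          inv\<^bsub>grp (snu n S) 1\<^esub> (nu_proj (grp S 1) n (y (Suc n))) \<otimes>\<^bsub>grp (snu n S) 1\<^esub> y n \<in> x n)}"

definition milnor_proj :: "'a sgroup \<Rightarrow> (nat \<Rightarrow> 'a set) set \<Rightarrow> nat \<Rightarrow> 'a set set" where
  "milnor_proj S C = (\<lambda>n. hpi_map 0 (snu n S) (\<lambda>z. z n) C)"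


section \<open>Classifying space and Kan's loop group\<close>

text \<open>The nerve $BG = \overline{\mathcal W} G$ in bar notation: an $n$-simplex is a list
  $[g_1|\dots|g_n]$.\<close>

definition nerve :: "('a, 'b) monoid_scheme \<Rightarrow> 'a list sset" where
  "nerve G = \<lparr>simplices = (\<lambda>n. {xs. length xs = n \<and> set xs \<subseteq> carrier G}),
     sface = (\<lambda>n i xs. if i = 0 then tl xs else if i = n then butlast xs
        else take (i - 1) xs @ [xs ! (i - 1) \<otimes>\<^bsub>G\<^esub> xs ! i] @ drop (Suc i) xs),
     sdegen = (\<lambda>n i xs. take i xs @ [\<one>\<^bsub>G\<^esub>] @ drop i xs)\<rparr>"

text \<open>Kan's loop group of a reduced simplicial set: in dimension $n$ the free group with generators
  $\tau(x)$ for $x \in X_{n+1}$ and relations $\tau(s_0 x) = 1$, with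
  $d_0\tau(x) = \tau(d_1 x)\,\tau(d_0 x)^{-1}$, and $d_i\tau(x) = \tau(d_{i+1}x)$ for $i > 0$, and
  $s_i\tau(x) = \tau(s_{i+1}x)$.\<close>

definition loop_grp :: "'a sset \<Rightarrow> nat \<Rightarrow> 'a word monoid" where
  "loop_grp X n = free_group (simplices X (Suc n) - sdegen X n 0 ` simplices X n)"

definition tau :: "'a sset \<Rightarrow> nat \<Rightarrow> 'a \<Rightarrow> 'a word" where
  "tau X n x = (if x \<in> sdegen X n 0 ` simplices X n then [] else [(x, True)])"

definition kan_loop :: "'a sset \<Rightarrow> 'a word sgroup" where
  "kan_loop X = \<lparr>grp = loop_grp X,
     gface = (\<lambda>n i. free_lift (loop_grp X (n - 1))
        (\<lambda>x. if i = 0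
             then tau X (n - 1) (sface X (Suc n) 1 x)
                  \<otimes>\<^bsub>loop_grp X (n - 1)\<^esub> inv\<^bsub>loop_grp X (n - 1)\<^esub> tau X (n - 1) (sface X (Suc n) 0 x)
             else tau X (n - 1) (sface X (Suc n) (Suc i) x))),
     gdegen = (\<lambda>n i. free_lift (loop_grp X (Suc n))
        (\<lambda>x. tau X (Suc n) (sdegen X (Suc n) (Suc i) x)))\<rparr>"


section \<open>The group $\mathbb Z_\infty G$, Baer invariants and the natural maps\<close>

text \<open>The free simplicial resolution $\mathcal G \overline{\mathcal W} G$ of \<open>G\<close>, with its
  augmentation $F_0 \to G$, $\tau[g] \mapsto g$, which induces $\pi_0(F_\bullet) \cong G$.\<close>

definition free_res :: "('a, 'b) monoid_scheme \<Rightarrow> 'a list word sgroup" where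
  "free_res G = kan_loop (nerve G)"

definition res_aug :: "('a, 'b) monoid_scheme \<Rightarrow> 'a list word \<Rightarrow> 'a" where
  "res_aug G = free_lift G hd"

definition group_H :: "nat \<Rightarrow> ('a, 'b) monoid_scheme \<Rightarrow> ('a list \<Rightarrow>\<^sub>0 int) set monoid" where
  "group_H n G = homology (nerve G) n"

definition baer :: "nat \<Rightarrow> ('a, 'b) monoid_scheme \<Rightarrow> 'a list word set set monoid" where
  "baer n G = pi1_tower (free_res G) n"

definition baer_map :: "('a, 'b) monoid_scheme \<Rightarrow> nat \<Rightarrow> 'a list word set set \<Rightarrow> 'a list word set set" where
  "baer_map G n = pi1_tower_map (free_res G) n"

text \<open>$\mathbb Z_\infty G = \pi_1(\mathbb Z_\infty BG)$, computed in the model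
  $\overline{\mathcal W}(\widehat{\mathcal G BG})$ of the Bousfield--Kan completion $\mathbb Z_\infty BG$,
  that is, as $\pi_0(\widehat{\mathcal G BG})$.\<close>

definition Zinf :: "('a, 'b) monoid_scheme \<Rightarrow> (nat \<Rightarrow> 'a list word set) set monoid" where
  "Zinf G = hpi 0 (spronil (free_res G))"

text \<open>The map $G \to \mathbb Z_\infty G$ induced by $BG \to \overline{\mathcal W}\mathcal G BG \to
  \overline{\mathcal W}(\widehat{\mathcal G BG})$: the unit sends the 1-simplex $[g]$ to
  $\tau[g] \in F_0$.\<close>

definition to_Zinf :: "('a, 'b) monoid_scheme \<Rightarrow> 'a \<Rightarrow> (nat \<Rightarrow> 'a list word set) set" where
  "to_Zinf G g = moore_bounds (spronil (free_res G)) 0 #>\<^bsub>grp (spronil (free_res G)) 0\<^esub>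
     to_pronil (grp (free_res G) 0) (tau (nerve G) 0 [g])"

text \<open>The map $\mathbb Z_\infty G = \pi_0(\varprojlim \nu_nF_\bullet) \to
  \varprojlim \pi_0(\nu_nF_\bullet) = \varprojlim \nu_nG$.  The identification
  $\pi_0(\nu_nF_\bullet) = \nu_nG$ is induced by the augmentation, which is constant on the classes
  of $\pi_0(\nu_nF_\bullet)$.\<close>

definition Zinf_to_pronil ::
  "('a, 'b) monoid_scheme \<Rightarrow> (nat \<Rightarrow> 'a list word set) set \<Rightarrow> nat \<Rightarrow> 'a set" where
  "Zinf_to_pronil G C =
     (\<lambda>n. the_elem (nu_map G n (res_aug G) ` milnor_proj (free_res G) C n))"

definition lim1_baer :: "('a, 'b) monoid_scheme \<Rightarrow> (nat \<Rightarrow> 'a list word set set) set monoid" where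
  "lim1_baer G = lim1 (\<lambda>n. baer n G) (baer_map G)"

definition lim1_baer_to_Zinf :: "('a, 'b) monoid_scheme \<Rightarrow>
    (nat \<Rightarrow> 'a list word set set) set \<Rightarrow> (nat \<Rightarrow> 'a list word set) set" where
  "lim1_baer_to_Zinf G = milnor_delta (free_res G)"

end

theory Submission
  imports Defs
begin

text \<open>Nothing about the resolution \<open>F\<close> is used beyond $\pi_0(F) = G$: for every simplicial group \<open>F\<close>
  with $\pi_0(F) = G$ the sequence is Milnor's sequence of the tower $\nu_n F$, whose maps are
  surjective and hence fibrations.  The one essential point is that the kernel of
  $\mathbb Z_\infty G = \pi_0(\widehat F) \to \nu_n G$ is the term $\gamma_{n+1}$ of its lower central
  series.  Let $x_1, \dots, x_r \in F_0$ generate $G$ modulo $[G, G]$.  Since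
  commutators are bilinear on the associated graded group, every element of $\gamma_{m+1}F_0$ is
  $\prod_i [a_i, x_i] \cdot d_1(u)$ modulo $\gamma_{m+2}F_0$, with $a_i \in \gamma_m F_0$ and
  $u \in \gamma_{m+1}F_1 \cap \ker d_0$.  Successive approximation in the completion, where
  finiteness of the number of $x_i$ is essential, gives the same expression for the elements of the
  completed term, and the factor $d_1(u)$ dies in $\pi_0$.\<close>

text \<open>The obstacle: \<open>lcs\<close> is built from finite products of commutators, whereas
  an element of the completion that is trivial in one component is a priori only an infinite
  convergent product of them. Every correction at a deeper stage is therefore absorbed into the
  coefficient of a fixed commutator [a_i, x_i]; the coefficients converge, and in the limit one
  commutator for each i remains. The limits of the coefficients are elements of the completion with
  one commutator level less, so induction on the level applies to them. The boundary factors have to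
  converge as well, which is why u is required to be deep in F_1. This depth comes from the
  degeneracy s: for u in ker d_0, [h, d1(u)] = d1([s(h), u]). The assertions about \<open>nu\<close>
  and \<open>lcs_omega\<close> then reduce to the criterion \<open>Z_lcs_iff\<close>: the class of a
  sequence (t_n) lies in the lower central term of index m exactly when the augmentation of t_m lies
  in that term of G. The map from G to pi_0 of the completion is onto only modulo these terms, where
  aug t_n approximates the class.\<close>

declare lcs.simps(2) [simp del]

section \<open>Cosets and commutators\<close>

context group
begin

text \<open>Cancellation inside a right-nested product. Together with \<open>m_assoc\<close> and
  \<open>inv_mult_group\<close> it lets the simplifier decide the word identities between
  commutators below.\<close>

lemma mult_inv_cancel [simp]:
  assumes "x \<in> carrier G" "y \<in> carrier G"
  shows "x \<otimes> (inv x \<otimes> y) = y" "inv x \<otimes> (x \<otimes> y) = y"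
  using assms by (simp_all add: m_assoc [symmetric])

abbreviation commutator :: "'a \<Rightarrow> 'a \<Rightarrow> 'a" where
  "commutator h g \<equiv> h \<otimes> g \<otimes> inv h \<otimes> inv g"

end

lemma (in normal) rcos_eq_iff:
  assumes "x \<in> carrier G" "y \<in> carrier G"
  shows "H #> x = H #> y \<longleftrightarrow> x \<otimes> inv y \<in> H"
proof
  assume "H #> x = H #> y"
  then have "x \<in> H #> y" using assms rcos_self is_subgroup by blast
  then show "x \<otimes> inv y \<in> H" using assms rcos_module_imp[OF is_group] by blast
next
  assume "x \<otimes> inv y \<in> H"
  then have "x \<in> H #> y" using assms rcos_module_rev[OF is_group] by blast
  then show "H #> x = H #> y" using assms repr_independence is_subgroup by blast
qed

lemma (in normal) rcos_hom: "group_hom G (G Mod H) ((#>) H)"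
  using r_coset_hom_Mod factorgroup_is_group by (simp add: group_hom_def group_hom_axioms_def is_group)

lemma (in normal) rcos_eq_self_iff:
  assumes "x \<in> carrier G"
  shows "H #> x = H \<longleftrightarrow> x \<in> H"
  using assms is_subgroup coset_join1 coset_join2 by blast

text \<open>\<open>coset_map\<close> multiplies a whole image set by \<open>N\<close>, so that no
  representative is chosen. The elements f m with m in \<open>M\<close> are absorbed into
  \<open>N\<close>, and the neutral element of \<open>M\<close> gives the reverse inclusion.\<close>

lemma coset_map_rcos:
  assumes "group_hom G H f" "subgroup M G" "N \<lhd> H" "f ` M \<subseteq> N" "x \<in> carrier G"
  shows "coset_map H N f (M #>\<^bsub>G\<^esub> x) = N #>\<^bsub>H\<^esub> f x"
proof -
  interpret group_hom G H f by fact
  interpret N: normal N H by fact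
  have M: "M \<subseteq> carrier G" by (rule subgroup.subset[OF assms(2)])
  show ?thesis
  proof
    show "coset_map H N f (M #>\<^bsub>G\<^esub> x) \<subseteq> N #>\<^bsub>H\<^esub> f x"
    proof
      fix y assume "y \<in> coset_map H N f (M #>\<^bsub>G\<^esub> x)"
      then obtain n m where nm: "n \<in> N" "m \<in> M" "y = n \<otimes>\<^bsub>H\<^esub> f (m \<otimes>\<^bsub>G\<^esub> x)"
        by (auto simp: coset_map_def set_mult_def r_coset_def)
      have m: "m \<in> carrier G" and n: "n \<in> carrier H" and fm: "f m \<in> N"
        using nm M assms(4) N.subset by auto
      then have "y = (n \<otimes>\<^bsub>H\<^esub> f m) \<otimes>\<^bsub>H\<^esub> f x"
        using nm(3) assms(5) by (simp add: H.m_assoc)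
      moreover have "n \<otimes>\<^bsub>H\<^esub> f m \<in> N" using nm(1) fm by (rule N.m_closed)
      ultimately show "y \<in> N #>\<^bsub>H\<^esub> f x" by (auto simp: r_coset_def)
    qed
    show "N #>\<^bsub>H\<^esub> f x \<subseteq> coset_map H N f (M #>\<^bsub>G\<^esub> x)"
    proof
      fix y assume "y \<in> N #>\<^bsub>H\<^esub> f x"
      then obtain n where "n \<in> N" "y = n \<otimes>\<^bsub>H\<^esub> f x" by (auto simp: r_coset_def)
      moreover have "x \<in> M #>\<^bsub>G\<^esub> x" by (rule G.rcos_self[OF assms(5,2)])
      ultimately show "y \<in> coset_map H N f (M #>\<^bsub>G\<^esub> x)"
        by (auto simp: coset_map_def set_mult_def)
    qed
  qed
qed

lemma coset_map_hom:
  assumes "group_hom G H f" "M \<lhd> G" "N \<lhd> H" "f ` M \<subseteq> N"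
  shows "group_hom (G Mod M) (H Mod N) (coset_map H N f)"
proof -
  interpret group_hom G H f by fact
  interpret N: normal N H by fact
  interpret M: normal M G by fact
  note cm = coset_map_rcos[OF assms(1) M.subgroup_axioms assms(3,4)]
  have "coset_map H N f \<in> hom (G Mod M) (H Mod N)"
  proof (rule homI)
    fix x assume "x \<in> carrier (G Mod M)"
    then obtain a where a: "a \<in> carrier G" "x = M #>\<^bsub>G\<^esub> a"
      unfolding carrier_FactGroup by blast
    show "coset_map H N f x \<in> carrier (H Mod N)"
      unfolding carrier_FactGroup a(2) cm[OF a(1)] using hom_closed[OF a(1)] by (rule imageI)
  next
    fix x y assume "x \<in> carrier (G Mod M)" "y \<in> carrier (G Mod M)"
    then obtain a b where "a \<in> carrier G" "b \<in> carrier G" "x = M #>\<^bsub>G\<^esub> a" "y = M #>\<^bsub>G\<^esub> b"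
      unfolding carrier_FactGroup by blast
    then show "coset_map H N f (x \<otimes>\<^bsub>G Mod M\<^esub> y) = coset_map H N f x \<otimes>\<^bsub>H Mod N\<^esub> coset_map H N f y"
      using cm[of a] cm[of b] cm[of "a \<otimes>\<^bsub>G\<^esub> b"] M.rcos_sum[of a b] N.rcos_sum[of "f a" "f b"] by simp
  qed
  then show ?thesis
    by (simp add: group_hom_def group_hom_axioms_def M.factorgroup_is_group N.factorgroup_is_group)
qed

section \<open>The lower central series\<close>

context group
begin

lemma conj_commutator:
  assumes "g \<in> carrier G" "h \<in> carrier G" "k \<in> carrier G"
  shows "g \<otimes> commutator h k \<otimes> inv g = commutator (g \<otimes> h \<otimes> inv g) (g \<otimes> k \<otimes> inv g)"
  using assms by (simp add: m_assoc inv_mult_group)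

text \<open>Conjugation maps the set of generating commutators to itself: by
  \<open>conj_commutator\<close> it acts on both entries, and the previous term is normal by
  induction.\<close>

lemma lcs_normal: "lcs G n \<lhd> G"
proof (induction n)
  case 0
  show ?case by (simp add: normal_self)
next
  case (Suc n)
  interpret normal "lcs G n" G by fact
  show ?case unfolding lcs.simps(2)
  proof (rule normal_generateI)
    show "(\<Union>h\<in>lcs G n. \<Union>g\<in>carrier G. {commutator h g}) \<subseteq> carrier G"
      using subset by fast
    fix x g assume "x \<in> (\<Union>h\<in>lcs G n. \<Union>g\<in>carrier G. {commutator h g})" and g: "g \<in> carrier G"
    then obtain h k where hk: "h \<in> lcs G n" "k \<in> carrier G" and x: "x = commutator h k" by blast
    have h: "h \<in> carrier G" using hk subset by blast
    have "g \<otimes> x \<otimes> inv g = commutator (g \<otimes> h \<otimes> inv g) (g \<otimes> k \<otimes> inv g)"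
      unfolding x by (rule conj_commutator[OF g h hk(2)])
    moreover have "g \<otimes> h \<otimes> inv g \<in> lcs G n" by (rule inv_op_closed2[OF g hk(1)])
    moreover have "g \<otimes> k \<otimes> inv g \<in> carrier G" using g hk(2) by simp
    ultimately show "g \<otimes> x \<otimes> inv g \<in> (\<Union>h\<in>lcs G n. \<Union>g\<in>carrier G. {commutator h g})"
      by blast
  qed
qed

lemma lcs_subgroup: "subgroup (lcs G n) G"
  by (rule normal_imp_subgroup[OF lcs_normal])

lemma lcs_closed: "x \<in> lcs G n \<Longrightarrow> x \<in> carrier G"
  by (rule subgroup.mem_carrier[OF lcs_subgroup])

lemma commutator_lcs:
  assumes "h \<in> lcs G n" "g \<in> carrier G"
  shows "commutator h g \<in> lcs G (Suc n)"
  using assms by (auto simp: lcs.simps(2) intro!: generate.incl)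

text \<open>A commutator [h, g] is h times a conjugate of h^-1, hence stays in any normal subgroup
  that contains h.\<close>

lemma lcs_Suc_subset: "lcs G (Suc n) \<subseteq> lcs G n"
  unfolding lcs.simps(2)
proof (rule generate_subgroup_incl[OF _ lcs_subgroup], clarify)
  fix h g assume h: "h \<in> lcs G n" and g: "g \<in> carrier G"
  note hc = lcs_closed[OF h] and h' = subgroup.m_inv_closed[OF lcs_subgroup h]
  have "commutator h g = h \<otimes> (g \<otimes> inv h \<otimes> inv g)" using hc g by (simp add: m_assoc)
  then show "commutator h g \<in> lcs G n"
    using subgroup.m_closed[OF lcs_subgroup h normal.inv_op_closed2[OF lcs_normal g h']] by argo
qed

lemma lcs_antimono: "m \<le> n \<Longrightarrow> lcs G n \<subseteq> lcs G m"
  by (rule lift_Suc_antimono_le[of "lcs G"]) (rule lcs_Suc_subset)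

lemma nu_group: "group (nu n G)"
  unfolding nu_def by (rule normal.factorgroup_is_group[OF lcs_normal])

lemma nu_hom: "group_hom G (nu n G) ((#>) (lcs G n))"
  unfolding nu_def by (rule normal.rcos_hom[OF lcs_normal])

lemma lcs_rcos_eq_iff:
  assumes "x \<in> carrier G" "y \<in> carrier G"
  shows "lcs G n #> x = lcs G n #> y \<longleftrightarrow> x \<otimes> inv y \<in> lcs G n"
  by (rule normal.rcos_eq_iff[OF lcs_normal assms])

lemma lcs_rcos_eq_one_iff:
  assumes "x \<in> carrier G"
  shows "lcs G n #> x = lcs G n \<longleftrightarrow> x \<in> lcs G n"
  by (rule normal.rcos_eq_self_iff[OF lcs_normal assms])

lemma one_nu: "\<one>\<^bsub>nu n G\<^esub> = lcs G n"
  by (simp add: nu_def)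

lemma carrier_nu: "carrier (nu n G) = (#>) (lcs G n) ` carrier G"
  by (simp add: nu_def carrier_FactGroup)

lemma lcs_rcos_antimono:
  assumes "lcs G n #> x = lcs G n #> y" "m \<le> n" "x \<in> carrier G" "y \<in> carrier G"
  shows "lcs G m #> x = lcs G m #> y"
  using assms lcs_antimono by (auto simp: lcs_rcos_eq_iff)

text \<open>Centrality of each term modulo the next one, the source of the reorderings modulo lower
  central terms below.\<close>

lemma lcs_rcos_comm:
  assumes "x \<in> lcs G n" "y \<in> carrier G"
  shows "lcs G (Suc n) #> (x \<otimes> y) = lcs G (Suc n) #> (y \<otimes> x)"
proof -
  have "x \<in> carrier G" using assms lcs_closed by blast
  moreover have "x \<otimes> y \<otimes> inv (y \<otimes> x) = commutator x y"
    using assms calculation by (simp add: inv_mult_group m_assoc)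
  ultimately show ?thesis
    using assms(2) commutator_lcs[OF assms] lcs_rcos_eq_iff[of "x \<otimes> y" "y \<otimes> x" "Suc n"]
    by simp
qed

end

context group_hom
begin

lemma lcs_image_subset: "h ` lcs G n \<subseteq> lcs H n"
proof (induction n)
  case 0
  show ?case by auto
next
  case (Suc n)
  let ?C = "\<Union>k\<in>lcs G n. \<Union>g\<in>carrier G. {k \<otimes> g \<otimes> inv k \<otimes> inv g}"
  have C: "?C \<subseteq> carrier G" using G.lcs_closed by auto
  have "h ` lcs G (Suc n) = generate H (h ` ?C)"
    using generate_img[OF C] by (simp add: lcs.simps(2))
  also have "\<dots> \<subseteq> lcs H (Suc n)" unfolding lcs.simps(2)
  proof (rule mono_generate)
    show "h ` ?C \<subseteq> (\<Union>k\<in>lcs H n. \<Union>g\<in>carrier H. {k \<otimes>\<^bsub>H\<^esub> g \<otimes>\<^bsub>H\<^esub> inv\<^bsub>H\<^esub> k \<otimes>\<^bsub>H\<^esub> inv\<^bsub>H\<^esub> g})"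
    proof clarify
      fix k g assume kg: "k \<in> lcs G n" "g \<in> carrier G"
      then have e: "h (k \<otimes> g \<otimes> inv k \<otimes> inv g) = h k \<otimes>\<^bsub>H\<^esub> h g \<otimes>\<^bsub>H\<^esub> inv\<^bsub>H\<^esub> h k \<otimes>\<^bsub>H\<^esub> inv\<^bsub>H\<^esub> h g"
        using G.lcs_closed[OF kg(1)] by simp
      have "h k \<in> lcs H n" "h g \<in> carrier H" using kg Suc by auto
      then show "h (k \<otimes> g \<otimes> inv k \<otimes> inv g) \<in> (\<Union>k\<in>lcs H n. \<Union>g\<in>carrier H. {k \<otimes>\<^bsub>H\<^esub> g \<otimes>\<^bsub>H\<^esub> inv\<^bsub>H\<^esub> k \<otimes>\<^bsub>H\<^esub> inv\<^bsub>H\<^esub> g})"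
        unfolding e by blast
    qed
  qed
  finally show ?case .
qed

text \<open>A surjection makes both entries of a commutator liftable. Applied to the augmentation,
  this represents an element of a lower central term of G by an element of the same term of
  F_0.\<close>

lemma lcs_image_eq:
  assumes "h ` carrier G = carrier H"
  shows "h ` lcs G n = lcs H n"
proof (induction n)
  case 0
  show ?case by (simp add: assms)
next
  case (Suc n)
  let ?C = "\<Union>k\<in>lcs G n. \<Union>g\<in>carrier G. {k \<otimes> g \<otimes> inv k \<otimes> inv g}"
  have C: "?C \<subseteq> carrier G" using G.lcs_closed by auto
  have "h ` ?C = (\<Union>k\<in>lcs G n. \<Union>g\<in>carrier G. {h k \<otimes>\<^bsub>H\<^esub> h g \<otimes>\<^bsub>H\<^esub> inv\<^bsub>H\<^esub> h k \<otimes>\<^bsub>H\<^esub> inv\<^bsub>H\<^esub> h g})"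
    using G.lcs_closed by (auto simp: image_UN)
  also have "\<dots> = (\<Union>k\<in>h ` lcs G n. \<Union>g\<in>h ` carrier G. {k \<otimes>\<^bsub>H\<^esub> g \<otimes>\<^bsub>H\<^esub> inv\<^bsub>H\<^esub> k \<otimes>\<^bsub>H\<^esub> inv\<^bsub>H\<^esub> g})"
    by simp
  finally show ?case
    using generate_img[OF C] Suc assms by (simp add: lcs.simps(2))
qed

lemma nu_map_rcos:
  assumes "x \<in> carrier G"
  shows "nu_map H n h (lcs G n #> x) = lcs H n #>\<^bsub>H\<^esub> h x"
  unfolding nu_map_def
  by (rule coset_map_rcos[OF group_hom_axioms G.lcs_subgroup H.lcs_normal lcs_image_subset assms])

lemma nu_map_hom: "group_hom (nu n G) (nu n H) (nu_map H n h)"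
  unfolding nu_map_def nu_def
  by (rule coset_map_hom[OF group_hom_axioms G.lcs_normal H.lcs_normal lcs_image_subset])

end

context group
begin

lemma id_group_hom: "group_hom G G (\<lambda>x. x)"
  by (simp add: group_hom_def group_hom_axioms_def hom_def)

lemma nu_proj_rcos:
  assumes "x \<in> carrier G"
  shows "nu_proj G n (lcs G (Suc n) #> x) = lcs G n #> x"
  unfolding nu_proj_def
  by (rule coset_map_rcos[OF id_group_hom lcs_subgroup lcs_normal _ assms]) (use lcs_Suc_subset in auto)

lemma nu_proj_hom: "group_hom (nu (Suc n) G) (nu n G) (nu_proj G n)"
  unfolding nu_proj_def nu_def
  by (rule coset_map_hom[OF id_group_hom lcs_normal lcs_normal]) (use lcs_Suc_subset in auto)

lemma nu_proj_surj: "nu_proj G n ` carrier (nu (Suc n) G) = carrier (nu n G)"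
  unfolding carrier_nu image_image by (rule image_cong[OF refl nu_proj_rcos])

end

section \<open>Limits of towers of groups\<close>

locale group_tower =
  fixes A :: "nat \<Rightarrow> 'a monoid" and p :: "nat \<Rightarrow> 'a \<Rightarrow> 'a"
  assumes tower_hom: "group_hom (A (Suc n)) (A n) (p n)"
begin

abbreviation "L \<equiv> inv_limit A p"

lemma tower_group: "group (A n)"
  using tower_hom[of n] by (simp add: group_hom_def)

lemma p_closed: "x \<in> carrier (A (Suc n)) \<Longrightarrow> p n x \<in> carrier (A n)"
  using tower_hom[of n] by (simp add: group_hom.hom_closed)

lemma p_mult: "x \<in> carrier (A (Suc n)) \<Longrightarrow> y \<in> carrier (A (Suc n)) \<Longrightarrow>
   p n (x \<otimes>\<^bsub>A (Suc n)\<^esub> y) = p n x \<otimes>\<^bsub>A n\<^esub> p n y"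
  using tower_hom[of n] by (simp add: group_hom.hom_mult)

lemma p_inv: "x \<in> carrier (A (Suc n)) \<Longrightarrow> p n (inv\<^bsub>A (Suc n)\<^esub> x) = inv\<^bsub>A n\<^esub> p n x"
  using tower_hom[of n] by (simp add: group_hom.hom_inv)

lemma p_one: "p n \<one>\<^bsub>A (Suc n)\<^esub> = \<one>\<^bsub>A n\<^esub>"
  using tower_hom[of n] by (simp add: group_hom.hom_one)

lemma carrier_lim: "carrier L = {x. \<forall>n. x n \<in> carrier (A n) \<and> p n (x (Suc n)) = x n}"
  by (auto simp: inv_limit_def)

text \<open>\<open>product_group\<close> restricts functions to its index set; over
  \<open>UNIV\<close> the \<open>restrict\<close> is the identity, so the operations are plain
  pointwise ones.\<close>

lemma mult_lim: "x \<otimes>\<^bsub>L\<^esub> y = (\<lambda>n. x n \<otimes>\<^bsub>A n\<^esub> y n)"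
  by (simp add: inv_limit_def restrict_def)

lemma one_lim: "\<one>\<^bsub>L\<^esub> = (\<lambda>n. \<one>\<^bsub>A n\<^esub>)"
  by (simp add: inv_limit_def restrict_def)

lemma lim_group: "group L"
proof (rule groupI)
  note g = group.is_monoid[OF tower_group] tower_group
  show "x \<otimes>\<^bsub>L\<^esub> y \<in> carrier L"
    if "x \<in> carrier L" "y \<in> carrier L" for x y
    using that by (auto simp: carrier_lim mult_lim p_mult monoid.m_closed[OF g(1)])
  show "\<one>\<^bsub>L\<^esub> \<in> carrier L"
    by (auto simp: carrier_lim one_lim p_one monoid.one_closed[OF g(1)])
  show "x \<otimes>\<^bsub>L\<^esub> y \<otimes>\<^bsub>L\<^esub> z = x \<otimes>\<^bsub>L\<^esub> (y \<otimes>\<^bsub>L\<^esub> z)"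
    if "x \<in> carrier L" "y \<in> carrier L" "z \<in> carrier L" for x y z
    using that by (auto simp: carrier_lim mult_lim monoid.m_assoc[OF g(1)])
  show "\<one>\<^bsub>L\<^esub> \<otimes>\<^bsub>L\<^esub> x = x" if "x \<in> carrier L" for x
    using that by (auto simp: carrier_lim mult_lim one_lim monoid.l_one[OF g(1)])
  show "\<exists>y\<in>carrier L. y \<otimes>\<^bsub>L\<^esub> x = \<one>\<^bsub>L\<^esub>"
    if "x \<in> carrier L" for x
    by (rule bexI[of _ "\<lambda>n. inv\<^bsub>A n\<^esub> x n"])
      (use that in \<open>auto simp: carrier_lim mult_lim one_lim p_inv group.l_inv[OF g(2)] group.inv_closed[OF g(2)]\<close>)
qed

lemma inv_lim:
  assumes "x \<in> carrier L"
  shows "inv\<^bsub>L\<^esub> x = (\<lambda>n. inv\<^bsub>A n\<^esub> x n)"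
proof (rule group.inv_equality[OF lim_group _ assms])
  show "(\<lambda>n. inv\<^bsub>A n\<^esub> x n) \<otimes>\<^bsub>L\<^esub> x = \<one>\<^bsub>L\<^esub>"
    using assms by (auto simp: carrier_lim mult_lim one_lim group.l_inv[OF tower_group])
  show "(\<lambda>n. inv\<^bsub>A n\<^esub> x n) \<in> carrier L"
    using assms by (auto simp: carrier_lim p_inv group.inv_closed[OF tower_group])
qed

end

section \<open>The pronilpotent completion in terms of representatives\<close>

text \<open>Elements of the completion are handled through sequences of representatives. Terms n and
  n + 1 have to agree only modulo \<open>lcs G n\<close>, since component n of the limit lives in
  \<open>nu n G\<close>.\<close>

definition coherent :: "('a, 'b) monoid_scheme \<Rightarrow> (nat \<Rightarrow> 'a) \<Rightarrow> bool" where
  "coherent G t \<longleftrightarrow> (\<forall>n. t n \<in> carrier G \<and> lcs G n #>\<^bsub>G\<^esub> t (Suc n) = lcs G n #>\<^bsub>G\<^esub> t n)"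

definition pro_class :: "('a, 'b) monoid_scheme \<Rightarrow> (nat \<Rightarrow> 'a) \<Rightarrow> nat \<Rightarrow> 'a set" where
  "pro_class G t = (\<lambda>n. lcs G n #>\<^bsub>G\<^esub> t n)"

context group
begin

lemma pronil_tower: "group_tower (\<lambda>n. nu n G) (nu_proj G)"
  by (simp add: group_tower_def nu_proj_hom)

lemma pronil_group: "group (pronil G)"
  unfolding pronil_def by (rule group_tower.lim_group[OF pronil_tower])

lemma carrier_pronil: "carrier (pronil G) = {x. \<forall>n. x n \<in> carrier (nu n G) \<and> nu_proj G n (x (Suc n)) = x n}"
  unfolding pronil_def by (rule group_tower.carrier_lim[OF pronil_tower])

lemma mult_pronil: "x \<otimes>\<^bsub>pronil G\<^esub> y = (\<lambda>n. x n \<otimes>\<^bsub>nu n G\<^esub> y n)"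
  unfolding pronil_def by (rule group_tower.mult_lim[OF pronil_tower])

lemma one_pronil: "\<one>\<^bsub>pronil G\<^esub> = lcs G"
  unfolding pronil_def by (simp add: group_tower.one_lim[OF pronil_tower] one_nu)

lemma inv_pronil: "x \<in> carrier (pronil G) \<Longrightarrow> inv\<^bsub>pronil G\<^esub> x = (\<lambda>n. inv\<^bsub>nu n G\<^esub> x n)"
  unfolding pronil_def by (rule group_tower.inv_lim[OF pronil_tower])

lemma coherent_closed: "coherent G t \<Longrightarrow> t n \<in> carrier G"
  by (simp add: coherent_def)

lemma pro_class_closed:
  assumes "coherent G t"
  shows "pro_class G t \<in> carrier (pronil G)"
  using assms by (auto simp: carrier_pronil pro_class_def carrier_nu coherent_def nu_proj_rcos)

lemma pro_classE:
  assumes "z \<in> carrier (pronil G)"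
  obtains t where "coherent G t" "z = pro_class G t"
proof -
  have "\<forall>n. \<exists>t\<in>carrier G. z n = lcs G n #> t"
    using assms unfolding carrier_pronil carrier_nu by blast
  then obtain t where t: "\<And>n. t n \<in> carrier G" "\<And>n. z n = lcs G n #> t n"
    by metis
  have "lcs G n #> t (Suc n) = lcs G n #> t n" for n
    using assms t[of n] t[of "Suc n"] nu_proj_rcos[OF t(1), of n "Suc n"]
    unfolding carrier_pronil mem_Collect_eq by metis
  then have "coherent G t" using t by (simp add: coherent_def)
  moreover have "z = pro_class G t" using t by (auto simp: pro_class_def)
  ultimately show ?thesis using that by blast
qed

lemma coherent_mult:
  assumes "coherent G t" "coherent G u"
  shows "coherent G (\<lambda>n. t n \<otimes> u n)"
proof -
  have "lcs G n #> (t (Suc n) \<otimes> u (Suc n)) = lcs G n #> (t n \<otimes> u n)" for n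
    using assms group_hom.hom_mult[OF nu_hom[of n]] by (metis coherent_def)
  then show ?thesis using assms by (simp add: coherent_def)
qed

lemma coherent_inv:
  assumes "coherent G t"
  shows "coherent G (\<lambda>n. inv t n)"
proof -
  have "lcs G n #> (inv t (Suc n)) = lcs G n #> (inv t n)" for n
    using assms group_hom.hom_inv[OF nu_hom[of n]] by (metis coherent_def)
  then show ?thesis using assms by (simp add: coherent_def)
qed

lemma coherent_const: "x \<in> carrier G \<Longrightarrow> coherent G (\<lambda>n. x)"
  by (simp add: coherent_def)

text \<open>Any later term represents an earlier component. This permits passing to shifted
  sequences without changing the element of the completion.\<close>

lemma coherent_le:
  assumes "coherent G t" "n \<le> m"
  shows "lcs G n #> t m = lcs G n #> t n"
  using assms(2)
proof (induction m rule: dec_induct)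
  case (step m)
  have "lcs G n #> t (Suc m) = lcs G n #> t m"
    using assms(1) lcs_rcos_antimono[of m "t (Suc m)" "t m" n] step by (simp add: coherent_def)
  then show ?case using step by simp
qed simp

lemma pro_class_mult:
  assumes "coherent G t" "coherent G u"
  shows "pro_class G t \<otimes>\<^bsub>pronil G\<^esub> pro_class G u = pro_class G (\<lambda>n. t n \<otimes> u n)"
  using assms group_hom.hom_mult[OF nu_hom]
  by (auto simp: mult_pronil pro_class_def coherent_def)

lemma pro_class_inv:
  assumes "coherent G t"
  shows "inv\<^bsub>pronil G\<^esub> pro_class G t = pro_class G (\<lambda>n. inv t n)"
  using assms group_hom.hom_inv[OF nu_hom] pro_class_closed[OF assms]
  by (auto simp: inv_pronil pro_class_def coherent_def)

lemma to_pronil_eq: "to_pronil G g = pro_class G (\<lambda>n. g)"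
  by (simp add: to_pronil_def pro_class_def)

lemma to_pronil_hom: "group_hom G (pronil G) (to_pronil G)"
  using pro_class_closed coherent_const pro_class_mult
  by (auto simp: group_hom_def group_hom_axioms_def pronil_group to_pronil_eq intro!: homI)

lemma pronil_nu_hom: "group_hom (pronil G) (nu n G) (\<lambda>z. z n)"
  by (auto simp: group_hom_def group_hom_axioms_def pronil_group nu_group mult_pronil carrier_pronil intro!: homI)

end

context group_hom
begin

lemma coherent_image:
  assumes "coherent G t"
  shows "coherent H (\<lambda>n. h (t n))"
  unfolding coherent_def
proof
  fix n
  have t: "t n \<in> carrier G" "t (Suc n) \<in> carrier G" "lcs G n #> t (Suc n) = lcs G n #> t n"
    using assms by (simp_all add: coherent_def)
  then show "h (t n) \<in> carrier H \<and> lcs H n #>\<^bsub>H\<^esub> h (t (Suc n)) = lcs H n #>\<^bsub>H\<^esub> h (t n)"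
    using nu_map_rcos[of "t n" n] nu_map_rcos[of "t (Suc n)" n] by simp
qed

end

section \<open>Simplicial groups in dimensions at most two\<close>

text \<open>The faces and degeneracies between dimensions 0 and 1 are \<open>d0\<close>, \<open>d1\<close> and \<open>s\<close>; those between
  dimensions 1 and 2 are \<open>e0\<close>, \<open>e1\<close>, \<open>e2\<close> and \<open>t0\<close>, \<open>t1\<close>.\<close>

locale trunc_sgroup =
  fixes F0 :: "('a, 'x) monoid_scheme" and F1 :: "('b, 'y) monoid_scheme"
    and F2 :: "('c, 'z) monoid_scheme"
    and d0 d1 e0 e1 e2 s t0 t1
  assumes d0_hom: "group_hom F1 F0 d0" and d1_hom: "group_hom F1 F0 d1"
    and e0_hom: "group_hom F2 F1 e0" and e1_hom: "group_hom F2 F1 e1" and e2_hom: "group_hom F2 F1 e2"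
    and s_hom: "group_hom F0 F1 s" and t0_hom: "group_hom F1 F2 t0" and t1_hom: "group_hom F1 F2 t1"
    and d_s: "x \<in> carrier F0 \<Longrightarrow> d0 (s x) = x" "x \<in> carrier F0 \<Longrightarrow> d1 (s x) = x"
    and e_t0: "y \<in> carrier F1 \<Longrightarrow> e0 (t0 y) = y" "y \<in> carrier F1 \<Longrightarrow> e1 (t0 y) = y"
      "y \<in> carrier F1 \<Longrightarrow> e2 (t0 y) = s (d1 y)"
    and e_t1: "y \<in> carrier F1 \<Longrightarrow> e0 (t1 y) = s (d0 y)" "y \<in> carrier F1 \<Longrightarrow> e1 (t1 y) = y"
      "y \<in> carrier F1 \<Longrightarrow> e2 (t1 y) = y"
    and d_e: "w \<in> carrier F2 \<Longrightarrow> d0 (e1 w) = d0 (e0 w)" "w \<in> carrier F2 \<Longrightarrow> d0 (e2 w) = d1 (e0 w)"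
      "w \<in> carrier F2 \<Longrightarrow> d1 (e2 w) = d1 (e1 w)"
begin

sublocale F0: group F0 using d0_hom by (simp add: group_hom_def)
sublocale F1: group F1 using d0_hom by (simp add: group_hom_def)
sublocale F2: group F2 using e0_hom by (simp add: group_hom_def)
sublocale d0: group_hom F1 F0 d0 by (rule d0_hom)
sublocale d1: group_hom F1 F0 d1 by (rule d1_hom)
sublocale e0: group_hom F2 F1 e0 by (rule e0_hom)
sublocale e1: group_hom F2 F1 e1 by (rule e1_hom)
sublocale e2: group_hom F2 F1 e2 by (rule e2_hom)
sublocale s: group_hom F0 F1 s by (rule s_hom)
sublocale t0: group_hom F1 F2 t0 by (rule t0_hom)
sublocale t1: group_hom F1 F2 t1 by (rule t1_hom)

text \<open>The Moore complex in low dimensions: \<open>N1\<close> and \<open>N2\<close> are its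
  chains, \<open>Z1\<close> the 1-cycles, \<open>B0\<close> and \<open>B1\<close> the boundaries.
  The last face is the differential, so F_0 / \<open>B0\<close> and \<open>Z1\<close> /
  \<open>B1\<close> are pi_0 and pi_1.\<close>

definition N1 where "N1 = {y \<in> carrier F1. d0 y = \<one>\<^bsub>F0\<^esub>}"
definition Z1 where "Z1 = {y \<in> N1. d1 y = \<one>\<^bsub>F0\<^esub>}"
definition N2 where "N2 = {w \<in> carrier F2. e0 w = \<one>\<^bsub>F1\<^esub> \<and> e1 w = \<one>\<^bsub>F1\<^esub>}"
definition B1 where "B1 = e2 ` N2"
definition B0 where "B0 = d1 ` N1"

lemma N1_I: "y \<in> carrier F1 \<Longrightarrow> d0 y = \<one>\<^bsub>F0\<^esub> \<Longrightarrow> y \<in> N1"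
  by (simp add: N1_def)

lemma N1_D: assumes "y \<in> N1" shows "y \<in> carrier F1" "d0 y = \<one>\<^bsub>F0\<^esub>"
  using assms by (simp_all add: N1_def)

lemma Z1_D: assumes "y \<in> Z1" shows "y \<in> carrier F1" "d0 y = \<one>\<^bsub>F0\<^esub>" "d1 y = \<one>\<^bsub>F0\<^esub>" "y \<in> N1"
  using assms by (simp_all add: Z1_def N1_def)

lemma N2_I: "w \<in> carrier F2 \<Longrightarrow> e0 w = \<one>\<^bsub>F1\<^esub> \<Longrightarrow> e1 w = \<one>\<^bsub>F1\<^esub> \<Longrightarrow> w \<in> N2"
  by (simp add: N2_def)

lemma N2_D: assumes "w \<in> N2" shows "w \<in> carrier F2" "e0 w = \<one>\<^bsub>F1\<^esub>" "e1 w = \<one>\<^bsub>F1\<^esub>"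
  using assms by (simp_all add: N2_def)

lemma N1_mult: "x \<in> N1 \<Longrightarrow> y \<in> N1 \<Longrightarrow> x \<otimes>\<^bsub>F1\<^esub> y \<in> N1"
  by (simp add: N1_def)
lemma N1_inv: "x \<in> N1 \<Longrightarrow> inv\<^bsub>F1\<^esub> x \<in> N1"
  by (simp add: N1_def)
lemma N1_one: "\<one>\<^bsub>F1\<^esub> \<in> N1"
  by (simp add: N1_def)

lemma Z1_mult: "x \<in> Z1 \<Longrightarrow> y \<in> Z1 \<Longrightarrow> x \<otimes>\<^bsub>F1\<^esub> y \<in> Z1"
  by (simp add: Z1_def N1_def)
lemma Z1_inv: "x \<in> Z1 \<Longrightarrow> inv\<^bsub>F1\<^esub> x \<in> Z1"
  by (simp add: Z1_def N1_def)
lemma Z1_one: "\<one>\<^bsub>F1\<^esub> \<in> Z1"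
  by (simp add: Z1_def N1_def)

lemma Z1_subgroup: "subgroup Z1 F1"
  using Z1_mult Z1_inv Z1_one Z1_D(1) by (simp add: subgroup_def subset_iff)

lemma B1_I: "w \<in> N2 \<Longrightarrow> e2 w \<in> B1"
  by (simp add: B1_def)

lemma B1_E:
  assumes "b \<in> B1"
  obtains w where "w \<in> N2" "b = e2 w"
  using assms by (auto simp: B1_def)

lemma B0_I: "y \<in> N1 \<Longrightarrow> d1 y \<in> B0"
  by (simp add: B0_def)

lemma B0_E:
  assumes "b \<in> B0"
  obtains y where "y \<in> N1" "b = d1 y"
  using assms by (auto simp: B0_def)

lemma B1_Z1:
  assumes "b \<in> B1"
  shows "b \<in> Z1"
proof -
  obtain w where w: "w \<in> N2" "b = e2 w" using assms by (rule B1_E)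
  then show ?thesis using N2_D[OF w(1)] by (simp add: Z1_def N1_def d_e)
qed

text \<open>Conjugation by x in F_1 lifts to conjugation by \<open>t1 x\<close> in F_2, because
  \<open>e2 (t1 x)\<close> is x and \<open>N2\<close> is an intersection of kernels. Normality in
  all of F_1, beyond \<open>Z1\<close>, allows classes of arbitrary chains modulo
  \<open>B1\<close>.\<close>

lemma B1_normal: "B1 \<lhd> F1"
  unfolding F1.normal_inv_iff
proof (intro conjI ballI)
  show "subgroup B1 F1"
  proof (rule F1.subgroupI)
    show "B1 \<subseteq> carrier F1" using B1_Z1 Z1_D(1) by (simp add: subset_iff)
    have "\<one>\<^bsub>F2\<^esub> \<in> N2" by (simp add: N2_def)
    then show "B1 \<noteq> {}" by (auto simp: B1_def)
    fix a assume "a \<in> B1"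
    then obtain w where w: "w \<in> N2" "a = e2 w" by (rule B1_E)
    have "inv\<^bsub>F2\<^esub> w \<in> N2" using N2_D[OF w(1)] by (simp add: N2_def)
    from B1_I[OF this] show "inv\<^bsub>F1\<^esub> a \<in> B1" using N2_D[OF w(1)] w by simp
    fix b assume "b \<in> B1"
    then obtain v where v: "v \<in> N2" "b = e2 v" by (rule B1_E)
    have "w \<otimes>\<^bsub>F2\<^esub> v \<in> N2" using N2_D[OF w(1)] N2_D[OF v(1)] by (simp add: N2_def)
    from B1_I[OF this] show "a \<otimes>\<^bsub>F1\<^esub> b \<in> B1" using N2_D[OF w(1)] N2_D[OF v(1)] w v by simp
  qed
  fix x b assume x: "x \<in> carrier F1" and "b \<in> B1"
  then obtain w where w: "w \<in> N2" "b = e2 w" by (elim B1_E)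
  have "t1 x \<otimes>\<^bsub>F2\<^esub> w \<otimes>\<^bsub>F2\<^esub> inv\<^bsub>F2\<^esub> t1 x \<in> N2"
    using x N2_D[OF w(1)] by (simp add: N2_def e_t1)
  from B1_I[OF this] show "x \<otimes>\<^bsub>F1\<^esub> b \<otimes>\<^bsub>F1\<^esub> inv\<^bsub>F1\<^esub> x \<in> B1"
    using x w N2_D[OF w(1)] by (simp add: e_t1)
qed

text \<open>One dimension lower, conjugation by x lifts to conjugation by
  \<open>s x\<close>.\<close>

lemma B0_normal: "B0 \<lhd> F0"
  unfolding F0.normal_inv_iff
proof (intro conjI ballI)
  show "subgroup B0 F0"
  proof (rule F0.subgroupI)
    show "B0 \<subseteq> carrier F0" by (auto simp: B0_def N1_def)
    show "B0 \<noteq> {}" using N1_one by (auto simp: B0_def)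
    fix a assume "a \<in> B0"
    then obtain w where w: "w \<in> N1" "a = d1 w" by (rule B0_E)
    from B0_I[OF N1_inv[OF w(1)]] show "inv\<^bsub>F0\<^esub> a \<in> B0" using N1_D[OF w(1)] w by simp
    fix b assume "b \<in> B0"
    then obtain v where v: "v \<in> N1" "b = d1 v" by (rule B0_E)
    from B0_I[OF N1_mult[OF w(1) v(1)]] show "a \<otimes>\<^bsub>F0\<^esub> b \<in> B0"
      using N1_D[OF w(1)] N1_D[OF v(1)] w v by simp
  qed
  fix x b assume x: "x \<in> carrier F0" and "b \<in> B0"
  then obtain w where w: "w \<in> N1" "b = d1 w" by (elim B0_E)
  have "s x \<otimes>\<^bsub>F1\<^esub> w \<otimes>\<^bsub>F1\<^esub> inv\<^bsub>F1\<^esub> s x \<in> N1"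
    using x N1_D[OF w(1)] by (simp add: N1_def d_s)
  from B0_I[OF this] show "x \<otimes>\<^bsub>F0\<^esub> b \<otimes>\<^bsub>F0\<^esub> inv\<^bsub>F0\<^esub> x \<in> B0"
    using x w N1_D[OF w(1)] by (simp add: d_s)
qed

text \<open>The 1-simplex w is corrected to the Moore chain w^-1 \<open>s (d0 w)\<close>, whose
  inverse has boundary (d0 w)^-1 (d1 w). Conjugating by d0 w gives the quotient of the two
  faces.\<close>

lemma faces_B0_equal:
  assumes "w \<in> carrier F1"
  shows "B0 #>\<^bsub>F0\<^esub> d0 w = B0 #>\<^bsub>F0\<^esub> d1 w"
proof -
  have "inv\<^bsub>F1\<^esub> w \<otimes>\<^bsub>F1\<^esub> s (d0 w) \<in> N1" using assms by (simp add: N1_def d_s)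
  from B0_I[OF N1_inv[OF this]] have "inv\<^bsub>F0\<^esub> d0 w \<otimes>\<^bsub>F0\<^esub> d1 w \<in> B0"
    using assms by (simp add: d_s F1.inv_mult_group)
  then have "d1 w \<otimes>\<^bsub>F0\<^esub> inv\<^bsub>F0\<^esub> d0 w \<in> B0"
    using normal.inv_op_closed2[OF B0_normal, of "d0 w" "inv\<^bsub>F0\<^esub> d0 w \<otimes>\<^bsub>F0\<^esub> d1 w"] assms by simp
  then show ?thesis using normal.rcos_eq_iff[OF B0_normal, of "d1 w" "d0 w"] assms by simp
qed

text \<open>The Peiffer commutator \<open>[y, x]\<close> is the boundary of \<open>[t1 y, t1 x (t0 x)\<inverse>]\<close>.\<close>

lemma Peiffer:
  assumes y: "y \<in> N1" and x: "x \<in> carrier F1" "d1 x = \<one>\<^bsub>F0\<^esub>"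
  shows "F1.commutator y x \<in> B1"
proof -
  define v where "v = t1 x \<otimes>\<^bsub>F2\<^esub> inv\<^bsub>F2\<^esub> t0 x"
  have v: "v \<in> carrier F2" using x by (simp add: v_def)
  have "F2.commutator (t1 y) v \<in> N2"
  proof (rule N2_I)
    show "e0 (F2.commutator (t1 y) v) = \<one>\<^bsub>F1\<^esub>"
      using v N1_D[OF y] by (simp add: e_t1)
    have "e1 v = \<one>\<^bsub>F1\<^esub>" using x by (simp add: v_def e_t0 e_t1)
    then show "e1 (F2.commutator (t1 y) v) = \<one>\<^bsub>F1\<^esub>"
      using v N1_D[OF y] by simp
  qed (use v N1_D[OF y] in simp)
  moreover have "e2 (F2.commutator (t1 y) v) = F1.commutator y x"
    using x v N1_D[OF y] by (simp add: v_def e_t0 e_t1)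
  ultimately show ?thesis using B1_I by force
qed

text \<open>Peiffer commutators are boundaries, so a cycle is central in \<open>N1\<close> modulo
  \<open>B1\<close>, as for the kernel of a crossed module. Besides making pi_1 abelian, this makes
  the gaps between chains multiplicative later on.\<close>

lemma Z1_N1_comm:
  assumes x: "x \<in> Z1" and y: "y \<in> N1"
  shows "B1 #>\<^bsub>F1\<^esub> (x \<otimes>\<^bsub>F1\<^esub> y) = B1 #>\<^bsub>F1\<^esub> (y \<otimes>\<^bsub>F1\<^esub> x)"
proof -
  note c = Z1_D[OF x] N1_D[OF y]
  have "(y \<otimes>\<^bsub>F1\<^esub> x) \<otimes>\<^bsub>F1\<^esub> inv\<^bsub>F1\<^esub> (x \<otimes>\<^bsub>F1\<^esub> y) = F1.commutator y x"
    using c by (simp add: F1.inv_mult_group F1.m_assoc)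
  then have "B1 #>\<^bsub>F1\<^esub> (y \<otimes>\<^bsub>F1\<^esub> x) = B1 #>\<^bsub>F1\<^esub> (x \<otimes>\<^bsub>F1\<^esub> y)"
    using Peiffer[OF y c(1,3)] normal.rcos_eq_iff[OF B1_normal, of "y \<otimes>\<^bsub>F1\<^esub> x" "x \<otimes>\<^bsub>F1\<^esub> y"] c by simp
  then show ?thesis by simp
qed

text \<open>Products in pi_1 are computed in the larger group F_1 / \<open>B1\<close>, where chains
  that are not cycles have classes too.\<close>

sublocale q: group_hom F1 "F1 Mod B1" "r_coset F1 B1"
  by (rule normal.rcos_hom[OF B1_normal])

abbreviation "pi1 \<equiv> F1\<lparr>carrier := Z1\<rparr> Mod B1"

lemma carrier_pi1: "carrier pi1 = r_coset F1 B1 ` Z1"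
  by (simp add: carrier_FactGroup r_coset_def)

lemma mult_pi1: "(\<otimes>\<^bsub>pi1\<^esub>) = (\<otimes>\<^bsub>F1 Mod B1\<^esub>)"
  by (simp add: set_mult_def fun_eq_iff)

lemma pi1_comm_group: "comm_group pi1"
proof -
  have sub: "subgroup (r_coset F1 B1 ` Z1) (F1 Mod B1)"
    by (rule q.subgroup_img_is_subgroup[OF Z1_subgroup])
  have eq: "pi1 = (F1 Mod B1)\<lparr>carrier := r_coset F1 B1 ` Z1\<rparr>"
    by (rule monoid.equality) (simp_all add: carrier_pi1 mult_pi1 set_mult_def fun_eq_iff)
  have "group pi1" unfolding eq by (rule subgroup.subgroup_is_group[OF sub q.H.group_axioms])
  then show ?thesis
  proof (rule group.group_comm_groupI)
    fix x y assume "x \<in> carrier pi1" "y \<in> carrier pi1"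
    then obtain a b where ab: "a \<in> Z1" "x = r_coset F1 B1 a" "b \<in> Z1" "y = r_coset F1 B1 b"
      unfolding carrier_pi1 by (elim imageE)
    show "x \<otimes>\<^bsub>pi1\<^esub> y = y \<otimes>\<^bsub>pi1\<^esub> x"
      unfolding mult_pi1 ab(2,4)
      using Z1_N1_comm[OF ab(1) Z1_D(4)[OF ab(3)]] Z1_D(1)[OF ab(1)] Z1_D(1)[OF ab(3)]
        q.hom_mult[of a b] q.hom_mult[of b a] by simp
  qed
qed

lemma one_pi1: "\<one>\<^bsub>pi1\<^esub> = r_coset F1 B1 \<one>\<^bsub>F1\<^esub>"
  using q.hom_one by simp

lemma inv_pi1:
  assumes "x \<in> Z1"
  shows "inv\<^bsub>pi1\<^esub> (r_coset F1 B1 x) = r_coset F1 B1 (inv\<^bsub>F1\<^esub> x)"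
proof (rule group.inv_equality)
  show "group pi1" using pi1_comm_group by (simp add: comm_group_def)
  show "r_coset F1 B1 x \<in> carrier pi1" "r_coset F1 B1 (inv\<^bsub>F1\<^esub> x) \<in> carrier pi1"
    unfolding carrier_pi1 using assms Z1_inv[OF assms] by (auto intro: imageI)
  show "r_coset F1 B1 (inv\<^bsub>F1\<^esub> x) \<otimes>\<^bsub>pi1\<^esub> r_coset F1 B1 x = \<one>\<^bsub>pi1\<^esub>"
    unfolding mult_pi1 one_pi1 using Z1_D(1)[OF assms] q.hom_mult[of "inv\<^bsub>F1\<^esub> x" x] by simp
qed

end

section \<open>The derived limit\<close>

locale abelian_tower = group_tower +
  assumes comm: "comm_group (A n)"
begin

abbreviation "P \<equiv> product_group UNIV A"

definition lim1_rel where
  "lim1_rel = (\<lambda>x n. x n \<otimes>\<^bsub>A n\<^esub> inv\<^bsub>A n\<^esub> p n (x (Suc n))) ` carrier P"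

lemma carrier_P: "x \<in> carrier P \<longleftrightarrow> (\<forall>n. x n \<in> carrier (A n))"
  by auto

lemma mult_P: "x \<otimes>\<^bsub>P\<^esub> y = (\<lambda>n. x n \<otimes>\<^bsub>A n\<^esub> y n)"
  by (simp add: restrict_def)

lemma P_group: "group P"
  by (rule product_group) (rule tower_group)

lemma P_comm_group: "comm_group P"
proof (rule group.group_comm_groupI[OF P_group])
  fix x y assume "x \<in> carrier P" "y \<in> carrier P"
  then show "x \<otimes>\<^bsub>P\<^esub> y = y \<otimes>\<^bsub>P\<^esub> x"
    unfolding mult_P carrier_P using comm by (simp add: comm_groupE(4))
qed

text \<open>Commutativity of the groups makes the difference of identity and shift a homomorphism,
  so its image is a subgroup; in an abelian product every subgroup is normal.\<close>

lemma lim1_rel_normal: "lim1_rel \<lhd> P"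
proof -
  let ?f = "\<lambda>x n. x n \<otimes>\<^bsub>A n\<^esub> inv\<^bsub>A n\<^esub> p n (x (Suc n))"
  have "?f \<in> hom P P"
  proof (rule homI)
    fix x y assume x: "x \<in> carrier P" and y: "y \<in> carrier P"
    show "?f x \<in> carrier P"
      using x unfolding carrier_P
      by (simp add: p_closed tower_group group.inv_closed group.is_monoid monoid.m_closed)
    show "?f (x \<otimes>\<^bsub>P\<^esub> y) = ?f x \<otimes>\<^bsub>P\<^esub> ?f y"
    proof
      fix n
      interpret comm_group "A n" by (rule comm)
      have "x n \<in> carrier (A n)" "y n \<in> carrier (A n)"
        "x (Suc n) \<in> carrier (A (Suc n))" "y (Suc n) \<in> carrier (A (Suc n))"
        using x y unfolding carrier_P by simp_all
      then show "?f (x \<otimes>\<^bsub>P\<^esub> y) n = (?f x \<otimes>\<^bsub>P\<^esub> ?f y) n"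
        unfolding mult_P by (simp add: p_mult p_closed inv_mult m_ac)
    qed
  qed
  then have "group_hom P P ?f"
    by (simp only: group_hom_def group_hom_axioms_def P_group simp_thms)
  then have "subgroup lim1_rel P"
    unfolding lim1_rel_def by (rule group_hom.img_is_subgroup)
  then show ?thesis by (simp only: comm_group.normal_iff_subgroup[OF P_comm_group])
qed

lemma lim1_eq: "lim1 A p = P Mod lim1_rel"
  by (simp add: lim1_def lim1_rel_def)

lemma lim1_hom: "group_hom P (lim1 A p) (r_coset P lim1_rel)"
  unfolding lim1_eq by (rule normal.rcos_hom[OF lim1_rel_normal])

lemma lim1_carrier: "carrier (lim1 A p) = r_coset P lim1_rel ` carrier P"
  unfolding lim1_eq carrier_FactGroup ..

lemma lim1_rcos_eq_iff:
  assumes "x \<in> carrier P" "y \<in> carrier P"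
  shows "r_coset P lim1_rel x = r_coset P lim1_rel y \<longleftrightarrow> x \<otimes>\<^bsub>P\<^esub> inv\<^bsub>P\<^esub> y \<in> lim1_rel"
  by (rule normal.rcos_eq_iff[OF lim1_rel_normal assms])

end

section \<open>Milnor's sequence\<close>

text \<open>Surjectivity of the tower maps in dimensions 1 and 2 gives lifts of 1-chains, 2-chains
  and 1-boundaries along the tower: the fibration property behind Milnor's sequence.\<close>

locale sgroup_tower =
  fixes F0 :: "nat \<Rightarrow> 'a monoid" and F1 :: "nat \<Rightarrow> 'b monoid" and F2 :: "nat \<Rightarrow> 'c monoid"
    and d0 d1 e0 e1 e2 s t0 t1 p0 p1 p2
  assumes sg: "trunc_sgroup (F0 n) (F1 n) (F2 n) (d0 n) (d1 n) (e0 n) (e1 n) (e2 n) (s n) (t0 n) (t1 n)"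
    and p0_hom: "group_hom (F0 (Suc n)) (F0 n) (p0 n)"
    and p1_hom: "group_hom (F1 (Suc n)) (F1 n) (p1 n)"
    and p2_hom: "group_hom (F2 (Suc n)) (F2 n) (p2 n)"
    and p1_surj: "p1 n ` carrier (F1 (Suc n)) = carrier (F1 n)"
    and p2_surj: "p2 n ` carrier (F2 (Suc n)) = carrier (F2 n)"
    and p_d: "y \<in> carrier (F1 (Suc n)) \<Longrightarrow> p0 n (d0 (Suc n) y) = d0 n (p1 n y)"
      "y \<in> carrier (F1 (Suc n)) \<Longrightarrow> p0 n (d1 (Suc n) y) = d1 n (p1 n y)"
    and p_e: "w \<in> carrier (F2 (Suc n)) \<Longrightarrow> p1 n (e0 (Suc n) w) = e0 n (p2 n w)"
      "w \<in> carrier (F2 (Suc n)) \<Longrightarrow> p1 n (e1 (Suc n) w) = e1 n (p2 n w)"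
      "w \<in> carrier (F2 (Suc n)) \<Longrightarrow> p1 n (e2 (Suc n) w) = e2 n (p2 n w)"
    and p_s: "x \<in> carrier (F0 (Suc n)) \<Longrightarrow> p1 n (s (Suc n) x) = s n (p0 n x)"
    and p_t: "y \<in> carrier (F1 (Suc n)) \<Longrightarrow> p2 n (t0 (Suc n) y) = t0 n (p1 n y)"
      "y \<in> carrier (F1 (Suc n)) \<Longrightarrow> p2 n (t1 (Suc n) y) = t1 n (p1 n y)"
begin

sublocale S: trunc_sgroup "F0 n" "F1 n" "F2 n" "d0 n" "d1 n" "e0 n" "e1 n" "e2 n" "s n" "t0 n" "t1 n" for n
  by (rule sg)
sublocale p0: group_hom "F0 (Suc n)" "F0 n" "p0 n" for n by (rule p0_hom)
sublocale p1: group_hom "F1 (Suc n)" "F1 n" "p1 n" for n by (rule p1_hom)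
sublocale p2: group_hom "F2 (Suc n)" "F2 n" "p2 n" for n by (rule p2_hom)
sublocale T0: group_tower F0 p0 by (simp add: group_tower_def p0_hom)
sublocale T1: group_tower F1 p1 by (simp add: group_tower_def p1_hom)

lemma p1_N1: "y \<in> S.N1 (Suc n) \<Longrightarrow> p1 n y \<in> S.N1 n"
  by (simp add: S.N1_def p_d(1)[symmetric])

lemma p1_Z1: "y \<in> S.Z1 (Suc n) \<Longrightarrow> p1 n y \<in> S.Z1 n"
  by (simp add: S.Z1_def S.N1_def p_d[symmetric])

lemma p1_B1:
  assumes "b \<in> S.B1 (Suc n)"
  shows "p1 n b \<in> S.B1 n"
proof -
  obtain w where w: "w \<in> S.N2 (Suc n)" "b = e2 (Suc n) w" using assms by (rule S.B1_E)
  note wc = S.N2_D[OF w(1)]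
  have "p2 n w \<in> S.N2 n" using wc by (simp add: S.N2_def p_e[symmetric])
  from S.B1_I[OF this] show ?thesis using w wc by (simp add: p_e)
qed

text \<open>An arbitrary preimage v becomes a Moore chain after division by \<open>s (d0 v)\<close>;
  this factor maps to the neutral element since d0 y is trivial.\<close>

lemma lift_N1:
  assumes "y \<in> S.N1 n"
  obtains y' where "y' \<in> S.N1 (Suc n)" "p1 n y' = y"
proof -
  note y = S.N1_D[OF assms]
  obtain v where v: "v \<in> carrier (F1 (Suc n))" "p1 n v = y"
    using p1_surj[of n] y(1) by (metis imageE)
  let ?y = "v \<otimes>\<^bsub>F1 (Suc n)\<^esub> inv\<^bsub>F1 (Suc n)\<^esub> s (Suc n) (d0 (Suc n) v)"
  have "?y \<in> S.N1 (Suc n)" using v(1) by (simp add: S.N1_def S.d_s)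
  moreover have "p1 n ?y = y" using v y by (simp add: p_s p_d)
  ultimately show ?thesis by (rule that)
qed

text \<open>The two faces are killed one after the other, with the degeneracies \<open>t0\<close>
  and \<open>t1\<close>; the correcting factors map to the neutral element because w is a Moore
  chain.\<close>

lemma lift_N2:
  assumes "w \<in> S.N2 n"
  obtains w' where "w' \<in> S.N2 (Suc n)" "p2 n w' = w"
proof -
  note w = S.N2_D[OF assms]
  obtain v where v: "v \<in> carrier (F2 (Suc n))" "p2 n v = w"
    using p2_surj[of n] w(1) by (metis imageE)
  let ?u = "v \<otimes>\<^bsub>F2 (Suc n)\<^esub> inv\<^bsub>F2 (Suc n)\<^esub> t0 (Suc n) (e0 (Suc n) v)"
  have "?u \<in> carrier (F2 (Suc n))" "p2 n ?u = w" "e0 (Suc n) ?u = \<one>\<^bsub>F1 (Suc n)\<^esub>"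
    using v w by (simp_all add: p_t p_e S.e_t0)
  then obtain u where u: "u \<in> carrier (F2 (Suc n))" "p2 n u = w" "e0 (Suc n) u = \<one>\<^bsub>F1 (Suc n)\<^esub>"
    by blast
  let ?w = "u \<otimes>\<^bsub>F2 (Suc n)\<^esub> inv\<^bsub>F2 (Suc n)\<^esub> t1 (Suc n) (e1 (Suc n) u)"
  \<comment> \<open>The second correction does not spoil the first: e0 of \<open>t1 (e1 u)\<close>
    is \<open>s (d0 (e1 u))\<close>, and d0 e1 = d0 e0, where e0 u is already trivial.\<close>
  have "d0 (Suc n) (e1 (Suc n) u) = \<one>\<^bsub>F0 (Suc n)\<^esub>"
    using u by (simp add: S.d_e(1))
  then have "?w \<in> S.N2 (Suc n)" using u by (simp add: S.N2_def S.e_t1)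
  moreover have "p2 n ?w = w"
    using u w by (simp add: p_t p_e)
  ultimately show ?thesis by (rule that)
qed

lemma lift_B1:
  assumes "b \<in> S.B1 n"
  obtains b' where "b' \<in> S.B1 (Suc n)" "p1 n b' = b"
proof -
  obtain w where w: "w \<in> S.N2 n" "b = e2 n w" using assms by (rule S.B1_E)
  obtain v where v: "v \<in> S.N2 (Suc n)" "p2 n v = w" using lift_N2[OF w(1)] .
  from S.B1_I[OF v(1)] show ?thesis by (rule that) (use v w S.N2_D[OF v(1)] p_e(3) in simp)
qed

abbreviation "cls n \<equiv> r_coset (F1 n) (S.B1 n)"

definition pi1_map where "pi1_map n = coset_map (F1 n) (S.B1 n) (p1 n)"

lemma pi1_map_cls:
  assumes "y \<in> S.Z1 (Suc n)"
  shows "pi1_map n (cls (Suc n) y) = cls n (p1 n y)"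
  unfolding pi1_map_def
  by (rule coset_map_rcos[OF p1_hom normal_imp_subgroup[OF S.B1_normal] S.B1_normal _ S.Z1_D(1)[OF assms]])
     (use p1_B1 in auto)

sublocale ab: abelian_tower "\<lambda>n. S.pi1 n" pi1_map
proof (intro abelian_tower.intro group_tower.intro abelian_tower_axioms.intro)
  fix n
  show "comm_group (S.pi1 n)" by (rule S.pi1_comm_group)
  have "pi1_map n \<in> hom (S.pi1 (Suc n)) (S.pi1 n)"
  proof (rule homI)
    fix x y assume "x \<in> carrier (S.pi1 (Suc n))" "y \<in> carrier (S.pi1 (Suc n))"
    then obtain a b where ab: "a \<in> S.Z1 (Suc n)" "x = cls (Suc n) a" "b \<in> S.Z1 (Suc n)" "y = cls (Suc n) b"
      unfolding S.carrier_pi1 by (elim imageE)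
    show "pi1_map n x \<in> carrier (S.pi1 n)"
      unfolding ab(2) pi1_map_cls[OF ab(1)] S.carrier_pi1 by (rule imageI[OF p1_Z1[OF ab(1)]])
    have "pi1_map n (cls (Suc n) (a \<otimes>\<^bsub>F1 (Suc n)\<^esub> b)) = cls n (p1 n a \<otimes>\<^bsub>F1 n\<^esub> p1 n b)"
      using pi1_map_cls[OF S.Z1_mult[OF ab(1,3)]] S.Z1_D(1)[OF ab(1)] S.Z1_D(1)[OF ab(3)] by simp
    then show "pi1_map n (x \<otimes>\<^bsub>S.pi1 (Suc n)\<^esub> y) = pi1_map n x \<otimes>\<^bsub>S.pi1 n\<^esub> pi1_map n y"
      unfolding S.mult_pi1 ab(2,4) pi1_map_cls[OF ab(1)] pi1_map_cls[OF ab(3)]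
      using S.q.hom_mult[OF S.Z1_D(1)[OF ab(1)] S.Z1_D(1)[OF ab(3)]]
        S.q.hom_mult[OF S.Z1_D(1)[OF p1_Z1[OF ab(1)]] S.Z1_D(1)[OF p1_Z1[OF ab(3)]]]
      by argo
  qed
  then show "group_hom (S.pi1 (Suc n)) (S.pi1 n) (pi1_map n)"
    using S.pi1_comm_group by (simp add: group_hom_def group_hom_axioms_def comm_group_def)
qed

end

text \<open>Centrality of cycles in the form that moves one past a chain at the head of a longer
  word.\<close>

lemma (in trunc_sgroup) Z1_N1_swap:
  assumes x: "x \<in> Z1" and y: "y \<in> N1" and a: "a \<in> carrier F1"
  shows "B1 #>\<^bsub>F1\<^esub> (y \<otimes>\<^bsub>F1\<^esub> x \<otimes>\<^bsub>F1\<^esub> a) = B1 #>\<^bsub>F1\<^esub> (x \<otimes>\<^bsub>F1\<^esub> y \<otimes>\<^bsub>F1\<^esub> a)"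
proof -
  note c = Z1_D(1)[OF x] N1_D(1)[OF y] a
  show ?thesis
    using c Z1_N1_comm[OF x y] q.hom_mult[of "y \<otimes>\<^bsub>F1\<^esub> x" a] q.hom_mult[of "x \<otimes>\<^bsub>F1\<^esub> y" a]
    by (simp only: F1.m_closed)
qed

section \<open>Chains over a compatible sequence of endpoints, and the connecting map\<close>

context sgroup_tower
begin

abbreviation "L0 \<equiv> inv_limit F0 p0"

abbreviation gap where "gap y n \<equiv> inv\<^bsub>F1 n\<^esub> p1 n (y (Suc n)) \<otimes>\<^bsub>F1 n\<^esub> y n"

text \<open>The chains need not be compatible themselves, only their ends are. Equality of the ends
  says that every \<open>gap\<close> is a cycle, so the incompatibility is measured by a sequence of
  classes in pi_1.\<close>

definition chains where
  "chains = {y. \<forall>n. y n \<in> S.N1 n \<and> d1 n (p1 n (y (Suc n))) = d1 n (y n)}"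

definition gap_class where "gap_class y = (\<lambda>n. cls n (gap y n))"

definition chain_end where "chain_end y = (\<lambda>n. d1 n (y n))"

text \<open>The boundaries of compatible chains: \<open>L0\<close> modulo \<open>LB\<close> is pi_0
  of the limit, whereas the end of a general element of \<open>chains\<close> is a boundary only
  componentwise.\<close>

definition LB where
  "LB = chain_end ` {w. \<forall>n. w n \<in> S.N1 n \<and> p1 n (w (Suc n)) = w n}"

definition delta where
  "delta \<xi> = {chain_end y | x y. x \<in> \<xi> \<and> (\<forall>n. y n \<in> S.N1 n \<and> gap y n \<in> x n)}"

lemma chainsD:
  assumes "y \<in> chains"
  shows "y n \<in> S.N1 n" "y n \<in> carrier (F1 n)" "p1 n (y (Suc n)) \<in> S.N1 n"
    "d1 n (p1 n (y (Suc n))) = d1 n (y n)" "gap y n \<in> S.Z1 n"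
proof -
  have y: "y k \<in> S.N1 k" "d1 k (p1 k (y (Suc k))) = d1 k (y k)" for k
    using assms by (simp_all add: chains_def)
  show "y n \<in> S.N1 n" "d1 n (p1 n (y (Suc n))) = d1 n (y n)" by (rule y)+
  show c: "y n \<in> carrier (F1 n)" by (rule S.N1_D(1)[OF y(1)])
  show p: "p1 n (y (Suc n)) \<in> S.N1 n" by (rule p1_N1[OF y(1)])
  show "gap y n \<in> S.Z1 n"
    unfolding S.Z1_def mem_Collect_eq
    using S.N1_mult[OF S.N1_inv[OF p] y(1)] y(2) S.N1_D(1)[OF p] c by simp
qed

lemma chain_end_closed:
  assumes "y \<in> chains"
  shows "chain_end y \<in> carrier L0"
proof -
  have "d1 n (y n) \<in> carrier (F0 n)" "p0 n (d1 (Suc n) (y (Suc n))) = d1 n (y n)" for n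
    using chainsD[OF assms] p_d(2)[OF chainsD(2)[OF assms]] by simp_all
  then show ?thesis by (simp add: T0.carrier_lim chain_end_def)
qed

lemma chains_mult:
  assumes "y \<in> chains" "z \<in> chains"
  shows "(\<lambda>n. y n \<otimes>\<^bsub>F1 n\<^esub> z n) \<in> chains"
    "chain_end (\<lambda>n. y n \<otimes>\<^bsub>F1 n\<^esub> z n) = chain_end y \<otimes>\<^bsub>L0\<^esub> chain_end z"
  using chainsD[OF assms(1)] chainsD[OF assms(2)] S.N1_D(1)
  by (simp_all add: chains_def S.N1_mult chain_end_def T0.mult_lim)

lemma chains_inv:
  assumes "y \<in> chains"
  shows "(\<lambda>n. inv\<^bsub>F1 n\<^esub> y n) \<in> chains"
    "chain_end (\<lambda>n. inv\<^bsub>F1 n\<^esub> y n) = inv\<^bsub>L0\<^esub> chain_end y"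
  using chainsD[OF assms] S.N1_D(1) T0.inv_lim[OF chain_end_closed[OF assms]]
  by (simp_all add: chains_def S.N1_inv chain_end_def)

lemma gap_class_closed: "y \<in> chains \<Longrightarrow> gap_class y \<in> carrier ab.P"
  unfolding ab.carrier_P gap_class_def S.carrier_pi1 using chainsD(5) by (intro allI imageI)

text \<open>The gap of the product is p(z_{n+1})^-1 gap(y) z_n. Moving the cycle gap(y) to the
  front, which changes nothing modulo \<open>B1\<close>, leaves gap(y) gap(z).\<close>

lemma gap_class_mult:
  assumes y: "y \<in> chains" and z: "z \<in> chains"
  shows "gap_class (\<lambda>n. y n \<otimes>\<^bsub>F1 n\<^esub> z n) = gap_class y \<otimes>\<^bsub>ab.P\<^esub> gap_class z"
proof
  fix n
  note yn = chainsD[OF y] and zn = chainsD[OF z]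
  note c = yn(2)[of n] zn(2)[of n] yn(2)[of "Suc n"] zn(2)[of "Suc n"]
    S.N1_D(1)[OF yn(3)[of n]] S.N1_D(1)[OF zn(3)[of n]]
  let ?u = "inv\<^bsub>F1 n\<^esub> p1 n (z (Suc n))"
  have h1: "gap (\<lambda>n. y n \<otimes>\<^bsub>F1 n\<^esub> z n) n = (?u \<otimes>\<^bsub>F1 n\<^esub> gap y n) \<otimes>\<^bsub>F1 n\<^esub> z n"
    using c by (simp add: S.F1.inv_mult_group S.F1.m_assoc)
  have h2: "cls n ((?u \<otimes>\<^bsub>F1 n\<^esub> gap y n) \<otimes>\<^bsub>F1 n\<^esub> z n) = cls n ((gap y n \<otimes>\<^bsub>F1 n\<^esub> ?u) \<otimes>\<^bsub>F1 n\<^esub> z n)"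
    by (rule S.Z1_N1_swap[OF yn(5)[of n] S.N1_inv[OF zn(3)[of n]] c(2)])
  have h3: "(gap y n \<otimes>\<^bsub>F1 n\<^esub> ?u) \<otimes>\<^bsub>F1 n\<^esub> z n = gap y n \<otimes>\<^bsub>F1 n\<^esub> gap z n"
    using c by (simp add: S.F1.m_assoc)
  have h4: "cls n (gap y n \<otimes>\<^bsub>F1 n\<^esub> gap z n) = cls n (gap y n) \<otimes>\<^bsub>F1 n Mod S.B1 n\<^esub> cls n (gap z n)"
    by (rule S.q.hom_mult[OF S.Z1_D(1)[OF yn(5)[of n]] S.Z1_D(1)[OF zn(5)[of n]]])
  show "gap_class (\<lambda>n. y n \<otimes>\<^bsub>F1 n\<^esub> z n) n = (gap_class y \<otimes>\<^bsub>ab.P\<^esub> gap_class z) n"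
    unfolding ab.mult_P gap_class_def S.mult_pi1 by (simp only: h1 h2 h3 h4)
qed

lemma gap_class_inv:
  assumes y: "y \<in> chains"
  shows "gap_class (\<lambda>n. inv\<^bsub>F1 n\<^esub> y n) = inv\<^bsub>ab.P\<^esub> gap_class y"
proof -
  interpret P: group ab.P by (rule ab.P_group)
  let ?i = "\<lambda>n. inv\<^bsub>F1 n\<^esub> y n"
  note i = chains_inv(1)[OF y]
  have "gap_class ?i \<otimes>\<^bsub>ab.P\<^esub> gap_class y = gap_class (\<lambda>n. ?i n \<otimes>\<^bsub>F1 n\<^esub> y n)"
    by (rule gap_class_mult[OF i y, symmetric])
  also have "\<dots> = \<one>\<^bsub>ab.P\<^esub>"
    using chainsD(2)[OF y] by (simp add: gap_class_def restrict_def fun_eq_iff S.q.hom_one)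
  finally show ?thesis
    using P.inv_equality[OF _ gap_class_closed[OF y] gap_class_closed[OF i]] by simp
qed

text \<open>For cycles c_n representing x_n, the equation p(y_{n+1}) = y_n c_n^-1 is solved
  recursively by lifting chains. The ends are compatible because c_n is a cycle, and the gap is c_n
  itself.\<close>

lemma gap_class_surj:
  assumes "x \<in> carrier ab.P"
  obtains y where "y \<in> chains" "gap_class y = x"
proof -
  have "\<forall>n. \<exists>c. c \<in> S.Z1 n \<and> x n = cls n c"
    using assms unfolding ab.carrier_P S.carrier_pi1 by blast
  then obtain c where c: "\<And>n. c n \<in> S.Z1 n" "\<And>n. x n = cls n (c n)" by metis
  have "\<exists>y. \<forall>n. y n \<in> S.N1 n \<and> p1 n (y (Suc n)) = y n \<otimes>\<^bsub>F1 n\<^esub> inv\<^bsub>F1 n\<^esub> c n"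
  proof (rule dependent_nat_choice)
    show "\<exists>y. y \<in> S.N1 0" using S.N1_one by blast
    fix y n assume "y \<in> S.N1 n"
    then have "y \<otimes>\<^bsub>F1 n\<^esub> inv\<^bsub>F1 n\<^esub> c n \<in> S.N1 n"
      by (rule S.N1_mult[OF _ S.N1_inv[OF S.Z1_D(4)[OF c(1)]]])
    then obtain y' where "y' \<in> S.N1 (Suc n)" "p1 n y' = y \<otimes>\<^bsub>F1 n\<^esub> inv\<^bsub>F1 n\<^esub> c n"
      by (rule lift_N1)
    then show "\<exists>y'. y' \<in> S.N1 (Suc n) \<and> p1 n y' = y \<otimes>\<^bsub>F1 n\<^esub> inv\<^bsub>F1 n\<^esub> c n" by blast
  qed
  then obtain y where y: "\<And>n. y n \<in> S.N1 n"
    "\<And>n. p1 n (y (Suc n)) = y n \<otimes>\<^bsub>F1 n\<^esub> inv\<^bsub>F1 n\<^esub> c n" by blast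
  note yc = S.N1_D(1)[OF y(1)] and cc = S.Z1_D[OF c(1)]
  have "y \<in> chains"
    using y(1) yc cc by (simp add: chains_def y(2))
  moreover have "gap_class y = x"
    using yc cc by (simp add: fun_eq_iff gap_class_def y(2) c(2) S.F1.inv_mult_group S.F1.m_assoc)
  ultimately show ?thesis by (rule that)
qed

lemma LB_I:
  assumes "\<And>n. w n \<in> S.N1 n" "\<And>n. p1 n (w (Suc n)) = w n"
  shows "chain_end w \<in> LB"
  unfolding LB_def using assms by (intro imageI) simp

lemma LB_E:
  assumes "b \<in> LB"
  obtains w where "\<forall>n. w n \<in> S.N1 n" "\<forall>n. p1 n (w (Suc n)) = w n" "w \<in> chains" "b = chain_end w"
proof -
  obtain w where w: "\<forall>n. w n \<in> S.N1 n \<and> p1 n (w (Suc n)) = w n" "b = chain_end w"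
    using assms unfolding LB_def by blast
  moreover from w have "w \<in> chains" by (simp add: chains_def)
  ultimately show ?thesis using that by blast
qed

lemma LB_normal: "LB \<lhd> L0"
  unfolding group.normal_inv_iff[OF T0.lim_group]
proof (intro conjI ballI)
  show "subgroup LB L0"
  proof (rule group.subgroupI[OF T0.lim_group])
    show "LB \<subseteq> carrier L0"
    proof
      fix b assume "b \<in> LB"
      then show "b \<in> carrier L0" by (rule LB_E) (simp add: chain_end_closed)
    qed
    have "chain_end (\<lambda>n. \<one>\<^bsub>F1 n\<^esub>) \<in> LB" by (rule LB_I) (simp_all add: S.N1_one)
    then show "LB \<noteq> {}" by blast
    fix a assume "a \<in> LB"
    then obtain w where w: "\<forall>n. w n \<in> S.N1 n" "\<forall>n. p1 n (w (Suc n)) = w n" "w \<in> chains" "a = chain_end w"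
      by (rule LB_E)
    note w = w(1,2)[rule_format] w(3,4)
    note wc = S.N1_D(1)[OF w(1)]
    have "chain_end (\<lambda>n. inv\<^bsub>F1 n\<^esub> w n) \<in> LB"
      by (rule LB_I) (use w wc in \<open>simp_all add: S.N1_inv\<close>)
    then show "inv\<^bsub>L0\<^esub> a \<in> LB" using w chains_inv by simp
    fix b assume "b \<in> LB"
    then obtain v where v: "\<forall>n. v n \<in> S.N1 n" "\<forall>n. p1 n (v (Suc n)) = v n" "v \<in> chains" "b = chain_end v"
      by (rule LB_E)
    note v = v(1,2)[rule_format] v(3,4)
    note vc = S.N1_D(1)[OF v(1)]
    have "chain_end (\<lambda>n. w n \<otimes>\<^bsub>F1 n\<^esub> v n) \<in> LB"
      by (rule LB_I) (use w wc v vc in \<open>simp_all add: S.N1_mult\<close>)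
    then show "a \<otimes>\<^bsub>L0\<^esub> b \<in> LB" using w(3,4) v(3,4) chains_mult by simp
  qed
  fix x b assume x: "x \<in> carrier L0" and "b \<in> LB"
  then obtain w where w: "\<forall>n. w n \<in> S.N1 n" "\<forall>n. p1 n (w (Suc n)) = w n" "w \<in> chains" "b = chain_end w"
    by (elim LB_E)
  note w = w(1,2)[rule_format] w(3,4)
  note wc = S.N1_D[OF w(1)]
  have xc: "x n \<in> carrier (F0 n)" "p0 n (x (Suc n)) = x n" for n
    using x by (simp_all add: T0.carrier_lim)
  \<comment> \<open>The degeneracies lift the entries of x compatibly with the tower maps, so the
    conjugated chains are again compatible.\<close>
  have "chain_end (\<lambda>n. s n (x n) \<otimes>\<^bsub>F1 n\<^esub> w n \<otimes>\<^bsub>F1 n\<^esub> inv\<^bsub>F1 n\<^esub> s n (x n)) \<in> LB"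
    by (rule LB_I) (use wc w(2) xc in \<open>simp_all add: S.N1_def S.d_s p_s\<close>)
  then show "x \<otimes>\<^bsub>L0\<^esub> b \<otimes>\<^bsub>L0\<^esub> inv\<^bsub>L0\<^esub> x \<in> LB"
    using wc xc w(4) x by (simp add: T0.mult_lim T0.inv_lim chain_end_def S.d_s)
qed

text \<open>The gaps of y form a difference c_n - p(c_{n+1}) in pi_1 exactly when some compatible
  sequence has the same ends as y. Replacing y_n by c_n^-1 y_n removes the gaps up to boundaries;
  conversely, for compatible w the cycles y_n w_n^-1 give the difference.\<close>

lemma gap_class_lim1_rel:
  assumes y: "y \<in> chains"
  shows "gap_class y \<in> ab.lim1_rel \<longleftrightarrow> chain_end y \<in> LB"
proof
  assume "gap_class y \<in> ab.lim1_rel"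
  then obtain v where v: "v \<in> carrier ab.P"
    "gap_class y = (\<lambda>n. v n \<otimes>\<^bsub>S.pi1 n\<^esub> inv\<^bsub>S.pi1 n\<^esub> pi1_map n (v (Suc n)))"
    unfolding ab.lim1_rel_def by (elim imageE)
  have "\<forall>n. \<exists>c. c \<in> S.Z1 n \<and> v n = cls n c"
    using v(1) unfolding ab.carrier_P S.carrier_pi1 by blast
  then obtain c where c: "\<And>n. c n \<in> S.Z1 n" "\<And>n. v n = cls n (c n)" by metis
  note cc = S.Z1_D[OF c(1)] and yc = chainsD[OF y]
  have pc: "p1 n (c (Suc n)) \<in> S.Z1 n" for n by (rule p1_Z1[OF c(1)])
  define u where "u n = inv\<^bsub>F1 n\<^esub> c n \<otimes>\<^bsub>F1 n\<^esub> y n" for n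
  have u: "u n \<in> S.N1 n" for n unfolding u_def by (rule S.N1_mult[OF S.N1_inv[OF cc(4)] yc(1)])
  have u_end: "d1 n (u n) = d1 n (y n)" for n using cc yc(2) by (simp add: u_def)
  \<comment> \<open>The gap of u is p(y_{n+1})^-1 b y_n with the cycle b = p(c_{n+1}) c_n^-1. Once b
    is moved to the front, it cancels the class c_n p(c_{n+1})^-1 of gap(y).\<close>
  have gap_u: "gap u n \<in> S.B1 n" for n
  proof -
    let ?a = "inv\<^bsub>F1 n\<^esub> p1 n (y (Suc n))"
    let ?b = "p1 n (c (Suc n)) \<otimes>\<^bsub>F1 n\<^esub> inv\<^bsub>F1 n\<^esub> c n"
    have b: "?b \<in> S.Z1 n" by (rule S.Z1_mult[OF pc S.Z1_inv[OF c(1)]])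
    have a: "?a \<in> S.N1 n" by (rule S.N1_inv[OF yc(3)])
    note car = S.N1_D(1)[OF a] S.Z1_D(1)[OF b] yc(2)[of n] cc(1)[of n] S.Z1_D(1)[OF pc[of n]]
      S.N1_D(1)[OF yc(3)[of n]]
    have h1: "gap u n = (?a \<otimes>\<^bsub>F1 n\<^esub> ?b) \<otimes>\<^bsub>F1 n\<^esub> y n"
      using car cc(1)[of "Suc n"] yc(2)[of "Suc n"] by (simp add: u_def S.F1.inv_mult_group S.F1.m_assoc)
    have h2: "cls n ((?a \<otimes>\<^bsub>F1 n\<^esub> ?b) \<otimes>\<^bsub>F1 n\<^esub> y n) = cls n ((?b \<otimes>\<^bsub>F1 n\<^esub> ?a) \<otimes>\<^bsub>F1 n\<^esub> y n)"
      by (rule S.Z1_N1_swap[OF b a car(3)])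
    have h3: "(?b \<otimes>\<^bsub>F1 n\<^esub> ?a) \<otimes>\<^bsub>F1 n\<^esub> y n = ?b \<otimes>\<^bsub>F1 n\<^esub> gap y n"
      by (rule S.F1.m_assoc[OF car(2,1,3)])
    have h4: "cls n (?b \<otimes>\<^bsub>F1 n\<^esub> gap y n) = cls n ?b \<otimes>\<^bsub>F1 n Mod S.B1 n\<^esub> cls n (gap y n)"
      by (rule S.q.hom_mult[OF car(2) S.Z1_D(1)[OF yc(5)]])
    have "cls n (gap y n) = v n \<otimes>\<^bsub>S.pi1 n\<^esub> inv\<^bsub>S.pi1 n\<^esub> pi1_map n (v (Suc n))"
      using v(2) unfolding gap_class_def by (rule fun_cong)
    also have "\<dots> = cls n (c n) \<otimes>\<^bsub>F1 n Mod S.B1 n\<^esub> cls n (inv\<^bsub>F1 n\<^esub> p1 n (c (Suc n)))"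
      unfolding c(2) pi1_map_cls[OF c(1)] S.inv_pi1[OF pc] S.mult_pi1 ..
    also have "\<dots> = cls n (c n \<otimes>\<^bsub>F1 n\<^esub> inv\<^bsub>F1 n\<^esub> p1 n (c (Suc n)))"
      by (rule S.q.hom_mult[symmetric, OF car(4) S.F1.inv_closed[OF car(5)]])
    finally have h5: "cls n (gap y n) = cls n (c n \<otimes>\<^bsub>F1 n\<^esub> inv\<^bsub>F1 n\<^esub> p1 n (c (Suc n)))" .
    have h6: "cls n ?b \<otimes>\<^bsub>F1 n Mod S.B1 n\<^esub> cls n (c n \<otimes>\<^bsub>F1 n\<^esub> inv\<^bsub>F1 n\<^esub> p1 n (c (Suc n)))
        = cls n (?b \<otimes>\<^bsub>F1 n\<^esub> (c n \<otimes>\<^bsub>F1 n\<^esub> inv\<^bsub>F1 n\<^esub> p1 n (c (Suc n))))"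
      by (rule S.q.hom_mult[symmetric, OF car(2) S.F1.m_closed[OF car(4) S.F1.inv_closed[OF car(5)]]])
    have h7: "?b \<otimes>\<^bsub>F1 n\<^esub> (c n \<otimes>\<^bsub>F1 n\<^esub> inv\<^bsub>F1 n\<^esub> p1 n (c (Suc n))) = \<one>\<^bsub>F1 n\<^esub>"
      using car(4,5) by (simp add: S.F1.m_assoc)
    have h8: "cls n \<one>\<^bsub>F1 n\<^esub> = S.B1 n" using S.q.hom_one by simp
    have "cls n (gap u n) = S.B1 n" by (simp only: h1 h2 h3 h4 h5 h6 h7 h8)
    then show ?thesis
      using normal.rcos_eq_self_iff[OF S.B1_normal] S.F1.m_closed[OF S.F1.inv_closed[OF S.N1_D(1)[OF p1_N1[OF u]]] S.N1_D(1)[OF u]]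
      by blast
  qed
  \<comment> \<open>The remaining gaps are absorbed by boundaries: p(e_{n+1}) = gap(u)_n e_n makes
    u_n e_n compatible and leaves the ends unchanged. The recursion can be solved because boundaries
    lift along the tower, whereas cycles in general do not.\<close>
  have "\<exists>e. \<forall>n. e n \<in> S.B1 n \<and> p1 n (e (Suc n)) = gap u n \<otimes>\<^bsub>F1 n\<^esub> e n"
  proof (rule dependent_nat_choice)
    show "\<exists>b. b \<in> S.B1 0"
      using subgroup.one_closed[OF normal_imp_subgroup[OF S.B1_normal[of 0]]] by (rule exI)
    fix b n assume "b \<in> S.B1 n"
    then have "gap u n \<otimes>\<^bsub>F1 n\<^esub> b \<in> S.B1 n"
      by (rule subgroup.m_closed[OF normal_imp_subgroup[OF S.B1_normal] gap_u])
    then obtain b' where "b' \<in> S.B1 (Suc n)" "p1 n b' = gap u n \<otimes>\<^bsub>F1 n\<^esub> b"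
      by (rule lift_B1)
    then show "\<exists>b'. b' \<in> S.B1 (Suc n) \<and> p1 n b' = gap u n \<otimes>\<^bsub>F1 n\<^esub> b" by blast
  qed
  then obtain e where e: "\<And>n. e n \<in> S.B1 n" "\<And>n. p1 n (e (Suc n)) = gap u n \<otimes>\<^bsub>F1 n\<^esub> e n" by blast
  note ez = S.Z1_D[OF S.B1_Z1[OF e(1)]] and uc = S.N1_D(1)[OF u]
  have "chain_end (\<lambda>n. u n \<otimes>\<^bsub>F1 n\<^esub> e n) \<in> LB"
  proof (rule LB_I)
    fix n
    show "u n \<otimes>\<^bsub>F1 n\<^esub> e n \<in> S.N1 n" by (rule S.N1_mult[OF u ez(4)])
    show "p1 n (u (Suc n) \<otimes>\<^bsub>F1 (Suc n)\<^esub> e (Suc n)) = u n \<otimes>\<^bsub>F1 n\<^esub> e n"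
      using ez(1) uc by (simp add: e(2) S.F1.m_assoc)
  qed
  moreover have "chain_end (\<lambda>n. u n \<otimes>\<^bsub>F1 n\<^esub> e n) = chain_end y"
    using ez uc yc(2) by (simp add: chain_end_def u_end)
  ultimately show "chain_end y \<in> LB" by simp
next
  assume "chain_end y \<in> LB"
  then obtain w where w: "\<forall>n. w n \<in> S.N1 n" "\<forall>n. p1 n (w (Suc n)) = w n" "w \<in> chains" "chain_end y = chain_end w"
    by (rule LB_E)
  note w = w(1,2)[rule_format] w(3,4)
  note yc = chainsD[OF y] and wc = S.N1_D(1)[OF w(1)]
  have yw: "d1 n (y n) = d1 n (w n)" for n using w(4) unfolding chain_end_def by (rule fun_cong)
  define c where "c n = y n \<otimes>\<^bsub>F1 n\<^esub> inv\<^bsub>F1 n\<^esub> w n" for n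
  have c: "c n \<in> S.Z1 n" for n
    unfolding c_def S.Z1_def mem_Collect_eq
    using S.N1_mult[OF yc(1) S.N1_inv[OF w(1)]] yw wc yc(2) by simp
  note pc = p1_Z1[OF c]
  \<comment> \<open>As w is compatible, gap(y) is a conjugate by w_n of the cycle p(c_{n+1})^-1 c_n,
    hence equal to it modulo \<open>B1\<close>.\<close>
  have gap_y: "cls n (gap y n) = cls n (c n \<otimes>\<^bsub>F1 n\<^esub> inv\<^bsub>F1 n\<^esub> p1 n (c (Suc n)))" for n
  proof -
    let ?g = "inv\<^bsub>F1 n\<^esub> p1 n (c (Suc n)) \<otimes>\<^bsub>F1 n\<^esub> c n"
    note car = S.Z1_D(1)[OF c[of n]] S.Z1_D(1)[OF pc[of n]] wc[of n] yc(2)[of n] S.N1_D(1)[OF yc(3)[of n]]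
    have g: "?g \<in> S.Z1 n" by (rule S.Z1_mult[OF S.Z1_inv[OF pc] c])
    have h1: "gap y n = (inv\<^bsub>F1 n\<^esub> w n \<otimes>\<^bsub>F1 n\<^esub> ?g) \<otimes>\<^bsub>F1 n\<^esub> w n"
      using car yc(2)[of "Suc n"] wc[of "Suc n"]
      by (simp add: c_def w(2) S.F1.inv_mult_group S.F1.m_assoc)
    have h2: "cls n ((inv\<^bsub>F1 n\<^esub> w n \<otimes>\<^bsub>F1 n\<^esub> ?g) \<otimes>\<^bsub>F1 n\<^esub> w n) = cls n ((?g \<otimes>\<^bsub>F1 n\<^esub> inv\<^bsub>F1 n\<^esub> w n) \<otimes>\<^bsub>F1 n\<^esub> w n)"
      by (rule S.Z1_N1_swap[OF g S.N1_inv[OF w(1)] car(3)])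
    have h3: "(?g \<otimes>\<^bsub>F1 n\<^esub> inv\<^bsub>F1 n\<^esub> w n) \<otimes>\<^bsub>F1 n\<^esub> w n = ?g"
      using car(1-3) by (simp add: S.F1.m_assoc)
    have h4: "cls n ?g = cls n (c n \<otimes>\<^bsub>F1 n\<^esub> inv\<^bsub>F1 n\<^esub> p1 n (c (Suc n)))"
      by (rule S.Z1_N1_comm[OF S.Z1_inv[OF pc] S.Z1_D(4)[OF c]])
    show ?thesis by (simp only: h1 h2 h3 h4)
  qed
  let ?v = "\<lambda>n. cls n (c n)"
  have "?v \<in> carrier ab.P"
    unfolding ab.carrier_P S.carrier_pi1 using c by (intro allI imageI)
  moreover have "gap_class y = (\<lambda>n. ?v n \<otimes>\<^bsub>S.pi1 n\<^esub> inv\<^bsub>S.pi1 n\<^esub> pi1_map n (?v (Suc n)))"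
    unfolding gap_class_def gap_y pi1_map_cls[OF c] S.inv_pi1[OF pc] S.mult_pi1
    using S.q.hom_mult[OF S.Z1_D(1)[OF c] S.F1.inv_closed[OF S.Z1_D(1)[OF pc]]] by (intro ext)
  ultimately show "gap_class y \<in> ab.lim1_rel"
    unfolding ab.lim1_rel_def by (intro image_eqI)
qed

abbreviation lim1_class where "lim1_class \<equiv> r_coset ab.P ab.lim1_rel"

abbreviation "lim1_pi1 \<equiv> lim1 (\<lambda>n. S.pi1 n) pi1_map"

text \<open>The formula for \<open>delta\<close> does not mention compatibility of the ends. It is
  forced by membership of the gap in a coset of \<open>B1\<close> that consists of cycles.\<close>

lemma gap_class_valid:
  assumes "x \<in> carrier ab.P" "\<forall>n. y n \<in> S.N1 n \<and> gap y n \<in> x n"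
  shows "y \<in> chains" "gap_class y = x"
proof -
  have *: "d1 n (p1 n (y (Suc n))) = d1 n (y n) \<and> cls n (gap y n) = x n" for n
  proof -
    obtain c where c: "c \<in> S.Z1 n" "x n = cls n c"
      using assms(1) unfolding ab.carrier_P S.carrier_pi1 by blast
    note yc = S.N1_D(1)[OF assms(2)[rule_format, THEN conjunct1], of n]
      S.N1_D(1)[OF p1_N1[OF assms(2)[rule_format, THEN conjunct1]], of n]
    have g: "gap y n \<in> cls n c" using assms(2) unfolding c(2)[symmetric] by blast
    then obtain b where b: "b \<in> S.B1 n" "gap y n = b \<otimes>\<^bsub>F1 n\<^esub> c"
      unfolding r_coset_def by blast
    note bz = S.Z1_D[OF S.B1_Z1[OF b(1)]] and cz = S.Z1_D[OF c(1)]
    have "d1 n (gap y n) = \<one>\<^bsub>F0 n\<^esub>" unfolding b(2) using bz cz by simp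
    then have "d1 n (y n) = d1 n (p1 n (y (Suc n)))"
      using yc S.F0.mult_inv_cancel(1)[of "d1 n (p1 n (y (Suc n)))" n "d1 n (y n)"] by (simp del: S.F0.mult_inv_cancel)
    moreover have "cls n (gap y n) = cls n c"
      by (rule S.F1.repr_independence[symmetric, OF g cz(1) normal_imp_subgroup[OF S.B1_normal]])
    ultimately show ?thesis using c(2) by simp
  qed
  show "y \<in> chains" unfolding chains_def using assms(2) * by simp
  show "gap_class y = x" unfolding gap_class_def using * by (intro ext) simp
qed

lemma gap_in_gap_class:
  assumes "y \<in> chains"
  shows "gap y n \<in> gap_class y n"
  unfolding gap_class_def
  by (rule S.F1.rcos_self[OF S.Z1_D(1)[OF chainsD(5)[OF assms]] normal_imp_subgroup[OF S.B1_normal]])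

text \<open>\<open>gap_class_lim1_rel\<close> applied to y z^-1. This one equivalence contains both
  that the connecting map is well defined and that it is injective.\<close>

lemma lim1_class_eq_iff:
  assumes y: "y \<in> chains" and z: "z \<in> chains"
  shows "lim1_class (gap_class y) = lim1_class (gap_class z) \<longleftrightarrow>
    r_coset L0 LB (chain_end y) = r_coset L0 LB (chain_end z)"
proof -
  note i = chains_inv[OF z]
  note m = chains_mult[OF y i(1)]
  have "lim1_class (gap_class y) = lim1_class (gap_class z) \<longleftrightarrow>
      gap_class (\<lambda>n. y n \<otimes>\<^bsub>F1 n\<^esub> inv\<^bsub>F1 n\<^esub> z n) \<in> ab.lim1_rel"
    unfolding ab.lim1_rcos_eq_iff[OF gap_class_closed[OF y] gap_class_closed[OF z]]
      gap_class_mult[OF y i(1)] gap_class_inv[OF z] ..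
  also have "\<dots> \<longleftrightarrow> chain_end y \<otimes>\<^bsub>L0\<^esub> inv\<^bsub>L0\<^esub> chain_end z \<in> LB"
    unfolding gap_class_lim1_rel[OF m(1)] m(2) i(2) ..
  also have "\<dots> \<longleftrightarrow> r_coset L0 LB (chain_end y) = r_coset L0 LB (chain_end z)"
    by (rule normal.rcos_eq_iff[symmetric, OF LB_normal chain_end_closed[OF y] chain_end_closed[OF z]])
  finally show ?thesis .
qed

text \<open>The admissible choices for one class fill a whole coset. Two choices have ends that
  agree modulo \<open>LB\<close> by the preceding equivalence; conversely an element of
  \<open>LB\<close> is the end of a compatible w, and w y is another admissible choice.\<close>

lemma delta_eq:
  assumes y: "y \<in> chains"
  shows "delta (lim1_class (gap_class y)) = r_coset L0 LB (chain_end y)"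
proof -
  note g = gap_class_closed[OF y] and e = chain_end_closed[OF y]
  note subP = normal_imp_subgroup[OF ab.lim1_rel_normal] and subL = normal_imp_subgroup[OF LB_normal]
  show ?thesis
  proof (intro subset_antisym subsetI)
    fix c assume "c \<in> delta (lim1_class (gap_class y))"
    then obtain x z where xz: "c = chain_end z" "x \<in> lim1_class (gap_class y)"
      "\<forall>n. z n \<in> S.N1 n \<and> gap z n \<in> x n"
      unfolding delta_def by blast
    have x: "x \<in> carrier ab.P"
      by (rule subgroup.elemrcos_carrier[OF subP ab.P_group g xz(2)])
    note z = gap_class_valid[OF x xz(3)]
    have "lim1_class (gap_class y) = lim1_class (gap_class z)"
      unfolding z(2) by (rule group.repr_independence[OF ab.P_group xz(2) g subP])
    then have "r_coset L0 LB (chain_end y) = r_coset L0 LB (chain_end z)"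
      unfolding lim1_class_eq_iff[OF y z(1)] .
    then show "c \<in> r_coset L0 LB (chain_end y)"
      unfolding xz(1) by (rule group.repr_independenceD[OF T0.lim_group subL chain_end_closed[OF z(1)]])
  next
    fix c assume "c \<in> r_coset L0 LB (chain_end y)"
    then obtain b where b: "b \<in> LB" "c = b \<otimes>\<^bsub>L0\<^esub> chain_end y" unfolding r_coset_def by blast
    from b(1) obtain w where w: "\<forall>n. w n \<in> S.N1 n" "\<forall>n. p1 n (w (Suc n)) = w n" "w \<in> chains" "b = chain_end w"
      by (rule LB_E)
    note z = chains_mult[OF w(3) y]
    let ?z = "\<lambda>n. w n \<otimes>\<^bsub>F1 n\<^esub> y n"
    have c: "c = chain_end ?z" unfolding b(2) w(4) z(2) ..
    have "r_coset L0 LB (chain_end ?z) = r_coset L0 LB (chain_end y)"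
      unfolding c[symmetric] by (rule group.repr_independence[symmetric, OF T0.lim_group _ e subL])
        (use b in \<open>auto simp: r_coset_def\<close>)
    then have "lim1_class (gap_class ?z) = lim1_class (gap_class y)"
      unfolding lim1_class_eq_iff[OF z(1) y] .
    then have "gap_class ?z \<in> lim1_class (gap_class y)"
      using group.rcos_self[OF ab.P_group gap_class_closed[OF z(1)] subP] by metis
    moreover have "\<forall>n. ?z n \<in> S.N1 n \<and> gap ?z n \<in> gap_class ?z n"
      using chainsD(1)[OF z(1)] gap_in_gap_class[OF z(1)] by blast
    ultimately show "c \<in> delta (lim1_class (gap_class y))"
      unfolding delta_def c by blast
  qed
qed

lemma lim1_chainE:
  assumes "\<xi> \<in> carrier lim1_pi1"
  obtains y where "y \<in> chains" "\<xi> = lim1_class (gap_class y)"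
proof -
  obtain x where x: "x \<in> carrier ab.P" "\<xi> = lim1_class x"
    using assms unfolding ab.lim1_carrier by (elim imageE)
  obtain y where "y \<in> chains" "gap_class y = x" by (rule gap_class_surj[OF x(1)])
  then show ?thesis using x(2) that by blast
qed

lemma lim1_chainI: "y \<in> chains \<Longrightarrow> lim1_class (gap_class y) \<in> carrier lim1_pi1"
  unfolding ab.lim1_carrier by (intro imageI gap_class_closed)

lemma delta_hom: "delta \<in> hom lim1_pi1 (L0 Mod LB)"
proof (rule homI)
  fix \<xi> assume "\<xi> \<in> carrier lim1_pi1"
  then obtain y where y: "y \<in> chains" "\<xi> = lim1_class (gap_class y)" by (rule lim1_chainE)
  show "delta \<xi> \<in> carrier (L0 Mod LB)"
    unfolding y(2) delta_eq[OF y(1)] carrier_FactGroup by (rule imageI[OF chain_end_closed[OF y(1)]])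
next
  fix \<xi> \<zeta> assume "\<xi> \<in> carrier lim1_pi1" "\<zeta> \<in> carrier lim1_pi1"
  then obtain y z where y: "y \<in> chains" "\<xi> = lim1_class (gap_class y)"
    and z: "z \<in> chains" "\<zeta> = lim1_class (gap_class z)" by (elim lim1_chainE) blast
  note m = chains_mult[OF y(1) z(1)]
  have "\<xi> \<otimes>\<^bsub>lim1_pi1\<^esub> \<zeta> = lim1_class (gap_class (\<lambda>n. y n \<otimes>\<^bsub>F1 n\<^esub> z n))"
    unfolding y(2) z(2) gap_class_mult[OF y(1) z(1)]
    by (rule group_hom.hom_mult[symmetric, OF ab.lim1_hom gap_class_closed[OF y(1)] gap_class_closed[OF z(1)]])
  then have "delta (\<xi> \<otimes>\<^bsub>lim1_pi1\<^esub> \<zeta>) = r_coset L0 LB (chain_end y \<otimes>\<^bsub>L0\<^esub> chain_end z)"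
    using delta_eq[OF m(1)] m(2) by simp
  also have "\<dots> = r_coset L0 LB (chain_end y) \<otimes>\<^bsub>L0 Mod LB\<^esub> r_coset L0 LB (chain_end z)"
    by (rule group_hom.hom_mult[OF normal.rcos_hom[OF LB_normal] chain_end_closed[OF y(1)] chain_end_closed[OF z(1)]])
  finally show "delta (\<xi> \<otimes>\<^bsub>lim1_pi1\<^esub> \<zeta>) = delta \<xi> \<otimes>\<^bsub>L0 Mod LB\<^esub> delta \<zeta>"
    unfolding y(2) z(2) delta_eq[OF y(1)] delta_eq[OF z(1)] .
qed

lemma delta_inj: "inj_on delta (carrier lim1_pi1)"
proof (rule inj_onI)
  fix \<xi> \<zeta> assume x: "\<xi> \<in> carrier lim1_pi1" "\<zeta> \<in> carrier lim1_pi1" and eq: "delta \<xi> = delta \<zeta>"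
  from x obtain y z where y: "y \<in> chains" "\<xi> = lim1_class (gap_class y)"
    and z: "z \<in> chains" "\<zeta> = lim1_class (gap_class z)" by (elim lim1_chainE) blast
  show "\<xi> = \<zeta>"
    using eq unfolding y(2) z(2) delta_eq[OF y(1)] delta_eq[OF z(1)] lim1_class_eq_iff[OF y(1) z(1)] .
qed

text \<open>Sequences that are boundaries in every component represent the kernel of the map from
  pi_0 of the limit to the limit of the pi_0. Chains with these ends may be chosen for each n
  independently: their ends are compatible because z is.\<close>

lemma delta_image:
  "delta ` carrier lim1_pi1 = r_coset L0 LB ` {z \<in> carrier L0. \<forall>n. z n \<in> S.B0 n}"
proof (intro subset_antisym subsetI)
  fix c assume "c \<in> delta ` carrier lim1_pi1"
  then obtain \<xi> where \<xi>: "\<xi> \<in> carrier lim1_pi1" "c = delta \<xi>" by (elim imageE)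
  from \<xi>(1) obtain y where y: "y \<in> chains" "\<xi> = lim1_class (gap_class y)" by (rule lim1_chainE)
  show "c \<in> r_coset L0 LB ` {z \<in> carrier L0. \<forall>n. z n \<in> S.B0 n}"
    unfolding \<xi>(2) y(2) delta_eq[OF y(1)]
  proof (intro imageI CollectI conjI allI)
    show "chain_end y \<in> carrier L0" by (rule chain_end_closed[OF y(1)])
    show "chain_end y n \<in> S.B0 n" for n
      unfolding chain_end_def by (rule S.B0_I[OF chainsD(1)[OF y(1)]])
  qed
next
  fix c assume "c \<in> r_coset L0 LB ` {z \<in> carrier L0. \<forall>n. z n \<in> S.B0 n}"
  then obtain z where z: "z \<in> carrier L0" "\<forall>n. z n \<in> S.B0 n" "c = r_coset L0 LB z" by blast
  have "\<forall>n. \<exists>y. y \<in> S.N1 n \<and> z n = d1 n y"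
    using z(2) unfolding S.B0_def by blast
  then obtain y where y: "\<And>n. y n \<in> S.N1 n" "\<And>n. z n = d1 n (y n)" by metis
  have "d1 n (p1 n (y (Suc n))) = d1 n (y n)" for n
    using z(1) y(2) p_d(2)[OF S.N1_D(1)[OF y(1)]] unfolding T0.carrier_lim by simp
  then have yc: "y \<in> chains" using y(1) by (simp add: chains_def)
  have "z = chain_end y" unfolding chain_end_def by (rule ext) (rule y(2))
  then have "c = delta (lim1_class (gap_class y))" unfolding delta_eq[OF yc] z(3) by simp
  then show "c \<in> delta ` carrier lim1_pi1"
    by (rule image_eqI[OF _ lim1_chainI[OF yc]])
qed

end

section \<open>Successive approximation by commutators\<close>

text \<open>Coefficients are indexed by the list entries rather than by positions, so that
  corrections of coefficients are pointwise products of functions. A single coefficient can then be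
  prescribed as long as the list is distinct.\<close>

primrec commutator_prod :: "('a, 'b) monoid_scheme \<Rightarrow> 'a list \<Rightarrow> ('a \<Rightarrow> 'a) \<Rightarrow> 'a" where
  "commutator_prod G [] a = \<one>\<^bsub>G\<^esub>"
| "commutator_prod G (x # xs) a =
    a x \<otimes>\<^bsub>G\<^esub> x \<otimes>\<^bsub>G\<^esub> inv\<^bsub>G\<^esub> a x \<otimes>\<^bsub>G\<^esub> inv\<^bsub>G\<^esub> x \<otimes>\<^bsub>G\<^esub> commutator_prod G xs a"

section \<open>Bilinearity of commutators modulo deeper lower central terms\<close>

context group
begin

lemma nu_mult:
  "x \<in> carrier G \<Longrightarrow> y \<in> carrier G \<Longrightarrow> lcs G n #> (x \<otimes> y) = (lcs G n #> x) \<otimes>\<^bsub>nu n G\<^esub> (lcs G n #> y)"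
  by (rule group_hom.hom_mult[OF nu_hom])

lemma lcs_rcos_swap:
  assumes "c \<in> lcs G n" "a \<in> carrier G" "r \<in> carrier G"
  shows "lcs G (Suc n) #> (a \<otimes> c \<otimes> r) = lcs G (Suc n) #> (c \<otimes> a \<otimes> r)"
  using lcs_rcos_comm[OF assms(1,2)] nu_mult[of "a \<otimes> c" r "Suc n"] nu_mult[of "c \<otimes> a" r "Suc n"]
    lcs_closed[OF assms(1)] assms(2,3) by simp

lemma mult_interchange:
  assumes "a \<in> carrier G" "b \<in> carrier G" "y \<in> carrier G" "x \<in> carrier G" "a \<otimes> x = x \<otimes> a"
  shows "(b \<otimes> a) \<otimes> (x \<otimes> y) = (b \<otimes> x) \<otimes> (a \<otimes> y)"
  using assms by (metis m_assoc m_closed)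

lemma commutator_closed: "h \<in> carrier G \<Longrightarrow> g \<in> carrier G \<Longrightarrow> commutator h g \<in> carrier G"
  by simp

text \<open>[a b, x] = a [b, x] a^-1 [a, x], and conjugation by a is trivial on [b, x] modulo the
  next term. Only b has a prescribed depth: a deep correction b can be attached to an arbitrary
  a.\<close>

lemma commutator_mult_left:
  assumes a: "a \<in> carrier G" and b: "b \<in> lcs G m" and x: "x \<in> carrier G"
  shows "lcs G (Suc (Suc m)) #> commutator (a \<otimes> b) x = lcs G (Suc (Suc m)) #> (commutator b x \<otimes> commutator a x)"
proof -
  note bc = lcs_closed[OF b]
  have "commutator (a \<otimes> b) x = a \<otimes> commutator b x \<otimes> (inv a \<otimes> commutator a x)"
    using a bc x by (simp add: m_assoc inv_mult_group)
  moreover have "commutator b x \<otimes> commutator a x = commutator b x \<otimes> a \<otimes> (inv a \<otimes> commutator a x)"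
    using a bc x by (simp add: m_assoc)
  moreover have "inv a \<otimes> commutator a x \<in> carrier G" using a x by simp
  ultimately show ?thesis
    using lcs_rcos_swap[OF commutator_lcs[OF b x] a] by presburger
qed

text \<open>[h, g k] = [h, g] g [h, k] g^-1, and the conjugation is trivial because [h, k] is one
  level deeper than h.\<close>

lemma commutator_mult_right:
  assumes h: "h \<in> lcs G m" and g: "g \<in> carrier G" and k: "k \<in> carrier G"
  shows "lcs G (Suc (Suc m)) #> commutator h (g \<otimes> k) = lcs G (Suc (Suc m)) #> (commutator h g \<otimes> commutator h k)"
proof -
  note hc = lcs_closed[OF h]
  let ?c = "commutator h g \<otimes> g"
  have "commutator h (g \<otimes> k) = commutator h g \<otimes> (g \<otimes> commutator h k \<otimes> inv g)"
    using g hc k by (simp add: m_assoc inv_mult_group)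
  moreover have "commutator h g \<otimes> commutator h k = commutator h g \<otimes> (commutator h k \<otimes> g \<otimes> inv g)"
    using g hc k by (simp add: m_assoc)
  moreover have "commutator h g \<in> carrier G" "g \<otimes> commutator h k \<otimes> inv g \<in> carrier G"
    "commutator h k \<otimes> g \<otimes> inv g \<in> carrier G"
    using g hc k by simp_all
  ultimately show ?thesis
    using lcs_rcos_swap[OF commutator_lcs[OF h k] g, of "inv g"] g nu_mult by simp
qed

lemma nu_central:
  assumes c: "c \<in> lcs G n" and x: "x \<in> carrier (nu (Suc n) G)"
  shows "x \<otimes>\<^bsub>nu (Suc n) G\<^esub> (lcs G (Suc n) #> c) = (lcs G (Suc n) #> c) \<otimes>\<^bsub>nu (Suc n) G\<^esub> x"
proof -
  obtain y where y: "y \<in> carrier G" "x = lcs G (Suc n) #> y" using x unfolding carrier_nu by (elim imageE)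
  show ?thesis unfolding y(2)
    using lcs_rcos_comm[OF c y(1)] nu_mult[OF y(1) lcs_closed[OF c], of "Suc n"] nu_mult[OF lcs_closed[OF c] y(1), of "Suc n"]
    by simp
qed

lemma commutator_hom:
  assumes h: "h \<in> lcs G m"
  shows "group_hom G (nu (Suc (Suc m)) G) (\<lambda>g. lcs G (Suc (Suc m)) #> commutator h g)"
proof -
  note hc = lcs_closed[OF h]
  have "(\<lambda>g. lcs G (Suc (Suc m)) #> commutator h g) \<in> hom G (nu (Suc (Suc m)) G)"
  proof (rule homI)
    fix g assume g: "g \<in> carrier G"
    show "lcs G (Suc (Suc m)) #> commutator h g \<in> carrier (nu (Suc (Suc m)) G)"
      unfolding carrier_nu by (rule imageI[OF commutator_closed[OF hc g]])
    fix k assume k: "k \<in> carrier G"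
    show "lcs G (Suc (Suc m)) #> commutator h (g \<otimes> k) =
      (lcs G (Suc (Suc m)) #> commutator h g) \<otimes>\<^bsub>nu (Suc (Suc m)) G\<^esub> (lcs G (Suc (Suc m)) #> commutator h k)"
      unfolding commutator_mult_right[OF h g k]
      by (rule nu_mult[OF commutator_closed[OF hc g] commutator_closed[OF hc k]])
  qed
  then show ?thesis by (simp add: group_hom_def group_hom_axioms_def nu_group)
qed

text \<open>Modulo \<open>lcs G (Suc (Suc m))\<close> the map from g to [h, g] is a homomorphism
  with central values, so it kills all commutators and hence \<open>lcs G 1\<close>.\<close>

lemma commutator_lcs_1:
  assumes h: "h \<in> lcs G m" and g: "g \<in> lcs G 1"
  shows "commutator h g \<in> lcs G (Suc (Suc m))"
proof -
  let ?N = "nu (Suc (Suc m)) G" and ?f = "\<lambda>g. lcs G (Suc (Suc m)) #> commutator h g"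
  interpret f: group_hom G ?N ?f by (rule commutator_hom[OF h])
  have "lcs G (Suc 0) \<subseteq> kernel G ?N ?f"
    unfolding lcs.simps(2)[of G 0]
  proof (rule generate_subgroup_incl[OF _ f.subgroup_kernel], clarify)
    fix p q assume p: "p \<in> lcs G 0" and q: "q \<in> carrier G"
    have pc: "p \<in> carrier G" using p by simp
    note c = f.hom_closed[OF pc] f.hom_closed[OF q]
    have comm: "?f p \<otimes>\<^bsub>?N\<^esub> ?f q = ?f q \<otimes>\<^bsub>?N\<^esub> ?f p"
      by (rule nu_central[OF commutator_lcs[OF h q] c(1)])
    have "?f (commutator p q) = ?f p \<otimes>\<^bsub>?N\<^esub> ?f q \<otimes>\<^bsub>?N\<^esub> inv\<^bsub>?N\<^esub> ?f p \<otimes>\<^bsub>?N\<^esub> inv\<^bsub>?N\<^esub> ?f q"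
      using pc q f.hom_mult[of "p \<otimes> q \<otimes> inv p" "inv q"] f.hom_mult[of "p \<otimes> q" "inv p"] f.hom_mult[of p q]
        f.hom_inv[OF pc] f.hom_inv[OF q] m_closed inv_closed by presburger
    also have "\<dots> = \<one>\<^bsub>?N\<^esub>"
      unfolding comm using c by (simp only: f.H.m_assoc f.H.mult_inv_cancel f.H.m_closed f.H.inv_closed f.H.r_inv f.H.r_one)
    finally show "commutator p q \<in> kernel G ?N ?f"
      unfolding kernel_def using commutator_closed[OF pc q] by simp
  qed
  then have "?f g = lcs G (Suc (Suc m))" using g by (auto simp: kernel_def one_nu)
  then show ?thesis
    using lcs_rcos_eq_one_iff commutator_closed[OF lcs_closed[OF h] lcs_closed[OF g]] by blast
qed

lemma commutator_prod_closed:
  assumes "set xs \<subseteq> carrier G" "\<And>x. a x \<in> carrier G"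
  shows "commutator_prod G xs a \<in> carrier G"
  using assms by (induction xs) auto

lemma commutator_prod_lcs:
  assumes "set xs \<subseteq> carrier G" "\<And>x. a x \<in> lcs G m"
  shows "commutator_prod G xs a \<in> lcs G (Suc m)"
  using assms(1)
proof (induction xs)
  case Nil
  show ?case using subgroup.one_closed[OF lcs_subgroup] by simp
next
  case (Cons x xs)
  then show ?case
    using subgroup.m_closed[OF lcs_subgroup commutator_lcs[OF assms(2)[of x], of x] Cons.IH] by simp
qed

lemma commutator_prod_one:
  assumes "set xs \<subseteq> carrier G"
  shows "commutator_prod G xs (\<lambda>x. \<one>) = \<one>"
  using assms by (induction xs) auto

lemma commutator_prod_single:
  assumes "set xs \<subseteq> carrier G" "distinct xs" "h \<in> carrier G" "y \<in> set xs"
  shows "commutator_prod G xs (\<lambda>x. if x = y then h else \<one>) = commutator h y"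
  using assms
proof (induction xs)
  case (Cons x xs)
  have notin: "commutator_prod G zs (\<lambda>x. if x = y then h else \<one>) = \<one>"
    if "set zs \<subseteq> carrier G" "y \<notin> set zs" for zs
    using that by (induction zs) auto
  show ?case
  proof (cases "x = y")
    case True
    then have "y \<notin> set xs" using Cons.prems by auto
    then show ?thesis using True Cons.prems notin[of xs] by simp
  next
    case False
    then have "commutator_prod G xs (\<lambda>x. if x = y then h else \<one>) = commutator h y"
      using Cons by auto
    moreover have "y \<in> carrier G" using Cons.prems by auto
    ultimately show ?thesis using False Cons.prems by simp
  qed
qed simp

text \<open>The deep factors [b x, x] and their products are central at this precision, so they can
  be collected in front, for coefficients a of any depth.\<close>

lemma commutator_prod_mult:
  assumes "set xs \<subseteq> carrier G" "\<And>x. a x \<in> carrier G" "\<And>x. b x \<in> lcs G m"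
  shows "lcs G (Suc (Suc m)) #> commutator_prod G xs (\<lambda>x. a x \<otimes> b x) =
    lcs G (Suc (Suc m)) #> (commutator_prod G xs b \<otimes> commutator_prod G xs a)"
  using assms(1)
proof (induction xs)
  case (Cons x xs)
  let ?n = "Suc (Suc m)"
  let ?C = "commutator_prod G xs" and ?N = "nu ?n G" and ?p = "\<lambda>c. lcs G ?n #> c"
  interpret p: group_hom G ?N ?p by (rule nu_hom)
  have x: "x \<in> carrier G" and xs: "set xs \<subseteq> carrier G" using Cons.prems by auto
  note bc = lcs_closed[OF assms(3)]
  have ab: "a x \<otimes> b x \<in> carrier G" for x using assms(2) bc by simp
  note c1 = commutator_closed[OF ab[of x] x] and ca = commutator_closed[OF assms(2)[of x] x]
    and cb = commutator_closed[OF bc[of x] x]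
  note C1 = commutator_prod_closed[OF xs ab] and Ca = commutator_prod_closed[OF xs assms(2)]
    and Cb = commutator_prod_closed[OF xs bc]
  note Cbl = commutator_prod_lcs[OF xs assms(3)]
  have h1: "?p (commutator_prod G (x # xs) (\<lambda>x. a x \<otimes> b x)) = ?p (commutator (a x \<otimes> b x) x) \<otimes>\<^bsub>?N\<^esub> ?p (?C (\<lambda>x. a x \<otimes> b x))"
    using nu_mult[OF c1 C1] by simp
  have h2: "?p (commutator (a x \<otimes> b x) x) = ?p (commutator (b x) x) \<otimes>\<^bsub>?N\<^esub> ?p (commutator (a x) x)"
    using commutator_mult_left[OF assms(2) assms(3) x] nu_mult[OF cb ca] by simp
  have h3: "?p (?C (\<lambda>x. a x \<otimes> b x)) = ?p (?C b) \<otimes>\<^bsub>?N\<^esub> ?p (?C a)"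
    using Cons.IH[OF xs] nu_mult[OF Cb Ca] by simp
  have h4: "?p (commutator (a x) x) \<otimes>\<^bsub>?N\<^esub> ?p (?C b) = ?p (?C b) \<otimes>\<^bsub>?N\<^esub> ?p (commutator (a x) x)"
    by (rule nu_central[OF Cbl p.hom_closed[OF ca]])
  have h5: "?p (commutator_prod G (x # xs) b \<otimes> commutator_prod G (x # xs) a) =
      (?p (commutator (b x) x) \<otimes>\<^bsub>?N\<^esub> ?p (?C b)) \<otimes>\<^bsub>?N\<^esub> (?p (commutator (a x) x) \<otimes>\<^bsub>?N\<^esub> ?p (?C a))"
    using nu_mult[OF m_closed[OF cb Cb] m_closed[OF ca Ca]] nu_mult[OF cb Cb] nu_mult[OF ca Ca] by simp
  note pc = p.hom_closed[OF ca] p.hom_closed[OF cb] p.hom_closed[OF Ca] p.hom_closed[OF Cb]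
  show ?case unfolding h1 h2 h3 h5 by (rule p.H.mult_interchange[OF pc h4])
qed simp

end

text \<open>\<open>xs_generate\<close> expresses that the images of \<open>xs\<close> generate the
  abelianization of pi_0 = F_0 / \<open>B0\<close>.\<close>

locale fin_gen_trunc_sgroup = trunc_sgroup F0 F1 F2 d0 d1 e0 e1 e2 s t0 t1
  for F0 :: "'a monoid" and F1 :: "'b monoid" and F2 :: "'c monoid" and d0 d1 e0 e1 e2 s t0 t1 +
  fixes xs :: "'a list"
  assumes xs_closed: "set xs \<subseteq> carrier F0" and xs_distinct: "distinct xs"
    and xs_generate: "generate F0 (set xs \<union> B0 \<union> lcs F0 1) = carrier F0"
begin

abbreviation "C \<equiv> commutator_prod F0 xs"

abbreviation cl where "cl n x \<equiv> lcs F0 n #>\<^bsub>F0\<^esub> x"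

text \<open>The desired form, up to an error in \<open>lcs F0 (Suc (Suc m))\<close>. Requiring u in
  \<open>lcs F1 (Suc m)\<close> makes the repeated corrections of the boundary factor converge in
  the completion of F_1.\<close>

definition approximable where
  "approximable m = {c \<in> carrier F0. \<exists>a u. (\<forall>x. a x \<in> lcs F0 m) \<and> u \<in> N1 \<and> u \<in> lcs F1 (Suc m) \<and>
     cl (Suc (Suc m)) c = cl (Suc (Suc m)) (C a \<otimes>\<^bsub>F0\<^esub> d1 u)}"

lemma approximableI:
  assumes "c \<in> carrier F0" "\<And>x. a x \<in> lcs F0 m" "u \<in> N1" "u \<in> lcs F1 (Suc m)"
    "cl (Suc (Suc m)) c = cl (Suc (Suc m)) (C a \<otimes>\<^bsub>F0\<^esub> d1 u)"
  shows "c \<in> approximable m"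
  unfolding approximable_def using assms by blast

lemma approximableE:
  assumes "c \<in> approximable m"
  obtains a u where "c \<in> carrier F0" "\<forall>x. a x \<in> lcs F0 m" "u \<in> N1" "u \<in> lcs F1 (Suc m)"
    "cl (Suc (Suc m)) c = cl (Suc (Suc m)) (C a \<otimes>\<^bsub>F0\<^esub> d1 u)"
  using assms unfolding approximable_def by blast

lemma d1_lcs: "u \<in> lcs F1 k \<Longrightarrow> d1 u \<in> lcs F0 k"
  using d1.lcs_image_subset[of k] by (rule subsetD[OF _ imageI])

lemma C_closed: "(\<And>x. a x \<in> carrier F0) \<Longrightarrow> C a \<in> carrier F0"
  by (rule F0.commutator_prod_closed[OF xs_closed])

lemma C_lcs: "(\<And>x. a x \<in> lcs F0 m) \<Longrightarrow> C a \<in> lcs F0 (Suc m)"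
  by (rule F0.commutator_prod_lcs[OF xs_closed])

lemma approximable_cong:
  assumes "c \<in> approximable m" "c' \<in> carrier F0" "cl (Suc (Suc m)) c' = cl (Suc (Suc m)) c"
  shows "c' \<in> approximable m"
  using assms(1) by (rule approximableE) (use assms(2,3) in \<open>auto intro: approximableI\<close>)

text \<open>The factors d1 u and \<open>C b\<close> are exchanged, which is possible since
  \<open>C b\<close> is central at this precision. The new coefficient is b x times a x, in this
  order, because \<open>commutator_prod_mult\<close> reverses the factors.\<close>

lemma approximable_mult:
  assumes "c \<in> approximable m" "c' \<in> approximable m"
  shows "c \<otimes>\<^bsub>F0\<^esub> c' \<in> approximable m"
proof -
  let ?n = "Suc (Suc m)"
  let ?N = "nu ?n F0"
  interpret p: group_hom F0 ?N "r_coset F0 (lcs F0 ?n)" by (rule F0.nu_hom)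
  obtain a u where a: "c \<in> carrier F0" "\<forall>x. a x \<in> lcs F0 m" "u \<in> N1" "u \<in> lcs F1 (Suc m)"
    "cl ?n c = cl ?n (C a \<otimes>\<^bsub>F0\<^esub> d1 u)" using assms(1) by (rule approximableE)
  obtain b v where b: "c' \<in> carrier F0" "\<forall>x. b x \<in> lcs F0 m" "v \<in> N1" "v \<in> lcs F1 (Suc m)"
    "cl ?n c' = cl ?n (C b \<otimes>\<^bsub>F0\<^esub> d1 v)" using assms(2) by (rule approximableE)
  note al = a(2)[rule_format] and bl = b(2)[rule_format]
  note ac = F0.lcs_closed[OF al] and bc = F0.lcs_closed[OF bl]
  note du = d1.hom_closed[OF N1_D(1)[OF a(3)]] and dv = d1.hom_closed[OF N1_D(1)[OF b(3)]]
  note Ca = C_closed[of a, OF ac] and Cb = C_closed[of b, OF bc]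
  have ba: "b x \<otimes>\<^bsub>F0\<^esub> a x \<in> lcs F0 m" for x by (rule subgroup.m_closed[OF F0.lcs_subgroup bl al])
  note Cba = C_closed[of "\<lambda>x. b x \<otimes>\<^bsub>F0\<^esub> a x", OF F0.lcs_closed[OF ba]]
  have "cl ?n (c \<otimes>\<^bsub>F0\<^esub> c') = (cl ?n (C a) \<otimes>\<^bsub>?N\<^esub> cl ?n (d1 u)) \<otimes>\<^bsub>?N\<^esub> (cl ?n (C b) \<otimes>\<^bsub>?N\<^esub> cl ?n (d1 v))"
    unfolding p.hom_mult[OF a(1) b(1)] a(5) b(5) p.hom_mult[OF Ca du] p.hom_mult[OF Cb dv] ..
  moreover have "cl ?n (d1 u) \<otimes>\<^bsub>?N\<^esub> cl ?n (C b) = cl ?n (C b) \<otimes>\<^bsub>?N\<^esub> cl ?n (d1 u)"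
    by (rule F0.nu_central[OF C_lcs[OF bl] p.hom_closed[OF du]])
  moreover have "cl ?n (C (\<lambda>x. b x \<otimes>\<^bsub>F0\<^esub> a x)) = cl ?n (C a) \<otimes>\<^bsub>?N\<^esub> cl ?n (C b)"
    using F0.commutator_prod_mult[OF xs_closed, of b a m, OF bc al] p.hom_mult[OF Ca Cb] by simp
  moreover have "cl ?n (C (\<lambda>x. b x \<otimes>\<^bsub>F0\<^esub> a x) \<otimes>\<^bsub>F0\<^esub> d1 (u \<otimes>\<^bsub>F1\<^esub> v)) =
     cl ?n (C (\<lambda>x. b x \<otimes>\<^bsub>F0\<^esub> a x)) \<otimes>\<^bsub>?N\<^esub> (cl ?n (d1 u) \<otimes>\<^bsub>?N\<^esub> cl ?n (d1 v))"
    using p.hom_mult[OF Cba F0.m_closed[OF du dv]] p.hom_mult[OF du dv]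
      d1.hom_mult[OF N1_D(1)[OF a(3)] N1_D(1)[OF b(3)]] by simp
  ultimately have "cl ?n (c \<otimes>\<^bsub>F0\<^esub> c') = cl ?n (C (\<lambda>x. b x \<otimes>\<^bsub>F0\<^esub> a x) \<otimes>\<^bsub>F0\<^esub> d1 (u \<otimes>\<^bsub>F1\<^esub> v))"
    using p.H.mult_interchange[OF p.hom_closed[OF du] p.hom_closed[OF Ca] p.hom_closed[OF dv] p.hom_closed[OF Cb]]
    by simp
  then show ?thesis
    by (rule approximableI[OF F0.m_closed[OF a(1) b(1)] ba N1_mult[OF a(3) b(3)]
          subgroup.m_closed[OF F1.lcs_subgroup a(4) b(4)]])
qed

lemma approximable_lcs_Suc_Suc:
  assumes "c \<in> lcs F0 (Suc (Suc m))"
  shows "c \<in> approximable m"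
proof (rule approximableI[of c "\<lambda>x. \<one>\<^bsub>F0\<^esub>" m "\<one>\<^bsub>F1\<^esub>"])
  show "cl (Suc (Suc m)) c = cl (Suc (Suc m)) (C (\<lambda>x. \<one>\<^bsub>F0\<^esub>) \<otimes>\<^bsub>F0\<^esub> d1 \<one>\<^bsub>F1\<^esub>)"
    using assms F0.lcs_rcos_eq_one_iff[OF F0.lcs_closed[OF assms], of "Suc (Suc m)"]
    by (simp add: F0.commutator_prod_one[OF xs_closed] F0.coset_mult_one subgroup.subset[OF F0.lcs_subgroup])
qed (use assms F0.lcs_closed F0.lcs_subgroup F1.lcs_subgroup N1_one subgroup.one_closed in blast)+

lemma approximable_inv:
  assumes "c \<in> approximable m"
  shows "inv\<^bsub>F0\<^esub> c \<in> approximable m"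
proof -
  let ?n = "Suc (Suc m)"
  let ?N = "nu ?n F0"
  interpret p: group_hom F0 ?N "r_coset F0 (lcs F0 ?n)" by (rule F0.nu_hom)
  obtain a u where a: "c \<in> carrier F0" "\<forall>x. a x \<in> lcs F0 m" "u \<in> N1" "u \<in> lcs F1 (Suc m)"
    "cl ?n c = cl ?n (C a \<otimes>\<^bsub>F0\<^esub> d1 u)" using assms by (rule approximableE)
  note al = a(2)[rule_format]
  note ac = F0.lcs_closed[OF al] and du = d1.hom_closed[OF N1_D(1)[OF a(3)]]
  note Ca = C_closed[of a, OF ac]
  have il: "inv\<^bsub>F0\<^esub> a x \<in> lcs F0 m" for x by (rule subgroup.m_inv_closed[OF F0.lcs_subgroup al])
  let ?i = "\<lambda>x. inv\<^bsub>F0\<^esub> a x"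
  note Ci = C_closed[of ?i, OF F0.lcs_closed[OF il]]
  have "cl ?n (C (\<lambda>x. \<one>\<^bsub>F0\<^esub>)) = cl ?n (C ?i) \<otimes>\<^bsub>?N\<^esub> cl ?n (C a)"
    using F0.commutator_prod_mult[OF xs_closed, of a ?i m, OF ac il] p.hom_mult[OF Ci Ca] ac by simp
  then have 1: "cl ?n (C ?i) \<otimes>\<^bsub>?N\<^esub> cl ?n (C a) = \<one>\<^bsub>?N\<^esub>"
    using F0.commutator_prod_one[OF xs_closed] p.hom_one by simp
  have 2: "cl ?n (C ?i) = inv\<^bsub>?N\<^esub> cl ?n (C a)"
    by (rule p.H.inv_equality[symmetric, OF 1 p.hom_closed[OF Ca] p.hom_closed[OF Ci]])
  have 3: "cl ?n (d1 u) \<otimes>\<^bsub>?N\<^esub> cl ?n (C a) = cl ?n (C a) \<otimes>\<^bsub>?N\<^esub> cl ?n (d1 u)"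
    by (rule F0.nu_central[OF C_lcs[OF al] p.hom_closed[OF du]])
  have "cl ?n (inv\<^bsub>F0\<^esub> c) = inv\<^bsub>?N\<^esub> (cl ?n (d1 u) \<otimes>\<^bsub>?N\<^esub> cl ?n (C a))"
    unfolding p.hom_inv[OF a(1)] a(5) p.hom_mult[OF Ca du] 3 ..
  also have "\<dots> = inv\<^bsub>?N\<^esub> cl ?n (C a) \<otimes>\<^bsub>?N\<^esub> inv\<^bsub>?N\<^esub> cl ?n (d1 u)"
    by (rule p.H.inv_mult_group[OF p.hom_closed[OF du] p.hom_closed[OF Ca]])
  also have "\<dots> = cl ?n (C ?i \<otimes>\<^bsub>F0\<^esub> d1 (inv\<^bsub>F1\<^esub> u))"
    unfolding 2[symmetric] d1.hom_inv[OF N1_D(1)[OF a(3)]] p.hom_mult[OF Ci F0.inv_closed[OF du]] p.hom_inv[OF du] ..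
  finally have "cl ?n (inv\<^bsub>F0\<^esub> c) = cl ?n (C ?i \<otimes>\<^bsub>F0\<^esub> d1 (inv\<^bsub>F1\<^esub> u))" .
  then show ?thesis
    by (rule approximableI[OF F0.inv_closed[OF a(1)] il N1_inv[OF a(3)]
          subgroup.m_inv_closed[OF F1.lcs_subgroup a(4)]])
qed

lemma approximable_subgroup: "subgroup (approximable m) F0"
proof (rule F0.subgroupI)
  show "approximable m \<subseteq> carrier F0" by (auto simp: approximable_def)
  have "\<one>\<^bsub>F0\<^esub> \<in> approximable m"
    by (rule approximable_lcs_Suc_Suc[OF subgroup.one_closed[OF F0.lcs_subgroup]])
  then show "approximable m \<noteq> {}" by blast
qed (rule approximable_inv approximable_mult, assumption+)+

text \<open>The g that satisfy the claim for all h of depth m form a subgroup, because [h, g] is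
  multiplicative in g at this precision. It remains to treat the three kinds of generators of
  F_0.\<close>

lemma commutator_approximable:
  assumes g: "g \<in> carrier F0"
  shows "\<forall>h \<in> lcs F0 m. F0.commutator h g \<in> approximable m"
proof -
  let ?n = "Suc (Suc m)"
  let ?N = "nu ?n F0"
  let ?Q = "{g \<in> carrier F0. \<forall>h \<in> lcs F0 m. F0.commutator h g \<in> approximable m}"
  have cc: "F0.commutator h g \<in> carrier F0" if "h \<in> lcs F0 m" "g \<in> carrier F0" for h g
    by (rule F0.commutator_closed[OF F0.lcs_closed[OF that(1)] that(2)])
  have "subgroup ?Q F0"
  proof (rule F0.subgroupI)
    have "\<one>\<^bsub>F0\<^esub> \<in> ?Q"
      using F0.lcs_closed subgroup.one_closed[OF approximable_subgroup] by simp
    then show "?Q \<noteq> {}" by blast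
    fix g assume g: "g \<in> ?Q"
    have "F0.commutator h (inv\<^bsub>F0\<^esub> g) \<in> approximable m" if h: "h \<in> lcs F0 m" for h
    proof -
      interpret f: group_hom F0 ?N "\<lambda>g. cl ?n (F0.commutator h g)" by (rule F0.commutator_hom[OF h])
      interpret p: group_hom F0 ?N "r_coset F0 (lcs F0 ?n)" by (rule F0.nu_hom)
      have gc: "g \<in> carrier F0" using g by simp
      have "cl ?n (F0.commutator h (inv\<^bsub>F0\<^esub> g)) = cl ?n (inv\<^bsub>F0\<^esub> F0.commutator h g)"
        using f.hom_inv[OF gc] p.hom_inv[OF cc[OF h gc]] by (rule trans_sym)
      moreover have "inv\<^bsub>F0\<^esub> F0.commutator h g \<in> approximable m"
        by (rule approximable_inv) (use g h in blast)
      ultimately show ?thesis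
        using approximable_cong cc[OF h F0.inv_closed[OF gc]] by blast
    qed
    then show "inv\<^bsub>F0\<^esub> g \<in> ?Q" using g by simp
    fix k assume k: "k \<in> ?Q"
    have "F0.commutator h (g \<otimes>\<^bsub>F0\<^esub> k) \<in> approximable m" if h: "h \<in> lcs F0 m" for h
    proof -
      have gk: "g \<in> carrier F0" "k \<in> carrier F0" using g k by simp_all
      have "F0.commutator h g \<otimes>\<^bsub>F0\<^esub> F0.commutator h k \<in> approximable m"
        by (rule approximable_mult) (use g k h in blast)+
      then show ?thesis
        by (rule approximable_cong[OF _ cc[OF h F0.m_closed[OF gk]] F0.commutator_mult_right[OF h gk]])
    qed
    then show "g \<otimes>\<^bsub>F0\<^esub> k \<in> ?Q" using g k by simp
  qed (rule Collect_restrict)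
  moreover have "set xs \<union> B0 \<union> lcs F0 1 \<subseteq> ?Q"
  proof (intro Un_least subsetI CollectI conjI ballI)
    fix y h assume y: "y \<in> set xs" and h: "h \<in> lcs F0 m"
    \<comment> \<open>For an entry of \<open>xs\<close> the commutator [h, y] is already of the
      required form: coefficient h at y, trivial elsewhere, and no boundary factor.\<close>
    let ?a = "\<lambda>x. if x = y then h else \<one>\<^bsub>F0\<^esub>"
    have yc: "y \<in> carrier F0" using y xs_closed by blast
    have "C ?a = F0.commutator h y"
      by (rule F0.commutator_prod_single[OF xs_closed xs_distinct F0.lcs_closed[OF h] y])
    then show "F0.commutator h y \<in> approximable m"
      using h subgroup.one_closed[OF F0.lcs_subgroup] cc[OF h yc]
      by (intro approximableI[of _ ?a m "\<one>\<^bsub>F1\<^esub>"])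
        (auto simp: N1_one subgroup.one_closed[OF F1.lcs_subgroup])
  next
    fix y assume "y \<in> set xs" then show "y \<in> carrier F0" using xs_closed by blast
  next
    fix y assume "y \<in> B0" then show "y \<in> carrier F0"
      using subgroup.mem_carrier[OF normal_imp_subgroup[OF B0_normal]] by blast
  next
    fix y h assume "y \<in> B0" and h: "h \<in> lcs F0 m"
    then obtain u where u: "u \<in> N1" "y = d1 u" by (elim B0_E)
    note hc = F0.lcs_closed[OF h] and uc = N1_D[OF u(1)]
    have sh: "s h \<in> lcs F1 m" using s.lcs_image_subset[of m] h by blast
    \<comment> \<open>The degeneracy lifts [h, d1 u] to the chain [s h, u], which stays in ker d_0
      with u and is one commutator level deeper than s h.\<close>
    let ?v = "F1.commutator (s h) u"
    have "F0.commutator h y = d1 ?v" using hc uc u(2) by (simp add: d_s)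
    moreover have "?v \<in> N1" using hc uc by (simp add: N1_def d_s)
    moreover have "?v \<in> lcs F1 (Suc m)" by (rule F1.commutator_lcs[OF sh uc(1)])
    ultimately show "F0.commutator h y \<in> approximable m"
      using subgroup.one_closed[OF F0.lcs_subgroup] N1_D(1)
      by (intro approximableI[of _ "\<lambda>x. \<one>\<^bsub>F0\<^esub>" m ?v])
        (auto simp: F0.commutator_prod_one[OF xs_closed])
  next
    fix y assume "y \<in> lcs F0 1" then show "y \<in> carrier F0" by (rule F0.lcs_closed)
  next
    \<comment> \<open>For y in the commutator subgroup, [h, y] falls into the error term.\<close>
    fix y h assume "y \<in> lcs F0 1" "h \<in> lcs F0 m"
    then show "F0.commutator h y \<in> approximable m"
      by (intro approximable_lcs_Suc_Suc F0.commutator_lcs_1)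
  qed
  ultimately have "generate F0 (set xs \<union> B0 \<union> lcs F0 1) \<subseteq> ?Q"
    by (intro F0.generate_subgroup_incl)
  then show ?thesis using g xs_generate by blast
qed

lemma lcs_Suc_approximable: "lcs F0 (Suc m) \<subseteq> approximable m"
  unfolding lcs.simps(2)
  by (rule F0.generate_subgroup_incl[OF _ approximable_subgroup]) (use commutator_approximable in blast)

text \<open>The error T (C A d1 U)^-1 lies in \<open>lcs F0 (Suc (n + m))\<close> and is
  approximable there, with coefficients b and a chain v. These are absorbed as A b and v U, so A and
  U change only by deep factors.\<close>

lemma approximation_step:
  assumes A: "\<And>x. A x \<in> lcs F0 m" and U: "U \<in> N1"
    and T: "T \<in> carrier F0" "cl (Suc (n + m)) T = cl (Suc (n + m)) (C A \<otimes>\<^bsub>F0\<^esub> d1 U)"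
  obtains A' U' where "\<forall>x. A' x \<in> lcs F0 m" "U' \<in> N1"
    "cl (Suc (Suc (n + m))) T = cl (Suc (Suc (n + m))) (C A' \<otimes>\<^bsub>F0\<^esub> d1 U')"
    "\<forall>x. cl (n + m) (A' x) = cl (n + m) (A x)"
    "lcs F1 (Suc (n + m)) #>\<^bsub>F1\<^esub> U' = lcs F1 (Suc (n + m)) #>\<^bsub>F1\<^esub> U"
proof -
  let ?k = "n + m"
  let ?n = "Suc (Suc ?k)"
  let ?N = "nu ?n F0"
  interpret p: group_hom F0 ?N "r_coset F0 (lcs F0 ?n)" by (rule F0.nu_hom)
  note Ac = F0.lcs_closed[OF A] and Uc = N1_D(1)[OF U]
  note CA = C_closed[of A, OF Ac] and dU = d1.hom_closed[OF Uc]
  let ?e = "T \<otimes>\<^bsub>F0\<^esub> inv\<^bsub>F0\<^esub> (C A \<otimes>\<^bsub>F0\<^esub> d1 U)"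
  have "?e \<in> lcs F0 (Suc ?k)"
    using T(2) F0.lcs_rcos_eq_iff[OF T(1) F0.m_closed[OF CA dU], of "Suc ?k"] by simp
  then have "?e \<in> approximable ?k" using lcs_Suc_approximable by blast
  then obtain b v where e: "?e \<in> carrier F0" and b': "\<forall>x. b x \<in> lcs F0 ?k"
    and v: "v \<in> N1" "v \<in> lcs F1 (Suc ?k)"
    and ebv: "cl ?n ?e = cl ?n (C b \<otimes>\<^bsub>F0\<^esub> d1 v)" by (rule approximableE)
  note b = b'[rule_format]
  note bc = F0.lcs_closed[OF b] and vc = N1_D(1)[OF v(1)]
  note Cb = C_closed[of b, OF bc] and dv = d1.hom_closed[OF vc]
  have bm: "b x \<in> lcs F0 m" for x
    using b[of x] F0.lcs_antimono[of m ?k] by auto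
  let ?A = "\<lambda>x. A x \<otimes>\<^bsub>F0\<^esub> b x" and ?U = "v \<otimes>\<^bsub>F1\<^esub> U"
  have Am: "?A x \<in> lcs F0 m" for x by (rule subgroup.m_closed[OF F0.lcs_subgroup A bm])
  note CA' = C_closed[of ?A, OF F0.lcs_closed[OF Am]]
  have 1: "cl ?n (C ?A \<otimes>\<^bsub>F0\<^esub> d1 ?U) = (cl ?n (C b) \<otimes>\<^bsub>?N\<^esub> cl ?n (C A)) \<otimes>\<^bsub>?N\<^esub> (cl ?n (d1 v) \<otimes>\<^bsub>?N\<^esub> cl ?n (d1 U))"
    using F0.commutator_prod_mult[OF xs_closed, of A b ?k, OF Ac b] p.hom_mult[OF Cb CA]
      p.hom_mult[OF CA' F0.m_closed[OF dv dU]] p.hom_mult[OF dv dU] d1.hom_mult[OF vc Uc] by simp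
  \<comment> \<open>d1 v is as deep as the error itself, hence commutes with \<open>C A\<close> at
    this precision and can be moved next to d1 U.\<close>
  have 2: "cl ?n (C A) \<otimes>\<^bsub>?N\<^esub> cl ?n (d1 v) = cl ?n (d1 v) \<otimes>\<^bsub>?N\<^esub> cl ?n (C A)"
    by (rule F0.nu_central[OF d1_lcs[OF v(2)] p.hom_closed[OF CA]])
  have 3: "cl ?n T = cl ?n ?e \<otimes>\<^bsub>?N\<^esub> (cl ?n (C A) \<otimes>\<^bsub>?N\<^esub> cl ?n (d1 U))"
  proof -
    have "T = ?e \<otimes>\<^bsub>F0\<^esub> (C A \<otimes>\<^bsub>F0\<^esub> d1 U)"
      using T(1) F0.m_closed[OF CA dU] by (simp add: F0.m_assoc)
    then show ?thesis
      using p.hom_mult[OF e F0.m_closed[OF CA dU]] p.hom_mult[OF CA dU] by simp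
  qed
  have c1: "cl ?n T = cl ?n (C ?A \<otimes>\<^bsub>F0\<^esub> d1 ?U)"
    unfolding 1 3 ebv p.hom_mult[OF Cb dv]
    by (rule p.H.mult_interchange[OF p.hom_closed[OF dv] p.hom_closed[OF Cb] p.hom_closed[OF dU]
        p.hom_closed[OF CA] 2[symmetric]])
  have c2: "?U \<in> N1" by (rule N1_mult[OF v(1) U])
  have c3: "cl ?k (?A x) = cl ?k (A x)" for x
  proof -
    have "A x \<otimes>\<^bsub>F0\<^esub> b x \<otimes>\<^bsub>F0\<^esub> inv\<^bsub>F0\<^esub> A x \<in> lcs F0 ?k"
      by (rule normal.inv_op_closed2[OF F0.lcs_normal Ac b])
    then show ?thesis using F0.lcs_rcos_eq_iff[OF F0.m_closed[OF Ac bc] Ac] by blast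
  qed
  have c4: "lcs F1 (Suc ?k) #>\<^bsub>F1\<^esub> ?U = lcs F1 (Suc ?k) #>\<^bsub>F1\<^esub> U"
  proof -
    have "?U \<otimes>\<^bsub>F1\<^esub> inv\<^bsub>F1\<^esub> U \<in> lcs F1 (Suc ?k)"
      using v(2) vc Uc by (simp add: F1.m_assoc)
    then show ?thesis using F1.lcs_rcos_eq_iff[OF F1.m_closed[OF vc Uc] Uc] by blast
  qed
  show ?thesis by (rule that[of ?A ?U]) (use Am c1 c2 c3 c4 in blast)+
qed

text \<open>Iterating the correction gives coefficients and chains that stabilise modulo ever deeper
  terms, as coherence requires. The state of the recursion is the pair of the coefficient function
  and the chain.\<close>

lemma approximation:
  assumes T: "\<And>n. T n \<in> lcs F0 (Suc m)"
    "\<And>n. cl (Suc (n + m)) (T (Suc n)) = cl (Suc (n + m)) (T n)"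
  obtains A U where "\<forall>n x. A n x \<in> lcs F0 m" "\<forall>n. U n \<in> N1"
    "\<forall>n. cl (Suc (n + m)) (T n) = cl (Suc (n + m)) (C (A n) \<otimes>\<^bsub>F0\<^esub> d1 (U n))"
    "\<forall>n x. cl (n + m) (A (Suc n) x) = cl (n + m) (A n x)"
    "\<forall>n. lcs F1 (Suc (n + m)) #>\<^bsub>F1\<^esub> U (Suc n) = lcs F1 (Suc (n + m)) #>\<^bsub>F1\<^esub> U n"
proof -
  let ?P = "\<lambda>n (A, U). (\<forall>x. A x \<in> lcs F0 m) \<and> U \<in> N1 \<and>
    cl (Suc (n + m)) (T n) = cl (Suc (n + m)) (C A \<otimes>\<^bsub>F0\<^esub> d1 U)"
  let ?R = "\<lambda>n (A, U) (A', U'). (\<forall>x. cl (n + m) (A' x) = cl (n + m) (A x)) \<and>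
    lcs F1 (Suc (n + m)) #>\<^bsub>F1\<^esub> U' = lcs F1 (Suc (n + m)) #>\<^bsub>F1\<^esub> U"
  note Tc = F0.lcs_closed[OF T(1)]
  have "\<exists>f. \<forall>n. ?P n (f n) \<and> ?R n (f n) (f (Suc n))"
  proof (rule dependent_nat_choice)
    \<comment> \<open>At stage 0 the precision is only \<open>Suc m\<close>, where T 0 is trivial;
      trivial coefficients and the trivial chain start the recursion.\<close>
    have "cl (Suc m) (T 0) = lcs F0 (Suc m)"
      using T(1) F0.lcs_rcos_eq_one_iff[OF Tc] by blast
    then have "?P 0 (\<lambda>x. \<one>\<^bsub>F0\<^esub>, \<one>\<^bsub>F1\<^esub>)"
      by (simp add: F0.commutator_prod_one[OF xs_closed] N1_one subgroup.one_closed[OF F0.lcs_subgroup]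
          F0.coset_mult_one subgroup.subset[OF F0.lcs_subgroup])
    then show "\<exists>x. ?P 0 x" by (rule exI)
    fix x n assume Px: "?P n x"
    obtain A U where x: "x = (A, U)" by (cases x)
    have AU: "\<And>x. A x \<in> lcs F0 m" "U \<in> N1"
      "cl (Suc (n + m)) (T (Suc n)) = cl (Suc (n + m)) (C A \<otimes>\<^bsub>F0\<^esub> d1 U)"
      using Px T(2)[of n] unfolding x by simp_all
    obtain A' U' where "\<forall>x. A' x \<in> lcs F0 m" "U' \<in> N1"
      "cl (Suc (Suc (n + m))) (T (Suc n)) = cl (Suc (Suc (n + m))) (C A' \<otimes>\<^bsub>F0\<^esub> d1 U')"
      "\<forall>x. cl (n + m) (A' x) = cl (n + m) (A x)"
      "lcs F1 (Suc (n + m)) #>\<^bsub>F1\<^esub> U' = lcs F1 (Suc (n + m)) #>\<^bsub>F1\<^esub> U"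
      by (rule approximation_step[OF AU(1,2) Tc AU(3)])
    then have "?P (Suc n) (A', U') \<and> ?R n x (A', U')" unfolding x by simp
    then show "\<exists>y. ?P (Suc n) y \<and> ?R n x y" by (rule exI)
  qed
  then obtain f where f: "\<forall>n. ?P n (f n) \<and> ?R n (f n) (f (Suc n))" by (elim exE)
  show ?thesis
    by (rule that[of "\<lambda>n. fst (f n)" "\<lambda>n. snd (f n)"])
      (use f in \<open>simp_all add: case_prod_unfold\<close>)
qed

lemma coherent_C:
  assumes A: "\<And>x. coherent F0 (\<lambda>n. A n x)" and ys: "set ys \<subseteq> carrier F0"
  shows "coherent F0 (\<lambda>n. commutator_prod F0 ys (A n))"
  using ys
proof (induction ys)
  case Nil
  show ?case by (simp add: F0.coherent_const)
next
  case (Cons y ys)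
  have y: "coherent F0 (\<lambda>n. y)" using Cons.prems by (intro F0.coherent_const) simp
  have "coherent F0 (\<lambda>n. commutator_prod F0 ys (A n))" using Cons by simp
  then show ?case
    by (simp add: F0.coherent_mult F0.coherent_inv A y)
qed

text \<open>\<open>K\<close> will be the kernel of $\widehat{F_0} \to \pi_0(\widehat F)$: in the expression of \<open>z\<close> as
  a product of commutators and a boundary, the boundary dies modulo \<open>K\<close>.\<close>

lemma pronil_lcs:
  assumes K: "K \<lhd> pronil F0"
    and dK: "\<And>U. coherent F1 U \<Longrightarrow> (\<And>n. U n \<in> N1) \<Longrightarrow> pro_class F0 (\<lambda>n. d1 (U n)) \<in> K"
    and z: "z \<in> carrier (pronil F0)" "z m = lcs F0 m"
  shows "K #>\<^bsub>pronil F0\<^esub> z \<in> lcs (pronil F0 Mod K) m"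
  using z
proof (induction m arbitrary: z)
  case 0
  then show ?case by (auto simp: carrier_FactGroup)
next
  case (Suc m)
  let ?Z = "pronil F0 Mod K" and ?q = "r_coset (pronil F0) K"
  interpret Z: group_hom "pronil F0" ?Z ?q by (rule normal.rcos_hom[OF K])
  obtain t where t: "coherent F0 t" "z = pro_class F0 t" by (rule F0.pro_classE[OF Suc.prems(1)])
  note tc = F0.coherent_closed[OF t(1)]
  \<comment> \<open>The shift by m + 1 puts every term into \<open>lcs F0 (Suc m)\<close>; by
    \<open>coherent_le\<close> the shifted sequence represents the same element.\<close>
  define T where "T n = t (Suc (n + m))" for n
  have Tm: "T n \<in> lcs F0 (Suc m)" for n
  proof -
    have "cl (Suc m) (T n) = lcs F0 (Suc m)"
      unfolding T_def using F0.coherent_le[OF t(1), of "Suc m" "Suc (n + m)"] Suc.prems(2)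
      by (simp add: t(2) pro_class_def)
    then show ?thesis using F0.lcs_rcos_eq_one_iff[of "T n" "Suc m"] tc by (simp add: T_def)
  qed
  have T_Suc: "cl (Suc (n + m)) (T (Suc n)) = cl (Suc (n + m)) (T n)" for n
    using t(1) by (simp add: T_def coherent_def)
  obtain A U where AU0: "\<forall>n x. A n x \<in> lcs F0 m" "\<forall>n. U n \<in> N1"
    "\<forall>n. cl (Suc (n + m)) (T n) = cl (Suc (n + m)) (C (A n) \<otimes>\<^bsub>F0\<^esub> d1 (U n))"
    "\<forall>n x. cl (n + m) (A (Suc n) x) = cl (n + m) (A n x)"
    "\<forall>n. lcs F1 (Suc (n + m)) #>\<^bsub>F1\<^esub> U (Suc n) = lcs F1 (Suc (n + m)) #>\<^bsub>F1\<^esub> U n"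
    by (rule approximation[of T, OF Tm T_Suc])
  note AU = AU0[rule_format]
  note Ac = F0.lcs_closed[OF AU(1)] and Uc = N1_D(1)[OF AU(2)]
  have A: "coherent F0 (\<lambda>n. A n x)" for x
    unfolding coherent_def
    using Ac F0.lcs_rcos_antimono[OF AU(4)] by (metis le_add1)
  have U: "coherent F1 U"
    unfolding coherent_def
    using Uc F1.lcs_rcos_antimono[OF AU(5)] by (metis le_add1 le_SucI)
  have dU: "coherent F0 (\<lambda>n. d1 (U n))" by (rule d1.coherent_image[OF U])
  have CA: "coherent F0 (\<lambda>n. C (A n))" by (rule coherent_C[OF A xs_closed])
  \<comment> \<open>At stage n the approximation is precise modulo
    \<open>lcs F0 (Suc (n + m))\<close>, which is more than component n requires.\<close>
  have zeq: "z = pro_class F0 (\<lambda>n. C (A n) \<otimes>\<^bsub>F0\<^esub> d1 (U n))"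
  proof
    fix n
    have "z n = cl n (T n)"
      using F0.coherent_le[OF t(1), of n "Suc (n + m)"] by (simp add: t(2) pro_class_def T_def)
    also have "\<dots> = cl n (C (A n) \<otimes>\<^bsub>F0\<^esub> d1 (U n))"
      by (rule F0.lcs_rcos_antimono[OF AU(3)])
        (use tc F0.coherent_closed[OF CA] F0.coherent_closed[OF dU] in \<open>simp_all add: T_def\<close>)
    finally show "z n = pro_class F0 (\<lambda>n. C (A n) \<otimes>\<^bsub>F0\<^esub> d1 (U n)) n" by (simp add: pro_class_def)
  qed
  \<comment> \<open>The limit of the coefficients at x is trivial in component m, so the induction
    hypothesis, stated for all z, applies to it.\<close>
  have Alcs: "?q (pro_class F0 (\<lambda>n. A n x)) \<in> lcs ?Z m" for x
  proof (rule Suc.IH[OF F0.pro_class_closed[OF A]])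
    show "pro_class F0 (\<lambda>n. A n x) m = lcs F0 m"
      using F0.lcs_rcos_eq_one_iff[OF Ac] AU(1) by (simp add: pro_class_def)
  qed
  \<comment> \<open>The list stays fixed while n varies. Hence passing to the completion yields a
    finite product of genuine commutators of limits.\<close>
  have Clcs: "?q (pro_class F0 (\<lambda>n. commutator_prod F0 ys (A n))) \<in> lcs ?Z (Suc m)"
    if "set ys \<subseteq> carrier F0" for ys
    using that
  proof (induction ys)
    case Nil
    have "pro_class F0 (\<lambda>n. \<one>\<^bsub>F0\<^esub>) = \<one>\<^bsub>pronil F0\<^esub>"
      by (simp add: pro_class_def F0.one_pronil F0.coset_mult_one subgroup.subset[OF F0.lcs_subgroup])
    then show ?case using Z.hom_one subgroup.one_closed[OF Z.H.lcs_subgroup] by simp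
  next
    case (Cons y ys)
    have y: "coherent F0 (\<lambda>n. y)" using Cons.prems by (intro F0.coherent_const) simp
    have ys: "set ys \<subseteq> carrier F0" using Cons.prems by simp
    note IH = Cons.IH[OF ys] and Cys = coherent_C[of A, OF A ys]
    let ?a = "pro_class F0 (\<lambda>n. A n y)" and ?y = "pro_class F0 (\<lambda>n. y)"
    have "pro_class F0 (\<lambda>n. commutator_prod F0 (y # ys) (A n)) =
      ?a \<otimes>\<^bsub>pronil F0\<^esub> ?y \<otimes>\<^bsub>pronil F0\<^esub> inv\<^bsub>pronil F0\<^esub> ?a \<otimes>\<^bsub>pronil F0\<^esub> inv\<^bsub>pronil F0\<^esub> ?y
        \<otimes>\<^bsub>pronil F0\<^esub> pro_class F0 (\<lambda>n. commutator_prod F0 ys (A n))"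
      using A y Cys by (simp add: F0.pro_class_mult F0.pro_class_inv F0.coherent_mult F0.coherent_inv)
    moreover have "Z.H.commutator (?q ?a) (?q ?y) \<in> lcs ?Z (Suc m)"
      by (rule Z.H.commutator_lcs[OF Alcs Z.hom_closed[OF F0.pro_class_closed[OF y]]])
    ultimately show ?case
      using subgroup.m_closed[OF Z.H.lcs_subgroup _ IH] F0.pro_class_closed[OF A] F0.pro_class_closed[OF y]
        F0.pro_class_closed[OF Cys] by (simp del: mult_FactGroup)
  qed
  have "?q z = ?q (pro_class F0 (\<lambda>n. C (A n))) \<otimes>\<^bsub>?Z\<^esub> ?q (pro_class F0 (\<lambda>n. d1 (U n)))"
    unfolding zeq F0.pro_class_mult[OF CA dU, symmetric]
    by (rule Z.hom_mult[OF F0.pro_class_closed[OF CA] F0.pro_class_closed[OF dU]])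
  also have "?q (pro_class F0 (\<lambda>n. d1 (U n))) = \<one>\<^bsub>?Z\<^esub>"
    using normal.rcos_eq_self_iff[OF K F0.pro_class_closed[OF dU]] dK[OF U AU(2)] by simp
  also have "?q (pro_class F0 (\<lambda>n. C (A n))) \<otimes>\<^bsub>?Z\<^esub> \<one>\<^bsub>?Z\<^esub> = ?q (pro_class F0 (\<lambda>n. C (A n)))"
    by (rule Z.H.r_one[OF Z.hom_closed[OF F0.pro_class_closed[OF CA]]])
  finally show ?case using Clcs[OF xs_closed] by simp
qed

end

section \<open>The tower of nilpotent quotients of a simplicial group\<close>

lemma (in group) nu_carrierE:
  assumes "x \<in> carrier (nu n G)"
  obtains y where "y \<in> carrier G" "x = lcs G n #> y"
  using assms unfolding carrier_nu by (elim imageE)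

context trunc_sgroup
begin

lemma nu_trunc_sgroup:
  "trunc_sgroup (nu n F0) (nu n F1) (nu n F2) (nu_map F0 n d0) (nu_map F0 n d1)
    (nu_map F1 n e0) (nu_map F1 n e1) (nu_map F1 n e2) (nu_map F1 n s) (nu_map F2 n t0) (nu_map F2 n t1)"
proof (rule trunc_sgroup.intro; (rule d0.nu_map_hom d1.nu_map_hom e0.nu_map_hom e1.nu_map_hom
      e2.nu_map_hom s.nu_map_hom t0.nu_map_hom t1.nu_map_hom)?)
  note maps = d0.nu_map_rcos d1.nu_map_rcos e0.nu_map_rcos e1.nu_map_rcos e2.nu_map_rcos
    s.nu_map_rcos t0.nu_map_rcos t1.nu_map_rcos
  fix x assume "x \<in> carrier (nu n F0)"
  then obtain y where y: "y \<in> carrier F0" "x = lcs F0 n #>\<^bsub>F0\<^esub> y" by (rule F0.nu_carrierE)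
  show "nu_map F0 n d0 (nu_map F1 n s x) = x" "nu_map F0 n d1 (nu_map F1 n s x) = x"
    using y by (simp_all add: maps d_s)
next
  note maps = d0.nu_map_rcos d1.nu_map_rcos e0.nu_map_rcos e1.nu_map_rcos e2.nu_map_rcos
    s.nu_map_rcos t0.nu_map_rcos t1.nu_map_rcos
  fix x assume "x \<in> carrier (nu n F1)"
  then obtain y where y: "y \<in> carrier F1" "x = lcs F1 n #>\<^bsub>F1\<^esub> y" by (rule F1.nu_carrierE)
  show "nu_map F1 n e0 (nu_map F2 n t0 x) = x" "nu_map F1 n e1 (nu_map F2 n t0 x) = x"
    "nu_map F1 n e2 (nu_map F2 n t0 x) = nu_map F1 n s (nu_map F0 n d1 x)"
    "nu_map F1 n e0 (nu_map F2 n t1 x) = nu_map F1 n s (nu_map F0 n d0 x)"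
    "nu_map F1 n e1 (nu_map F2 n t1 x) = x" "nu_map F1 n e2 (nu_map F2 n t1 x) = x"
    using y by (simp_all add: maps e_t0 e_t1)
next
  note maps = d0.nu_map_rcos d1.nu_map_rcos e0.nu_map_rcos e1.nu_map_rcos e2.nu_map_rcos
  fix x assume "x \<in> carrier (nu n F2)"
  then obtain y where y: "y \<in> carrier F2" "x = lcs F2 n #>\<^bsub>F2\<^esub> y" by (rule F2.nu_carrierE)
  show "nu_map F0 n d0 (nu_map F1 n e1 x) = nu_map F0 n d0 (nu_map F1 n e0 x)"
    "nu_map F0 n d0 (nu_map F1 n e2 x) = nu_map F0 n d1 (nu_map F1 n e0 x)"
    "nu_map F0 n d1 (nu_map F1 n e2 x) = nu_map F0 n d1 (nu_map F1 n e1 x)"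
    using y by (simp_all add: maps d_e)
qed

end

lemma (in group_hom) nu_proj_nu_map:
  assumes "x \<in> carrier (nu (Suc n) G)"
  shows "nu_proj H n (nu_map H (Suc n) h x) = nu_map H n h (nu_proj G n x)"
proof -
  obtain y where y: "y \<in> carrier G" "x = lcs G (Suc n) #> y" using assms by (rule G.nu_carrierE)
  then show ?thesis by (simp add: nu_map_rcos G.nu_proj_rcos H.nu_proj_rcos)
qed

lemma (in trunc_sgroup) nu_tower:
  "sgroup_tower (\<lambda>n. nu n F0) (\<lambda>n. nu n F1) (\<lambda>n. nu n F2) (\<lambda>n. nu_map F0 n d0) (\<lambda>n. nu_map F0 n d1)
    (\<lambda>n. nu_map F1 n e0) (\<lambda>n. nu_map F1 n e1) (\<lambda>n. nu_map F1 n e2) (\<lambda>n. nu_map F1 n s)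
    (\<lambda>n. nu_map F2 n t0) (\<lambda>n. nu_map F2 n t1) (nu_proj F0) (nu_proj F1) (nu_proj F2)"
  by (rule sgroup_tower.intro)
    (rule nu_trunc_sgroup F0.nu_proj_hom F1.nu_proj_hom F2.nu_proj_hom F1.nu_proj_surj F2.nu_proj_surj
      d0.nu_proj_nu_map d1.nu_proj_nu_map e0.nu_proj_nu_map e1.nu_proj_nu_map e2.nu_proj_nu_map
      s.nu_proj_nu_map t0.nu_proj_nu_map t1.nu_proj_nu_map, assumption?)+

text \<open>The truncation to dimensions at most two determines pi_0 and pi_1, so the simplicial
  identities are recorded in this range.\<close>

locale simplicial_group =
  fixes S :: "'a sgroup"
  assumes trunc: "trunc_sgroup (grp S 0) (grp S 1) (grp S 2) (gface S 1 0) (gface S 1 1)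
    (gface S 2 0) (gface S 2 1) (gface S 2 2) (gdegen S 0 0) (gdegen S 1 0) (gdegen S 1 1)"
begin

abbreviation "F0 \<equiv> grp S 0"
abbreviation "F1 \<equiv> grp S 1"
abbreviation "F2 \<equiv> grp S 2"

sublocale T: trunc_sgroup F0 F1 F2 "gface S 1 0" "gface S 1 1"
  "gface S 2 0" "gface S 2 1" "gface S 2 2" "gdegen S 0 0" "gdegen S 1 0" "gdegen S 1 1"
  by (rule trunc)

sublocale nu: sgroup_tower "\<lambda>n. nu n F0" "\<lambda>n. nu n F1" "\<lambda>n. nu n F2"
  "\<lambda>n. nu_map F0 n (gface S 1 0)" "\<lambda>n. nu_map F0 n (gface S 1 1)"
  "\<lambda>n. nu_map F1 n (gface S 2 0)" "\<lambda>n. nu_map F1 n (gface S 2 1)" "\<lambda>n. nu_map F1 n (gface S 2 2)"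
  "\<lambda>n. nu_map F1 n (gdegen S 0 0)" "\<lambda>n. nu_map F2 n (gdegen S 1 0)" "\<lambda>n. nu_map F2 n (gdegen S 1 1)"
  "nu_proj F0" "nu_proj F1" "nu_proj F2"
  by (rule T.nu_tower)

section \<open>Translation of the Moore complex definitions into the notation of the tower\<close>

lemma ball_less_1: "(\<forall>i<(1::nat). P i) \<longleftrightarrow> P 0"
  by simp

lemma ball_less_2: "(\<forall>i<(2::nat). P i) \<longleftrightarrow> P 0 \<and> P 1"
  by (auto simp: numeral_2_eq_2 less_Suc_eq)

lemma snu_simps:
  "grp (snu n S) m = nu n (grp S m)"
  "gface (snu n S) m i = nu_map (grp S (m - 1)) n (gface S m i)"
  by (simp_all add: snu_def)

lemma moore_snu_1: "moore (snu n S) 1 = nu.S.N1 n"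
  unfolding moore_def nu.S.N1_def ball_less_1 snu_simps by simp

lemma moore_snu_2: "moore (snu n S) 2 = nu.S.N2 n"
  unfolding moore_def nu.S.N2_def ball_less_2 snu_simps by simp

lemma moore_cycles_snu_1: "moore_cycles (snu n S) 1 = nu.S.Z1 n"
  unfolding moore_cycles_def moore_snu_1 nu.S.Z1_def snu_simps by simp

lemma moore_bounds_snu_0: "moore_bounds (snu n S) 0 = nu.S.B0 n"
  unfolding moore_bounds_def One_nat_def[symmetric] moore_snu_1 nu.S.B0_def snu_simps by simp

lemma moore_bounds_snu_1: "moore_bounds (snu n S) 1 = nu.S.B1 n"
  unfolding moore_bounds_def Suc_1 moore_snu_2 nu.S.B1_def snu_simps by simp

lemma pi1_tower_eq: "pi1_tower S = (\<lambda>n. nu.S.pi1 n)"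
  unfolding pi1_tower_def hpi_def moore_cycles_snu_1 moore_bounds_snu_1 snu_simps ..

lemma pi1_tower_map_eq: "pi1_tower_map S = nu.pi1_map"
  unfolding pi1_tower_map_def hpi_map_def moore_bounds_snu_1 snu_simps nu.pi1_map_def[abs_def]
    nu_proj_def ..

lemma milnor_delta_eq: "milnor_delta S = nu.delta"
proof
  have [simp]: "grp S (1 - 1) = F0" by simp
  fix \<xi>
  show "milnor_delta S \<xi> = nu.delta \<xi>"
    unfolding milnor_delta_def nu.delta_def nu.chain_end_def moore_snu_1 snu_simps by simp
qed

lemma spronil_0: "grp (spronil S) 0 = pronil F0"
  by (simp add: spronil_def)

lemma L0_eq: "nu.L0 = pronil F0"
  by (simp add: pronil_def)

text \<open>Limits are formed componentwise: a Moore 1-chain of the completed simplicial group is a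
  compatible sequence of Moore 1-chains, and the boundaries of these make up
  \<open>LB\<close>.\<close>

lemma moore_bounds_spronil_0: "moore_bounds (spronil S) 0 = nu.LB"
proof -
  have "moore (spronil S) 1 = {w. \<forall>n. w n \<in> nu.S.N1 n \<and> nu_proj F1 n (w (Suc n)) = w n}"
  proof -
    have "\<one>\<^bsub>pronil F0\<^esub> = (\<lambda>n. \<one>\<^bsub>nu n F0\<^esub>)"
      unfolding T.F0.one_pronil by (simp add: T.F0.one_nu)
    then have "(pronil_map F0 (gface S 1 0) w = \<one>\<^bsub>pronil F0\<^esub>) \<longleftrightarrow>
        (\<forall>n. nu_map F0 n (gface S 1 0) (w n) = \<one>\<^bsub>nu n F0\<^esub>)" for w
      by (simp only: pronil_map_def fun_eq_iff)
    then show ?thesis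
      unfolding moore_def ball_less_1 spronil_def sgroup.select_convs nu.S.N1_def T.F1.carrier_pronil
      by auto
  qed
  then show ?thesis
    unfolding moore_bounds_def nu.LB_def One_nat_def[symmetric] nu.chain_end_def[abs_def]
    by (simp add: spronil_def pronil_map_def[abs_def])
qed

lemma hpi_0_spronil: "hpi 0 (spronil S) = pronil F0 Mod nu.LB"
proof -
  have "moore_cycles (spronil S) 0 = carrier (pronil F0)"
    by (simp add: moore_cycles_def moore_def spronil_0)
  then show ?thesis
    by (simp add: hpi_def spronil_0 moore_bounds_spronil_0)
qed

lemma LB_normal: "nu.LB \<lhd> pronil F0"
  using nu.LB_normal by (simp only: L0_eq)

end

section \<open>Resolutions of groups with finitely generated abelianization\<close>

declare One_nat_def [simp del]

text \<open>The hypotheses are injectivity and surjectivity of the induced maps, expressed on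
  representatives. This form suits a map that covers its target only modulo lower central
  terms.\<close>

lemma (in group_hom) nu_map_iso:
  assumes inj: "\<And>x n. x \<in> carrier G \<Longrightarrow> h x \<in> lcs H n \<Longrightarrow> x \<in> lcs G n"
    and surj: "\<And>y n. y \<in> carrier H \<Longrightarrow> \<exists>x\<in>carrier G. y \<otimes>\<^bsub>H\<^esub> inv\<^bsub>H\<^esub> h x \<in> lcs H n"
  shows "nu_map H n h \<in> iso (nu n G) (nu n H)"
proof (rule isoI)
  interpret nm: group_hom "nu n G" "nu n H" "nu_map H n h" by (rule nu_map_hom)
  show "nu_map H n h \<in> hom (nu n G) (nu n H)" by (rule nm.homh)
  show "bij_betw (nu_map H n h) (carrier (nu n G)) (carrier (nu n H))"
    unfolding bij_betw_def
  proof
    show "inj_on (nu_map H n h) (carrier (nu n G))"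
    proof (rule inj_onI)
      fix x y assume xy: "x \<in> carrier (nu n G)" "y \<in> carrier (nu n G)" "nu_map H n h x = nu_map H n h y"
      obtain a where a: "a \<in> carrier G" "x = lcs G n #> a" by (rule G.nu_carrierE[OF xy(1)])
      obtain b where b: "b \<in> carrier G" "y = lcs G n #> b" by (rule G.nu_carrierE[OF xy(2)])
      have "h a \<otimes>\<^bsub>H\<^esub> inv\<^bsub>H\<^esub> h b \<in> lcs H n"
        using xy(3) a b by (simp add: nu_map_rcos H.lcs_rcos_eq_iff)
      then have "a \<otimes> inv b \<in> lcs G n" using a(1) b(1) inj[of "a \<otimes> inv b" n] by simp
      then show "x = y" using a b by (simp add: G.lcs_rcos_eq_iff)
    qed
    show "nu_map H n h ` carrier (nu n G) = carrier (nu n H)"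
    proof (intro subset_antisym subsetI)
      fix y assume "y \<in> nu_map H n h ` carrier (nu n G)"
      then show "y \<in> carrier (nu n H)" using nm.hom_closed by (elim imageE) simp
    next
      fix y assume "y \<in> carrier (nu n H)"
      then obtain b where b: "b \<in> carrier H" "y = lcs H n #>\<^bsub>H\<^esub> b" by (rule H.nu_carrierE)
      obtain x where x: "x \<in> carrier G" "b \<otimes>\<^bsub>H\<^esub> inv\<^bsub>H\<^esub> h x \<in> lcs H n" using surj[OF b(1)] by blast
      have "y = nu_map H n h (lcs G n #> x)"
        using x b by (simp add: nu_map_rcos H.lcs_rcos_eq_iff)
      moreover have "lcs G n #> x \<in> carrier (nu n G)" unfolding G.carrier_nu by (rule imageI[OF x(1)])
      ultimately show "y \<in> nu_map H n h ` carrier (nu n G)" by (rule image_eqI)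
    qed
  qed
qed

text \<open>\<open>nu n G\<close> has nilpotency class at most n. Consequently every homomorphism
  into it kills the lower central term of index n of its source, which bounds that term from
  above.\<close>

lemma (in group) lcs_nu: "lcs (nu n G) n = {\<one>\<^bsub>nu n G\<^esub>}"
proof -
  interpret p: group_hom G "nu n G" "r_coset G (lcs G n)" by (rule nu_hom)
  have "lcs (nu n G) n = r_coset G (lcs G n) ` lcs G n"
    by (rule p.lcs_image_eq[symmetric]) (simp add: carrier_nu)
  also have "\<dots> = {lcs G n}"
  proof (intro subset_antisym subsetI)
    fix x assume "x \<in> r_coset G (lcs G n) ` lcs G n"
    then show "x \<in> {lcs G n}" using lcs_rcos_eq_one_iff[OF lcs_closed] by auto
  next
    fix x assume "x \<in> {lcs G n}"
    then show "x \<in> r_coset G (lcs G n) ` lcs G n"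
      using p.hom_one subgroup.one_closed[OF lcs_subgroup] by (auto simp: one_nu intro!: image_eqI[of _ _ \<one>])
  qed
  finally show ?thesis by (simp add: one_nu)
qed

text \<open>The augmentation identifies pi_0 = F_0 / \<open>B0\<close> with G. The section is a map
  of sets and is multiplicative modulo boundaries; X is a finite set that generates G modulo
  commutators.\<close>

locale resolution = simplicial_group S
  for S :: "'a sgroup" +
  fixes G :: "('b, 'c) monoid_scheme" and aug :: "'a \<Rightarrow> 'b" and \<sigma> :: "'b \<Rightarrow> 'a" and X :: "'b set"
  assumes aug_hom: "group_hom F0 G aug"
    and aug_kernel: "\<And>x. x \<in> carrier F0 \<Longrightarrow> aug x = \<one>\<^bsub>G\<^esub> \<longleftrightarrow> x \<in> T.B0"
    and section_closed: "\<And>g. g \<in> carrier G \<Longrightarrow> \<sigma> g \<in> carrier F0"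
    and aug_section: "\<And>g. g \<in> carrier G \<Longrightarrow> aug (\<sigma> g) = g"
    and X: "finite X" "X \<subseteq> carrier G" "generate G (X \<union> lcs G 1) = carrier G"
begin

sublocale aug: group_hom F0 G aug by (rule aug_hom)

definition xs where "xs = (SOME xs. set xs = \<sigma> ` X \<and> distinct xs)"

lemma xs: "set xs = \<sigma> ` X" "distinct xs"
  using someI_ex[OF finite_distinct_list[of "\<sigma> ` X"]] X(1) unfolding xs_def by simp_all

lemma aug_surj: "aug ` carrier F0 = carrier G"
proof (intro subset_antisym subsetI)
  fix g assume "g \<in> carrier G"
  then show "g \<in> aug ` carrier F0" using section_closed aug_section by (intro image_eqI[of _ _ "\<sigma> g"]) simp_all
qed auto

text \<open>X lifts along the section and \<open>lcs G 1\<close> lifts along the surjection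
  \<open>aug\<close>; the remaining difference lies in the kernel \<open>B0\<close>.\<close>

lemma xs_generates: "generate F0 (set xs \<union> T.B0 \<union> lcs F0 1) = carrier F0"
proof -
  let ?A = "set xs \<union> T.B0 \<union> lcs F0 1"
  have A: "?A \<subseteq> carrier F0"
    using X(2) section_closed T.F0.lcs_closed subgroup.mem_carrier[OF normal_imp_subgroup[OF T.B0_normal]]
    unfolding xs(1) by blast
  have B: "set xs \<union> lcs F0 1 \<subseteq> carrier F0" using A by simp
  have "aug ` (set xs \<union> lcs F0 1) = X \<union> lcs G 1"
  proof -
    have "aug ` \<sigma> ` X = (\<lambda>x. x) ` X"
      unfolding image_image by (rule image_cong[OF refl]) (use X(2) aug_section in blast)
    then have "aug ` \<sigma> ` X = X" by simp
    then show ?thesis unfolding image_Un xs(1) aug.lcs_image_eq[OF aug_surj] by simp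
  qed
  then have gen: "aug ` generate F0 (set xs \<union> lcs F0 1) = carrier G"
    using aug.generate_img[OF B] X(3) by simp
  have "x \<in> generate F0 ?A" if x: "x \<in> carrier F0" for x
  proof -
    have "aug x \<in> aug ` generate F0 (set xs \<union> lcs F0 1)" unfolding gen using x by simp
    then obtain y where y: "y \<in> generate F0 (set xs \<union> lcs F0 1)" "aug y = aug x" by (metis imageE)
    have yc: "y \<in> carrier F0" by (rule T.F0.generate_in_carrier[OF B y(1)])
    have "aug (x \<otimes>\<^bsub>F0\<^esub> inv\<^bsub>F0\<^esub> y) = \<one>\<^bsub>G\<^esub>" using x yc y(2) by simp
    then have "x \<otimes>\<^bsub>F0\<^esub> inv\<^bsub>F0\<^esub> y \<in> T.B0" using x yc aug_kernel[of "x \<otimes>\<^bsub>F0\<^esub> inv\<^bsub>F0\<^esub> y"] by simp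
    then have 1: "x \<otimes>\<^bsub>F0\<^esub> inv\<^bsub>F0\<^esub> y \<in> generate F0 ?A" by (intro generate.incl) simp
    have "y \<in> generate F0 ?A" using y(1) T.F0.mono_generate[of "set xs \<union> lcs F0 1" ?A] by auto
    from generate.eng[OF 1 this] show ?thesis using x yc by (simp add: T.F0.m_assoc)
  qed
  then show ?thesis using T.F0.generate_in_carrier[OF A] by blast
qed

sublocale fg: fin_gen_trunc_sgroup F0 F1 F2 "gface S 1 0" "gface S 1 1"
  "gface S 2 0" "gface S 2 1" "gface S 2 2" "gdegen S 0 0" "gdegen S 1 0" "gdegen S 1 1" xs
  using X(2) section_closed xs xs_generates
  by unfold_locales auto

abbreviation "Z \<equiv> hpi 0 (spronil S)"
abbreviation "P \<equiv> pronil F0"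
abbreviation "\<pi> \<equiv> r_coset P nu.LB"

definition to_Z where "to_Z g = \<pi> (to_pronil F0 (\<sigma> g))"

definition Z_to_pronil where
  "Z_to_pronil C = (\<lambda>n. the_elem (nu_map G n aug ` milnor_proj S C n))"

sublocale Z: group_hom P Z \<pi>
  unfolding hpi_0_spronil by (rule normal.rcos_hom[OF LB_normal])

lemma Z_classE:
  assumes "C \<in> carrier Z"
  obtains t where "coherent F0 t" "C = \<pi> (pro_class F0 t)"
proof -
  obtain z where z: "z \<in> carrier P" "C = \<pi> z"
    using assms unfolding hpi_0_spronil carrier_FactGroup by (elim imageE)
  show ?thesis by (rule T.F0.pro_classE[OF z(1)]) (use z(2) that in blast)
qed

section \<open>The augmentation and the map to the pronilpotent completion of G\<close>

lemma aug_faces: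
  assumes "y \<in> carrier F1"
  shows "aug (gface S 1 0 y) = aug (gface S 1 1 y)"
proof -
  let ?a = "gface S 1 0 y" and ?b = "gface S 1 1 y"
  have c: "?a \<in> carrier F0" "?b \<in> carrier F0" using assms by simp_all
  have ab: "?a \<otimes>\<^bsub>F0\<^esub> inv\<^bsub>F0\<^esub> ?b \<in> T.B0"
    using T.faces_B0_equal[OF assms] normal.rcos_eq_iff[OF T.B0_normal c] by blast
  have "aug (?a \<otimes>\<^bsub>F0\<^esub> inv\<^bsub>F0\<^esub> ?b) = \<one>\<^bsub>G\<^esub>"
    by (rule aug_kernel[THEN iffD2, OF _ ab]) (use c in simp)
  then have "aug ?a \<otimes>\<^bsub>G\<^esub> inv\<^bsub>G\<^esub> aug ?b = \<one>\<^bsub>G\<^esub>" using c by simp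
  then show ?thesis using c aug.H.inv_equality[of "aug ?a" "inv\<^bsub>G\<^esub> aug ?b"] by simp
qed

text \<open>A boundary is the last face of a chain whose other face is trivial, and both faces have
  the same augmentation.\<close>

lemma nu_map_aug_B0:
  assumes "b \<in> nu.S.B0 n"
  shows "nu_map G n aug b = \<one>\<^bsub>nu n G\<^esub>"
proof -
  obtain y where y: "y \<in> nu.S.N1 n" "b = nu_map F0 n (gface S 1 1) y" using assms by (rule nu.S.B0_E)
  note yN = nu.S.N1_D[OF y(1)]
  obtain v where v: "v \<in> carrier F1" "y = lcs F1 n #>\<^bsub>F1\<^esub> v" by (rule T.F1.nu_carrierE[OF yN(1)])
  have "nu_map G n aug b = lcs G n #>\<^bsub>G\<^esub> aug (gface S 1 1 v)"
    using v by (simp add: y(2) T.d1.nu_map_rcos aug.nu_map_rcos)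
  also have "\<dots> = nu_map G n aug (nu_map F0 n (gface S 1 0) y)"
    using v by (simp add: aug_faces[symmetric] T.d0.nu_map_rcos aug.nu_map_rcos)
  also have "\<dots> = \<one>\<^bsub>nu n G\<^esub>"
    unfolding yN(2) by (rule group_hom.hom_one[OF aug.nu_map_hom])
  finally show ?thesis .
qed

text \<open>In other words pi_0(nu_n F) = nu_n(pi_0 F). For the converse, \<open>aug t\<close> lifts
  to some l in \<open>lcs F0 n\<close>; then t l^-1 is a boundary in F_0, and modulo
  \<open>lcs F0 n\<close> the factor l disappears.\<close>

lemma B0_iff:
  assumes t: "t \<in> carrier F0"
  shows "lcs F0 n #>\<^bsub>F0\<^esub> t \<in> nu.S.B0 n \<longleftrightarrow> aug t \<in> lcs G n"
proof
  assume "lcs F0 n #>\<^bsub>F0\<^esub> t \<in> nu.S.B0 n"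
  then have "lcs G n #>\<^bsub>G\<^esub> aug t = lcs G n"
    using nu_map_aug_B0 aug.nu_map_rcos[OF t] by (metis aug.H.one_nu)
  then show "aug t \<in> lcs G n" using aug.H.lcs_rcos_eq_one_iff[of "aug t" n] t by simp
next
  assume "aug t \<in> lcs G n"
  then obtain l where l: "l \<in> lcs F0 n" "aug l = aug t"
    using aug.lcs_image_eq[OF aug_surj, of n] by (metis imageE)
  note lc = T.F0.lcs_closed[OF l(1)]
  have "t \<otimes>\<^bsub>F0\<^esub> inv\<^bsub>F0\<^esub> l \<in> T.B0"
    using aug_kernel[of "t \<otimes>\<^bsub>F0\<^esub> inv\<^bsub>F0\<^esub> l"] t lc l(2) by simp
  then obtain y where y: "y \<in> T.N1" "t \<otimes>\<^bsub>F0\<^esub> inv\<^bsub>F0\<^esub> l = gface S 1 1 y" by (rule T.B0_E)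
  note yc = T.N1_D[OF y(1)]
  have t_eq: "t = gface S 1 1 y \<otimes>\<^bsub>F0\<^esub> l"
    unfolding y(2)[symmetric] using t lc by (simp add: T.F0.m_assoc)
  have "lcs F0 n #>\<^bsub>F0\<^esub> t = lcs F0 n #>\<^bsub>F0\<^esub> gface S 1 1 y"
    using T.F0.lcs_rcos_eq_iff[of t "gface S 1 1 y" n] t yc(1) l(1) lc t_eq
      normal.inv_op_closed2[OF T.F0.lcs_normal T.d1.hom_closed[OF yc(1)] l(1)] by simp
  also have "\<dots> = nu_map F0 n (gface S 1 1) (lcs F1 n #>\<^bsub>F1\<^esub> y)"
    by (rule T.d1.nu_map_rcos[OF yc(1), symmetric])
  also have "\<dots> \<in> nu.S.B0 n"
  proof (rule nu.S.B0_I[OF nu.S.N1_I])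
    show "lcs F1 n #>\<^bsub>F1\<^esub> y \<in> carrier (nu n F1)" unfolding T.F1.carrier_nu by (rule imageI[OF yc(1)])
    show "nu_map F0 n (gface S 1 0) (lcs F1 n #>\<^bsub>F1\<^esub> y) = \<one>\<^bsub>nu n F0\<^esub>"
      unfolding T.d0.nu_map_rcos[OF yc(1)] yc(2) by (rule group_hom.hom_one[OF T.F0.nu_hom])
  qed
  finally show "lcs F0 n #>\<^bsub>F0\<^esub> t \<in> nu.S.B0 n" .
qed

lemma LB_component: "b \<in> nu.LB \<Longrightarrow> b n \<in> nu.S.B0 n"
  by (erule nu.LB_E) (simp add: nu.chain_end_def nu.S.B0_I)

lemma milnor_proj_class:
  assumes "z \<in> carrier P"
  shows "milnor_proj S (\<pi> z) n = nu.S.B0 n #>\<^bsub>nu n F0\<^esub> z n"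
  unfolding milnor_proj_def hpi_map_def moore_bounds_snu_0 snu_simps
  by (rule coset_map_rcos[OF T.F0.pronil_nu_hom normal_imp_subgroup[OF LB_normal] nu.S.B0_normal _ assms])
    (use LB_component in blast)

text \<open>By \<open>nu_map_aug_B0\<close> the augmentation is constant on each coset of
  boundaries, so its image is a singleton and \<open>the_elem\<close> picks that value.\<close>

lemma Z_to_pronil_class:
  assumes t: "coherent F0 t"
  shows "Z_to_pronil (\<pi> (pro_class F0 t)) = pro_class G (\<lambda>n. aug (t n))"
proof
  fix n
  note tc = T.F0.coherent_closed[OF t, of n]
  interpret m: group_hom "nu n F0" "nu n G" "nu_map G n aug" by (rule aug.nu_map_hom)
  let ?z = "lcs F0 n #>\<^bsub>F0\<^esub> t n"
  have z: "?z \<in> carrier (nu n F0)" unfolding T.F0.carrier_nu by (rule imageI[OF tc])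
  have "nu_map G n aug (b \<otimes>\<^bsub>nu n F0\<^esub> ?z) = lcs G n #>\<^bsub>G\<^esub> aug (t n)" if b: "b \<in> nu.S.B0 n" for b
  proof -
    have bc: "b \<in> carrier (nu n F0)"
      by (rule subgroup.mem_carrier[OF normal_imp_subgroup[OF nu.S.B0_normal] b])
    show ?thesis
      unfolding m.hom_mult[OF bc z] nu_map_aug_B0[OF b] aug.nu_map_rcos[OF tc]
      by (rule m.H.l_one) (use m.hom_closed[OF z] aug.nu_map_rcos[OF tc] in simp)
  qed
  then have "nu_map G n aug ` (nu.S.B0 n #>\<^bsub>nu n F0\<^esub> ?z) = {lcs G n #>\<^bsub>G\<^esub> aug (t n)}"
    using subgroup.one_closed[OF normal_imp_subgroup[OF nu.S.B0_normal[of n]]]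
    unfolding r_coset_def[of "nu n F0"] by auto
  then show "Z_to_pronil (\<pi> (pro_class F0 t)) n = pro_class G (\<lambda>n. aug (t n)) n"
    unfolding Z_to_pronil_def milnor_proj_class[OF T.F0.pro_class_closed[OF t]]
    by (simp add: pro_class_def)
qed

sublocale phi: group_hom Z "pronil G" Z_to_pronil
proof -
  have "Z_to_pronil \<in> hom Z (pronil G)"
  proof (rule homI)
    fix C assume "C \<in> carrier Z"
    then obtain t where t: "coherent F0 t" "C = \<pi> (pro_class F0 t)" by (rule Z_classE)
    show "Z_to_pronil C \<in> carrier (pronil G)"
      unfolding t(2) Z_to_pronil_class[OF t(1)] by (rule aug.H.pro_class_closed[OF aug.coherent_image[OF t(1)]])
  next
    fix C D assume CD: "C \<in> carrier Z" "D \<in> carrier Z"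
    obtain t where t: "coherent F0 t" "C = \<pi> (pro_class F0 t)" by (rule Z_classE[OF CD(1)])
    obtain u where u: "coherent F0 u" "D = \<pi> (pro_class F0 u)" by (rule Z_classE[OF CD(2)])
    have "C \<otimes>\<^bsub>Z\<^esub> D = \<pi> (pro_class F0 (\<lambda>n. t n \<otimes>\<^bsub>F0\<^esub> u n))"
      unfolding t(2) u(2) T.F0.pro_class_mult[OF t(1) u(1), symmetric]
      by (rule Z.hom_mult[symmetric, OF T.F0.pro_class_closed[OF t(1)] T.F0.pro_class_closed[OF u(1)]])
    then have "Z_to_pronil (C \<otimes>\<^bsub>Z\<^esub> D) = pro_class G (\<lambda>n. aug (t n \<otimes>\<^bsub>F0\<^esub> u n))"
      using Z_to_pronil_class[OF T.F0.coherent_mult[OF t(1) u(1)]] by simp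
    also have "\<dots> = pro_class G (\<lambda>n. aug (t n) \<otimes>\<^bsub>G\<^esub> aug (u n))"
      using T.F0.coherent_closed[OF t(1)] T.F0.coherent_closed[OF u(1)] by simp
    also have "\<dots> = Z_to_pronil C \<otimes>\<^bsub>pronil G\<^esub> Z_to_pronil D"
      unfolding t(2) u(2) Z_to_pronil_class[OF t(1)] Z_to_pronil_class[OF u(1)]
      by (rule aug.H.pro_class_mult[symmetric, OF aug.coherent_image[OF t(1)] aug.coherent_image[OF u(1)]])
    finally show "Z_to_pronil (C \<otimes>\<^bsub>Z\<^esub> D) = Z_to_pronil C \<otimes>\<^bsub>pronil G\<^esub> Z_to_pronil D" .
  qed
  then show "group_hom Z (pronil G) Z_to_pronil"
    using Z.H.group_axioms aug.H.pronil_group by (simp add: group_hom_def group_hom_axioms_def)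
qed

text \<open>The entries of a coherent sequence in G are lifted to F_0 inductively, so that
  consecutive lifts agree modulo \<open>lcs F0 n\<close>.\<close>

lemma phi_surj: "Z_to_pronil ` carrier Z = carrier (pronil G)"
proof (intro subset_antisym subsetI)
  fix y assume "y \<in> Z_to_pronil ` carrier Z"
  then show "y \<in> carrier (pronil G)" using phi.hom_closed by (elim imageE) simp
next
  fix y assume "y \<in> carrier (pronil G)"
  then obtain g where g: "coherent G g" "y = pro_class G g" by (rule aug.H.pro_classE)
  note gc = aug.H.coherent_closed[OF g(1)]
  have "\<exists>t. \<forall>n. (t n \<in> carrier F0 \<and> lcs G n #>\<^bsub>G\<^esub> aug (t n) = lcs G n #>\<^bsub>G\<^esub> g n) \<and>
      lcs F0 n #>\<^bsub>F0\<^esub> t (Suc n) = lcs F0 n #>\<^bsub>F0\<^esub> t n"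
  proof (rule dependent_nat_choice)
    show "\<exists>x. x \<in> carrier F0 \<and> lcs G 0 #>\<^bsub>G\<^esub> aug x = lcs G 0 #>\<^bsub>G\<^esub> g 0"
      using section_closed[OF gc] aug_section[OF gc] by metis
    fix x n assume x: "x \<in> carrier F0 \<and> lcs G n #>\<^bsub>G\<^esub> aug x = lcs G n #>\<^bsub>G\<^esub> g n"
    then have xc: "x \<in> carrier F0" by simp
    let ?y = "\<sigma> (g (Suc n))"
    have y: "?y \<in> carrier F0" "aug ?y = g (Suc n)" using section_closed[OF gc] aug_section[OF gc] by simp_all
    have "lcs G n #>\<^bsub>G\<^esub> aug x = lcs G n #>\<^bsub>G\<^esub> g (Suc n)"
      using x g(1) by (simp add: coherent_def)
    then have "aug x \<otimes>\<^bsub>G\<^esub> inv\<^bsub>G\<^esub> aug ?y \<in> lcs G n"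
      using aug.H.lcs_rcos_eq_iff[of "aug x" "g (Suc n)" n] xc y gc by simp
    then obtain l where l: "l \<in> lcs F0 n" "aug l = aug x \<otimes>\<^bsub>G\<^esub> inv\<^bsub>G\<^esub> aug ?y"
      using aug.lcs_image_eq[OF aug_surj, of n] by (metis imageE)
    note lc = T.F0.lcs_closed[OF l(1)]
    \<comment> \<open>The section applied to g_{n+1} would ignore the previous lift x. Dividing x by
      an l of depth n with the augmentation of x g_{n+1}^-1 gives the augmentation g_{n+1} and keeps
      the class of x.\<close>
    let ?w = "inv\<^bsub>F0\<^esub> l \<otimes>\<^bsub>F0\<^esub> x"
    have "aug ?w = g (Suc n)"
      using xc lc y gc by (simp add: l(2) aug.H.inv_mult_group aug.H.m_assoc)
    moreover have "lcs F0 n #>\<^bsub>F0\<^esub> ?w = lcs F0 n #>\<^bsub>F0\<^esub> x"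
      using T.F0.lcs_rcos_eq_iff[of ?w x n] xc lc subgroup.m_inv_closed[OF T.F0.lcs_subgroup l(1)]
      by (simp add: T.F0.m_assoc)
    moreover have "?w \<in> carrier F0" using xc lc by simp
    ultimately show "\<exists>w. (w \<in> carrier F0 \<and> lcs G (Suc n) #>\<^bsub>G\<^esub> aug w = lcs G (Suc n) #>\<^bsub>G\<^esub> g (Suc n)) \<and>
        lcs F0 n #>\<^bsub>F0\<^esub> w = lcs F0 n #>\<^bsub>F0\<^esub> x"
      by (intro exI[of _ ?w]) simp
  qed
  then obtain t where t: "\<forall>n. (t n \<in> carrier F0 \<and> lcs G n #>\<^bsub>G\<^esub> aug (t n) = lcs G n #>\<^bsub>G\<^esub> g n) \<and>
      lcs F0 n #>\<^bsub>F0\<^esub> t (Suc n) = lcs F0 n #>\<^bsub>F0\<^esub> t n" by (elim exE)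
  have tc: "coherent F0 t" using t by (simp add: coherent_def)
  have "y = Z_to_pronil (\<pi> (pro_class F0 t))"
    unfolding Z_to_pronil_class[OF tc] g(2) using t by (simp add: pro_class_def)
  then show "y \<in> Z_to_pronil ` carrier Z"
    by (rule image_eqI) (rule Z.hom_closed[OF T.F0.pro_class_closed[OF tc]])
qed

section \<open>The lower central series of pi_0 of the completed resolution\<close>

lemma const_LB:
  assumes "coherent F1 U" "\<And>n. U n \<in> T.N1"
  shows "pro_class F0 (\<lambda>n. gface S 1 1 (U n)) \<in> nu.LB"
proof -
  note Uc = T.N1_D[OF assms(2)]
  have "nu.chain_end (pro_class F1 U) \<in> nu.LB"
  proof (rule nu.LB_I)
    fix n
    show "pro_class F1 U n \<in> nu.S.N1 n"
    proof (rule nu.S.N1_I)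
      show "pro_class F1 U n \<in> carrier (nu n F1)"
        unfolding T.F1.carrier_nu pro_class_def by (rule imageI[OF Uc(1)])
      show "nu_map F0 n (gface S 1 0) (pro_class F1 U n) = \<one>\<^bsub>nu n F0\<^esub>"
        unfolding pro_class_def T.d0.nu_map_rcos[OF Uc(1)] Uc(2)
        by (rule group_hom.hom_one[OF T.F0.nu_hom])
    qed
    show "nu_proj F1 n (pro_class F1 U (Suc n)) = pro_class F1 U n"
      using T.F1.pro_class_closed[OF assms(1)] unfolding T.F1.carrier_pronil by simp
  qed
  moreover have "nu.chain_end (pro_class F1 U) = pro_class F0 (\<lambda>n. gface S 1 1 (U n))"
    unfolding nu.chain_end_def pro_class_def T.d1.nu_map_rcos[OF Uc(1)] ..
  ultimately show ?thesis by simp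
qed

text \<open>A boundary in F_0 bounds a constant, hence compatible, sequence of chains. It therefore
  vanishes in pi_0 of the completion itself, not merely in each component.\<close>

lemma B0_LB:
  assumes "b \<in> T.B0"
  shows "to_pronil F0 b \<in> nu.LB"
proof -
  obtain y where y: "y \<in> T.N1" "b = gface S 1 1 y" using assms by (rule T.B0_E)
  show ?thesis
    unfolding T.F0.to_pronil_eq y(2)
    by (rule const_LB[of "\<lambda>n. y"]) (use y(1) T.N1_D T.F1.coherent_const in simp_all)
qed

text \<open>Membership in \<open>lcs Z m\<close> forces triviality in \<open>nu m G\<close>, whose
  own term of index m is trivial. Conversely the representative is changed by a boundary of F_0
  until its component m is trivial; then \<open>pronil_lcs\<close> applies.\<close>

lemma Z_lcs_iff:
  assumes t: "coherent F0 t"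
  shows "\<pi> (pro_class F0 t) \<in> lcs Z m \<longleftrightarrow> aug (t m) \<in> lcs G m"
proof
  note tc = T.F0.coherent_closed[OF t, of m]
  assume C: "\<pi> (pro_class F0 t) \<in> lcs Z m"
  have f: "group_hom Z (nu m G) ((\<lambda>z. z m) \<circ> Z_to_pronil)"
    using Group.hom_compose[OF phi.homh group_hom.homh[OF aug.H.pronil_nu_hom[of m]]]
    by (simp add: group_hom_def group_hom_axioms_def aug.H.nu_group Z.H.group_axioms)
  have "((\<lambda>z. z m) \<circ> Z_to_pronil) (\<pi> (pro_class F0 t)) \<in> lcs (nu m G) m"
    by (rule subsetD[OF group_hom.lcs_image_subset[OF f] imageI[OF C]])
  then have "lcs G m #>\<^bsub>G\<^esub> aug (t m) = lcs G m"
    unfolding comp_def Z_to_pronil_class[OF t] aug.H.lcs_nu by (simp add: pro_class_def aug.H.one_nu)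
  then show "aug (t m) \<in> lcs G m" using aug.H.lcs_rcos_eq_one_iff[of "aug (t m)" m] tc by simp
next
  note tc = T.F0.coherent_closed[OF t, of m]
  assume "aug (t m) \<in> lcs G m"
  then obtain l where l: "l \<in> lcs F0 m" "aug l = aug (t m)"
    using aug.lcs_image_eq[OF aug_surj, of m] by (metis imageE)
  note lc = T.F0.lcs_closed[OF l(1)]
  \<comment> \<open>The difference between t m and a lift l of the right depth with the same
    augmentation. Being a boundary, it can be divided out as a constant sequence.\<close>
  let ?b = "t m \<otimes>\<^bsub>F0\<^esub> inv\<^bsub>F0\<^esub> l"
  have b: "?b \<in> carrier F0" using tc lc by simp
  have "aug ?b = \<one>\<^bsub>G\<^esub>" using tc lc l(2) by simp
  then have "?b \<in> T.B0" by (rule aug_kernel[THEN iffD1, OF b])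
  then have bLB: "to_pronil F0 ?b \<in> nu.LB" by (rule B0_LB)
  note bcoh = T.F0.coherent_const[OF b] and icoh = T.F0.coherent_inv[OF T.F0.coherent_const[OF b]]
  let ?u = "\<lambda>n. inv\<^bsub>F0\<^esub> ?b \<otimes>\<^bsub>F0\<^esub> t n"
  have u: "coherent F0 ?u" by (rule T.F0.coherent_mult[OF icoh t])
  \<comment> \<open>\<open>const_LB\<close> supplies the condition that boundaries of coherent
    sequences of chains die in the quotient.\<close>
  have "\<pi> (pro_class F0 ?u) \<in> lcs (P Mod nu.LB) m"
  proof (rule fg.pronil_lcs[OF LB_normal const_LB T.F0.pro_class_closed[OF u]])
    have "?u m = l" using tc lc by (simp add: T.F0.inv_mult_group T.F0.m_assoc)
    then show "pro_class F0 ?u m = lcs F0 m"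
      using T.F0.lcs_rcos_eq_one_iff[OF lc] l(1) by (simp add: pro_class_def)
  qed
  moreover have "\<pi> (pro_class F0 t) = \<pi> (pro_class F0 ?u)"
  proof -
    have bp: "to_pronil F0 ?b \<in> carrier P" unfolding T.F0.to_pronil_eq by (rule T.F0.pro_class_closed[OF bcoh])
    have "pro_class F0 ?u = inv\<^bsub>P\<^esub> to_pronil F0 ?b \<otimes>\<^bsub>P\<^esub> pro_class F0 t"
      unfolding T.F0.to_pronil_eq T.F0.pro_class_inv[OF bcoh] by (rule T.F0.pro_class_mult[OF icoh t, symmetric])
    then have "\<pi> (pro_class F0 ?u) = inv\<^bsub>Z\<^esub> \<pi> (to_pronil F0 ?b) \<otimes>\<^bsub>Z\<^esub> \<pi> (pro_class F0 t)"
      using bp T.F0.pro_class_closed[OF t] by simp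
    also have "\<pi> (to_pronil F0 ?b) = \<one>\<^bsub>Z\<^esub>"
      using normal.rcos_eq_self_iff[OF LB_normal bp] bLB by (simp add: hpi_0_spronil)
    finally show ?thesis using Z.hom_closed[OF T.F0.pro_class_closed[OF t]] by simp
  qed
  ultimately show "\<pi> (pro_class F0 t) \<in> lcs Z m" by (simp add: hpi_0_spronil)
qed

text \<open>The section need not be multiplicative, but its defect has trivial augmentation, so it
  is a boundary and dies in Z.\<close>

sublocale to_Z: group_hom G Z to_Z
proof -
  have "to_Z \<in> hom G Z"
  proof (rule homI)
    fix g assume g: "g \<in> carrier G"
    note tg = group_hom.hom_closed[OF T.F0.to_pronil_hom section_closed[OF g]]
    show "to_Z g \<in> carrier Z" unfolding to_Z_def by (rule Z.hom_closed[OF tg])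
    fix h assume h: "h \<in> carrier G"
    note th = group_hom.hom_closed[OF T.F0.to_pronil_hom section_closed[OF h]]
    interpret tp: group_hom F0 P "to_pronil F0" by (rule T.F0.to_pronil_hom)
    have gh: "g \<otimes>\<^bsub>G\<^esub> h \<in> carrier G" using g h by simp
    let ?b = "\<sigma> (g \<otimes>\<^bsub>G\<^esub> h) \<otimes>\<^bsub>F0\<^esub> inv\<^bsub>F0\<^esub> (\<sigma> g \<otimes>\<^bsub>F0\<^esub> \<sigma> h)"
    note c = section_closed[OF g] section_closed[OF h] section_closed[OF gh]
    have b: "?b \<in> carrier F0" using c by simp
    have "aug ?b = \<one>\<^bsub>G\<^esub>"
      using c aug_section[OF g] aug_section[OF h] aug_section[OF gh] g h by simp
    then have "?b \<in> T.B0" by (rule aug_kernel[THEN iffD1, OF b])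
    then have "to_pronil F0 ?b \<in> nu.LB" by (rule B0_LB)
    then have "to_pronil F0 (\<sigma> (g \<otimes>\<^bsub>G\<^esub> h)) \<otimes>\<^bsub>P\<^esub> inv\<^bsub>P\<^esub> (to_pronil F0 (\<sigma> g) \<otimes>\<^bsub>P\<^esub> to_pronil F0 (\<sigma> h)) \<in> nu.LB"
      using c by simp
    then have "\<pi> (to_pronil F0 (\<sigma> (g \<otimes>\<^bsub>G\<^esub> h))) = \<pi> (to_pronil F0 (\<sigma> g) \<otimes>\<^bsub>P\<^esub> to_pronil F0 (\<sigma> h))"
      by (rule normal.rcos_eq_iff[THEN iffD2, OF LB_normal tp.hom_closed[OF c(3)] Z.G.m_closed[OF tg th]])
    then show "to_Z (g \<otimes>\<^bsub>G\<^esub> h) = to_Z g \<otimes>\<^bsub>Z\<^esub> to_Z h"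
      unfolding to_Z_def using Z.hom_mult[OF tg th] by simp
  qed
  then show "group_hom G Z to_Z"
    using Z.H.group_axioms aug.H.group_axioms by (simp add: group_hom_def group_hom_axioms_def)
qed

lemma to_Z_eq: "to_Z g = \<pi> (pro_class F0 (\<lambda>n. \<sigma> g))"
  by (simp add: to_Z_def T.F0.to_pronil_eq)

lemma Z_to_pronil_eq_one_iff:
  assumes t: "coherent F0 t"
  shows "Z_to_pronil (\<pi> (pro_class F0 t)) = \<one>\<^bsub>pronil G\<^esub> \<longleftrightarrow> (\<forall>m. aug (t m) \<in> lcs G m)"
proof -
  have "pro_class G (\<lambda>n. aug (t n)) = lcs G \<longleftrightarrow> (\<forall>m. aug (t m) \<in> lcs G m)"
    unfolding pro_class_def fun_eq_iff
    using aug.H.lcs_rcos_eq_one_iff T.F0.coherent_closed[OF t] by simp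
  then show ?thesis unfolding Z_to_pronil_class[OF t] aug.H.one_pronil .
qed

text \<open>Both halves come from \<open>Z_lcs_iff\<close>. For constant sequences it shows that
  lower central terms are reflected; for the quotient of t by the constant sequence at the section
  of aug t_n it shows that t and aug t_n agree modulo \<open>lcs Z n\<close>.\<close>

lemma to_Z_nu_iso: "nu_map Z n to_Z \<in> iso (nu n G) (nu n Z)"
proof (rule to_Z.nu_map_iso)
  fix g n assume g: "g \<in> carrier G" "to_Z g \<in> lcs Z n"
  then show "g \<in> lcs G n"
    using Z_lcs_iff[OF T.F0.coherent_const[OF section_closed[OF g(1)]]] aug_section[OF g(1)]
    unfolding to_Z_eq by simp
next
  fix C n assume "C \<in> carrier Z"
  then obtain t where t: "coherent F0 t" "C = \<pi> (pro_class F0 t)" by (rule Z_classE)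
  note tc = T.F0.coherent_closed[OF t(1), of n]
  let ?g = "aug (t n)"
  have g: "?g \<in> carrier G" using tc by simp
  note s = T.F0.coherent_const[OF section_closed[OF g]]
  note i = T.F0.coherent_inv[OF s]
  have "C \<otimes>\<^bsub>Z\<^esub> inv\<^bsub>Z\<^esub> to_Z ?g = \<pi> (pro_class F0 t \<otimes>\<^bsub>P\<^esub> inv\<^bsub>P\<^esub> pro_class F0 (\<lambda>n. \<sigma> ?g))"
    unfolding t(2) to_Z_eq using T.F0.pro_class_closed[OF t(1)] T.F0.pro_class_closed[OF s] by simp
  also have "\<dots> = \<pi> (pro_class F0 (\<lambda>k. t k \<otimes>\<^bsub>F0\<^esub> inv\<^bsub>F0\<^esub> \<sigma> ?g))"
    unfolding T.F0.pro_class_inv[OF s] T.F0.pro_class_mult[OF t(1) i] ..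
  also have "\<dots> \<in> lcs Z n"
    unfolding Z_lcs_iff[OF T.F0.coherent_mult[OF t(1) i]]
    using tc g section_closed[OF g] aug_section[OF g] subgroup.one_closed[OF aug.H.lcs_subgroup] by simp
  finally show "\<exists>g\<in>carrier G. C \<otimes>\<^bsub>Z\<^esub> inv\<^bsub>Z\<^esub> to_Z g \<in> lcs Z n" using g by (intro bexI[of _ ?g])
qed

text \<open>Component n sends \<open>lcs (pronil G) n\<close> to the trivial subgroup of
  \<open>nu n G\<close>, and \<open>Z_lcs_iff\<close> turns this into membership of C. Surjectivity
  holds already before passing to quotients.\<close>

lemma Z_to_pronil_nu_iso: "nu_map (pronil G) n Z_to_pronil \<in> iso (nu n Z) (nu n (pronil G))"
proof (rule phi.nu_map_iso)
  fix C n assume C: "C \<in> carrier Z" and lcs: "Z_to_pronil C \<in> lcs (pronil G) n"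
  obtain t where t: "coherent F0 t" "C = \<pi> (pro_class F0 t)" using C by (rule Z_classE)
  have "Z_to_pronil C n \<in> lcs (nu n G) n"
    by (rule subsetD[OF group_hom.lcs_image_subset[OF aug.H.pronil_nu_hom[of n]] imageI[OF lcs]])
  then have "lcs G n #>\<^bsub>G\<^esub> aug (t n) = lcs G n"
    unfolding t(2) Z_to_pronil_class[OF t(1)] aug.H.lcs_nu by (simp add: pro_class_def aug.H.one_nu)
  then have "aug (t n) \<in> lcs G n"
    using aug.H.lcs_rcos_eq_one_iff[of "aug (t n)" n] T.F0.coherent_closed[OF t(1)] by simp
  then show "C \<in> lcs Z n" unfolding t(2) Z_lcs_iff[OF t(1)] .
next
  fix y n assume y: "y \<in> carrier (pronil G)"
  then obtain C where C: "C \<in> carrier Z" "y = Z_to_pronil C" unfolding phi_surj[symmetric] by (elim imageE)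
  have "y \<otimes>\<^bsub>pronil G\<^esub> inv\<^bsub>pronil G\<^esub> Z_to_pronil C = \<one>\<^bsub>pronil G\<^esub>"
    unfolding C(2) by (rule phi.H.r_inv[OF phi.hom_closed[OF C(1)]])
  then show "\<exists>C\<in>carrier Z. y \<otimes>\<^bsub>pronil G\<^esub> inv\<^bsub>pronil G\<^esub> Z_to_pronil C \<in> lcs (pronil G) n"
    using C(1) subgroup.one_closed[OF phi.H.lcs_subgroup] by (intro bexI[of _ C]) simp_all
qed

text \<open>Both sides amount to aug t_m lying in \<open>lcs G m\<close> for every m.\<close>

lemma lcs_omega_Z: "lcs_omega Z = kernel Z (pronil G) Z_to_pronil"
proof (intro subset_antisym subsetI)
  fix C assume C: "C \<in> lcs_omega Z"
  have "C \<in> lcs Z 0" using C unfolding lcs_omega_def by blast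
  then have Cc: "C \<in> carrier Z" by (rule Z.H.lcs_closed)
  obtain t where t: "coherent F0 t" "C = \<pi> (pro_class F0 t)" by (rule Z_classE[OF Cc])
  have "\<forall>m. aug (t m) \<in> lcs G m" using C unfolding lcs_omega_def t(2) Z_lcs_iff[OF t(1), symmetric] by blast
  then show "C \<in> kernel Z (pronil G) Z_to_pronil"
    unfolding kernel_def mem_Collect_eq using Cc Z_to_pronil_eq_one_iff[OF t(1)] t(2) by simp
next
  fix C assume C: "C \<in> kernel Z (pronil G) Z_to_pronil"
  then have Cc: "C \<in> carrier Z" "Z_to_pronil C = \<one>\<^bsub>pronil G\<^esub>" unfolding kernel_def by simp_all
  obtain t where t: "coherent F0 t" "C = \<pi> (pro_class F0 t)" by (rule Z_classE[OF Cc(1)])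
  have "\<forall>m. aug (t m) \<in> lcs G m" using Cc(2) unfolding t(2) Z_to_pronil_eq_one_iff[OF t(1)] .
  then show "C \<in> lcs_omega Z"
    unfolding lcs_omega_def t(2) INT_iff Z_lcs_iff[OF t(1)] by simp
qed

section \<open>The short exact sequence and the identification of its ends\<close>

abbreviation "lim1_S \<equiv> lim1 (pi1_tower S) (pi1_tower_map S)"

lemma milnor_delta_hom: "milnor_delta S \<in> hom lim1_S Z"
  using nu.delta_hom unfolding milnor_delta_eq pi1_tower_eq pi1_tower_map_eq hpi_0_spronil L0_eq .

lemma milnor_delta_inj: "inj_on (milnor_delta S) (carrier lim1_S)"
  using nu.delta_inj unfolding milnor_delta_eq pi1_tower_eq pi1_tower_map_eq .

text \<open>By \<open>B0_iff\<close> the componentwise boundaries are the sequences whose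
  augmentation is trivial in every \<open>nu n G\<close>.\<close>

lemma milnor_delta_image: "milnor_delta S ` carrier lim1_S = kernel Z (pronil G) Z_to_pronil"
proof -
  have "milnor_delta S ` carrier lim1_S = \<pi> ` {z \<in> carrier P. \<forall>n. z n \<in> nu.S.B0 n}"
    using nu.delta_image unfolding milnor_delta_eq pi1_tower_eq pi1_tower_map_eq L0_eq .
  also have "\<dots> = kernel Z (pronil G) Z_to_pronil"
  proof (intro subset_antisym subsetI)
    fix C assume "C \<in> \<pi> ` {z \<in> carrier P. \<forall>n. z n \<in> nu.S.B0 n}"
    then obtain z where z: "z \<in> carrier P" "\<forall>n. z n \<in> nu.S.B0 n" "C = \<pi> z" by blast
    obtain t where t: "coherent F0 t" "z = pro_class F0 t" by (rule T.F0.pro_classE[OF z(1)])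
    have "\<forall>n. aug (t n) \<in> lcs G n"
      using z(2) B0_iff[OF T.F0.coherent_closed[OF t(1)]] unfolding t(2) pro_class_def by blast
    then show "C \<in> kernel Z (pronil G) Z_to_pronil"
      unfolding kernel_def mem_Collect_eq z(3) t(2) Z_to_pronil_eq_one_iff[OF t(1)]
      using Z.hom_closed[OF z(1)] t(2) by simp
  next
    fix C assume C: "C \<in> kernel Z (pronil G) Z_to_pronil"
    then have Cc: "C \<in> carrier Z" "Z_to_pronil C = \<one>\<^bsub>pronil G\<^esub>" unfolding kernel_def by simp_all
    obtain t where t: "coherent F0 t" "C = \<pi> (pro_class F0 t)" by (rule Z_classE[OF Cc(1)])
    have "\<forall>m. aug (t m) \<in> lcs G m" using Cc(2) unfolding t(2) Z_to_pronil_eq_one_iff[OF t(1)] .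
    then have "\<forall>n. pro_class F0 t n \<in> nu.S.B0 n"
      using B0_iff[OF T.F0.coherent_closed[OF t(1)]] unfolding pro_class_def by blast
    then show "C \<in> \<pi> ` {z \<in> carrier P. \<forall>n. z n \<in> nu.S.B0 n}"
      unfolding t(2) using T.F0.pro_class_closed[OF t(1)] by (intro imageI CollectI conjI)
  qed
  finally show ?thesis .
qed

lemma milnor_delta_iso: "milnor_delta S \<in> iso lim1_S (Z\<lparr>carrier := lcs_omega Z\<rparr>)"
  using milnor_delta_hom milnor_delta_inj milnor_delta_image
  unfolding lcs_omega_Z iso_def hom_def bij_betw_def by (auto simp: Pi_iff)

lemma Z_to_pronil_nu_omega_iso: "(\<lambda>C. the_elem (Z_to_pronil ` C)) \<in> iso (nu_omega Z) (pronil G)"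
  unfolding nu_omega_def lcs_omega_Z by (rule phi.FactGroup_iso_set[OF phi_surj])

end

section \<open>Free groups\<close>

abbreviation flip :: "'a \<times> bool \<Rightarrow> 'a \<times> bool" where
  "flip l \<equiv> (fst l, \<not> snd l)"

lemma reduced_ConsD: "reduced (l # w) \<Longrightarrow> reduced w"
  by (cases w) auto

lemma reduced_push: "reduced w \<Longrightarrow> reduced (push l w)"
  by (cases w) (auto dest: reduced_ConsD)

text \<open>Letters act on reduced words by permutations, opposite letters by inverse ones (van der
  Waerden's argument). Reducedness ensures that a letter cancelled by the first push is put back by
  the second.\<close>

lemma push_flip_push: "reduced w \<Longrightarrow> push (flip l) (push l w) = w"
proof (cases w)
  case (Cons m v)
  assume "reduced w"
  then have r: "reduced (m # v)" using Cons by simp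
  show ?thesis
  proof (cases "fst l = fst m \<and> snd l \<noteq> snd m")
    case True
    then have "flip l = m" by (auto simp: prod_eq_iff)
    moreover have "push m v = m # v" using r by (cases v) auto
    ultimately show ?thesis using True Cons by simp
  next
    case False
    then show ?thesis using Cons by auto
  qed
qed simp

lemma reduced_foldr_push: "reduced w \<Longrightarrow> reduced (foldr push u w)"
  by (induction u) (auto intro: reduced_push)

lemma foldr_push_Nil: "reduced u \<Longrightarrow> foldr push u [] = u"
proof (induction u)
  case (Cons l u)
  then have "foldr push u [] = u" using reduced_ConsD by blast
  then show ?case using Cons.prems by (cases u) auto
qed simp

text \<open>If l cancels against the head of t, the two opposite letters act as mutually inverse
  permutations, so cancelling beforehand makes no difference. Associativity follows from this by
  induction.\<close>

lemma foldr_push_push: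
  assumes "reduced w"
  shows "foldr push (push l t) w = push l (foldr push t w)"
proof (cases t)
  case (Cons m v)
  show ?thesis
  proof (cases "fst l = fst m \<and> snd l \<noteq> snd m")
    case True
    then have "flip m = l" by (auto simp: prod_eq_iff)
    then show ?thesis
      using True Cons push_flip_push[OF reduced_foldr_push[OF assms], of m v] by simp
  qed (use Cons in auto)
qed simp

lemma foldr_push_assoc:
  "reduced w \<Longrightarrow> foldr push (foldr push u v) w = foldr push u (foldr push v w)"
  by (induction u) (auto simp: foldr_push_push)

lemma foldr_push_flip:
  "reduced w \<Longrightarrow> foldr push (rev (map flip u)) (foldr push u w) = w"
proof (induction u)
  case (Cons l u)
  then show ?case using push_flip_push[OF reduced_foldr_push[OF Cons.prems], of l u] by simp
qed simp

lemma set_push: "fst ` set (push l w) \<subseteq> insert (fst l) (fst ` set w)"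
  by (cases w) auto

lemma set_foldr_push: "fst ` set (foldr push u w) \<subseteq> fst ` set u \<union> fst ` set w"
proof (induction u)
  case (Cons l u)
  have "fst ` set (foldr push (l # u) w) \<subseteq> insert (fst l) (fst ` set (foldr push u w))"
    using set_push[of l "foldr push u w"] by simp
  also have "\<dots> \<subseteq> insert (fst l) (fst ` set u \<union> fst ` set w)"
    by (rule insert_mono[OF Cons.IH])
  finally show ?case by simp
qed simp

lemma free_group_simps:
  "carrier (free_group S) = {w. reduced w \<and> fst ` set w \<subseteq> S}"
  "u \<otimes>\<^bsub>free_group S\<^esub> v = foldr push u v"
  "\<one>\<^bsub>free_group S\<^esub> = []"
  by (simp_all add: free_group_def)

lemma free_group_group: "group (free_group S)"
proof (rule groupI)
  fix x y assume "x \<in> carrier (free_group S)" "y \<in> carrier (free_group S)"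
  then show "x \<otimes>\<^bsub>free_group S\<^esub> y \<in> carrier (free_group S)"
    using order_trans[OF set_foldr_push[of x y]] reduced_foldr_push[of y x]
    unfolding free_group_simps by simp
next
  fix x assume x: "x \<in> carrier (free_group S)"
  \<comment> \<open>The formal inverse word. It is passed through \<open>foldr push\<close> once
    more, so that the inverse is reduced by construction.\<close>
  let ?r = "rev (map flip x)"
  have "fst ` set (foldr push ?r []) \<subseteq> S"
    by (rule order_trans[OF set_foldr_push]) (use x in \<open>simp add: free_group_simps image_image\<close>)
  moreover have "foldr push (foldr push ?r []) x = []"
    using x foldr_push_assoc[of x ?r "[]"] foldr_push_flip[of "[]" x] foldr_push_Nil[of x]
    by (simp add: free_group_simps)
  ultimately show "\<exists>y\<in>carrier (free_group S). y \<otimes>\<^bsub>free_group S\<^esub> x = \<one>\<^bsub>free_group S\<^esub>"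
    by (intro bexI[of _ "foldr push ?r []"]) (auto simp: free_group_simps reduced_foldr_push)
qed (auto simp: free_group_simps foldr_push_assoc)

lemma generator_closed: "x \<in> S \<Longrightarrow> [(x, b)] \<in> carrier (free_group S)"
  by (simp add: free_group_simps)

lemma generator_inv: "x \<in> S \<Longrightarrow> [(x, False)] = inv\<^bsub>free_group S\<^esub> [(x, True)]"
  by (rule group.inv_equality[symmetric, OF free_group_group _ generator_closed generator_closed])
    (simp_all add: free_group_simps)

lemma free_group_Cons:
  assumes "l # w \<in> carrier (free_group S)"
  shows "fst l \<in> S" "w \<in> carrier (free_group S)" "l # w = [l] \<otimes>\<^bsub>free_group S\<^esub> w"
proof -
  show "fst l \<in> S" "w \<in> carrier (free_group S)"
    using assms by (auto simp: free_group_simps dest: reduced_ConsD)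
  show "l # w = [l] \<otimes>\<^bsub>free_group S\<^esub> w"
    using assms by (cases w) (auto simp: free_group_simps)
qed

lemma free_group_hom_eq:
  assumes h: "group_hom (free_group S) H h" and k: "group_hom (free_group S) H k"
    and gen: "\<And>x. x \<in> S \<Longrightarrow> h [(x, True)] = k [(x, True)]"
    and w: "w \<in> carrier (free_group S)"
  shows "h w = k w"
  using w
proof (induction w)
  case Nil
  show ?case using group_hom.hom_one[OF h] group_hom.hom_one[OF k] by (simp add: free_group_simps)
next
  case (Cons l w)
  note lw = free_group_Cons[OF Cons.prems]
  obtain x b where l: "l = (x, b)" by (cases l)
  have x: "x \<in> S" using lw(1) l by simp
  note xT = generator_closed[OF x, of True]
  have "h [l] = k [l]"
    using gen[OF x] group_hom.hom_inv[OF h xT] group_hom.hom_inv[OF k xT] generator_inv[OF x]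
    unfolding l by (cases b) simp_all
  moreover have "[l] \<in> carrier (free_group S)" unfolding l by (rule generator_closed[OF x])
  ultimately show ?case
    unfolding lw(3) using Cons.IH[OF lw(2)] group_hom.hom_mult[OF h _ lw(2)] group_hom.hom_mult[OF k _ lw(2)]
    by simp
qed

text \<open>Cancelling adjacent opposite letters does not change the value of a word. This is the
  step \<open>push\<close>, from which multiplicativity follows letter by letter.\<close>

lemma free_lift_hom:
  assumes "group H" and f: "\<And>x. x \<in> S \<Longrightarrow> f x \<in> carrier H"
  shows "group_hom (free_group S) H (free_lift H f)"
    "x \<in> S \<Longrightarrow> free_lift H f [(x, True)] = f x"
proof -
  interpret H: group H by fact
  define val where "val l = (if snd l then f (fst l) else inv\<^bsub>H\<^esub> f (fst l))" for l
  have lift: "free_lift H f [] = \<one>\<^bsub>H\<^esub>"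
    "free_lift H f (l # w) = val l \<otimes>\<^bsub>H\<^esub> free_lift H f w" for l w
    by (simp_all add: free_lift_def val_def split: prod.split)
  have val: "fst l \<in> S \<Longrightarrow> val l \<in> carrier H" for l using f by (simp add: val_def)
  have closed: "fst ` set w \<subseteq> S \<Longrightarrow> free_lift H f w \<in> carrier H" for w
    by (induction w) (auto simp: lift val)
  have push: "free_lift H f (push l w) = val l \<otimes>\<^bsub>H\<^esub> free_lift H f w"
    if l: "fst l \<in> S" and w: "fst ` set w \<subseteq> S" for l w
  proof (cases w)
    case (Cons m v)
    show ?thesis
    proof (cases "fst l = fst m \<and> snd l \<noteq> snd m")
      case True
      then have "val l = inv\<^bsub>H\<^esub> val m" using l f by (auto simp: val_def)
      moreover have "fst m \<in> S" "fst ` set v \<subseteq> S" using w Cons by auto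
      ultimately show ?thesis using True Cons val[of m] closed[of v] by (simp add: lift)
    qed (use Cons in \<open>auto simp: lift\<close>)
  qed (simp add: lift)
  have mult: "free_lift H f (foldr push u v) = free_lift H f u \<otimes>\<^bsub>H\<^esub> free_lift H f v"
    if "fst ` set u \<subseteq> S" and v: "fst ` set v \<subseteq> S" for u v
    using that(1)
  proof (induction u)
    case Nil
    then show ?case using closed[OF v] by (simp add: lift)
  next
    case (Cons l u)
    then have l: "fst l \<in> S" and u: "fst ` set u \<subseteq> S" by auto
    have "fst ` set (foldr push u v) \<subseteq> S" by (rule order_trans[OF set_foldr_push Un_least[OF u v]])
    then show ?case
      using push[OF l, of "foldr push u v"] Cons.IH[OF u] val[OF l] closed[OF u] closed[OF v]
      by (simp add: lift H.m_assoc)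
  qed
  have "free_lift H f \<in> hom (free_group S) H"
    by (rule homI) (auto simp: free_group_simps closed mult)
  then show "group_hom (free_group S) H (free_lift H f)"
    by (simp add: group_hom_def group_hom_axioms_def free_group_group H.group_axioms)
  show "x \<in> S \<Longrightarrow> free_lift H f [(x, True)] = f x"
    using f by (simp add: lift val_def)
qed

section \<open>The loop group of the nerve\<close>

context group
begin

abbreviation "gens n \<equiv> simplices (nerve G) n"
abbreviation "Fr n \<equiv> loop_grp (nerve G) n"
abbreviation "tau_G n \<equiv> tau (nerve G) n"

lemma gens_eq: "gens n = {xs. length xs = n \<and> set xs \<subseteq> carrier G}"
  by (simp add: nerve_def)

lemma sdegen_nerve: "sdegen (nerve G) n i xs = take i xs @ [\<one>] @ drop i xs"
  by (simp add: nerve_def)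

lemma sface_nerve: "sface (nerve G) n i xs = (if i = 0 then tl xs else if i = n then butlast xs
        else take (i - 1) xs @ [xs ! (i - 1) \<otimes> xs ! i] @ drop (Suc i) xs)"
  by (simp add: nerve_def)

lemma Fr_group: "group (Fr n)"
  by (simp add: loop_grp_def free_group_group)

text \<open>s_0 puts the neutral element in front of a bar, so the generators removed from the loop
  group are the bars that start with it.\<close>

lemma degenerate_iff:
  assumes "x \<in> gens (Suc n)"
  shows "x \<in> sdegen (nerve G) n 0 ` gens n \<longleftrightarrow> hd x = \<one>"
proof -
  obtain g y where "x = g # y" using assms by (auto simp: gens_eq length_Suc_conv)
  then show ?thesis using assms by (auto simp: gens_eq sdegen_nerve image_iff)
qed

lemma tau_eq:
  assumes "x \<in> gens (Suc n)"
  shows "tau_G n x = (if hd x = \<one> then \<one>\<^bsub>Fr n\<^esub> else [(x, True)])"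
  using degenerate_iff[OF assms] by (simp add: tau_def loop_grp_def free_group_simps)

lemma tau_closed:
  assumes "x \<in> gens (Suc n)"
  shows "tau_G n x \<in> carrier (Fr n)"
  using assms degenerate_iff[OF assms] group.is_monoid[OF Fr_group, THEN monoid.one_closed, of n]
  by (auto simp: tau_eq loop_grp_def intro!: generator_closed)

text \<open>The universal property of the presentation by generators tau(x) for all simplices x and
  relations tau(s_0 x) = 1.\<close>

lemma Fr_lift:
  assumes H: "group H" and f: "\<And>x. x \<in> gens (Suc n) \<Longrightarrow> f x \<in> carrier H"
    and deg: "\<And>x. x \<in> gens (Suc n) \<Longrightarrow> hd x = \<one> \<Longrightarrow> f x = \<one>\<^bsub>H\<^esub>"
  shows "group_hom (Fr n) H (free_lift H f)"
    and "\<forall>x \<in> gens (Suc n). free_lift H f (tau_G n x) = f x"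
proof -
  let ?S = "gens (Suc n) - sdegen (nerve G) n 0 ` gens n"
  have fS: "f x \<in> carrier H" if "x \<in> ?S" for x using f that by blast
  note L = free_lift_hom[where S = ?S and f = f, OF H fS]
  show hom: "group_hom (Fr n) H (free_lift H f)"
    unfolding loop_grp_def by (rule L(1))
  show "\<forall>x \<in> gens (Suc n). free_lift H f (tau_G n x) = f x"
  proof
    fix x assume x: "x \<in> gens (Suc n)"
    show "free_lift H f (tau_G n x) = f x"
      using group_hom.hom_one[OF hom] deg[OF x] L(2)[of x] x degenerate_iff[OF x] by (simp add: tau_eq)
  qed
qed

lemma Fr_hom_eq:
  assumes h: "group_hom (Fr n) H h" and k: "group_hom (Fr n) H k"
    and gen: "\<And>x. x \<in> gens (Suc n) \<Longrightarrow> h (tau_G n x) = k (tau_G n x)"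
    and w: "w \<in> carrier (Fr n)"
  shows "h w = k w"
proof (rule free_group_hom_eq[OF h[unfolded loop_grp_def] k[unfolded loop_grp_def] _ w[unfolded loop_grp_def]])
  fix x assume x: "x \<in> gens (Suc n) - sdegen (nerve G) n 0 ` gens n"
  then have "x \<in> gens (Suc n)" "hd x \<noteq> \<one>" using degenerate_iff by auto
  then show "h [(x, True)] = k [(x, True)]" using gen[of x] by (simp add: tau_eq)
qed

end

lemma group_hom_comp:
  assumes "group_hom G H f" "group_hom H K g"
  shows "group_hom G K (g \<circ> f)"
  using Group.hom_compose[OF group_hom.homh[OF assms(1)] group_hom.homh[OF assms(2)]] assms
  by (simp add: group_hom_def group_hom_axioms_def)

section \<open>Faces and degeneracies of the resolution in bar notation, in dimensions at most
  two\<close>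

context group
begin

abbreviation "\<delta> \<equiv> gface (free_res G)"
abbreviation "\<eta> \<equiv> gdegen (free_res G)"

lemma gens_1: "gens 1 = {[g] | g. g \<in> carrier G}"
  by (auto simp: gens_eq One_nat_def length_Suc_conv)

lemma gens_2: "gens 2 = {[g, h] | g h. g \<in> carrier G \<and> h \<in> carrier G}"
  by (auto simp: gens_eq numeral_2_eq_2 length_Suc_conv)

lemma gens_3: "gens 3 = {[g, h, k] | g h k. g \<in> carrier G \<and> h \<in> carrier G \<and> k \<in> carrier G}"
  by (auto simp: gens_eq numeral_3_eq_3 length_Suc_conv)

lemma sface_2: "sface (nerve G) 2 0 [g, h] = [h]" "sface (nerve G) 2 1 [g, h] = [g \<otimes> h]"
  "sface (nerve G) 2 2 [g, h] = [g]"
  by (simp_all add: sface_nerve One_nat_def)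

lemma sface_3: "sface (nerve G) 3 0 [g, h, k] = [h, k]" "sface (nerve G) 3 1 [g, h, k] = [g \<otimes> h, k]"
  "sface (nerve G) 3 2 [g, h, k] = [g, h \<otimes> k]" "sface (nerve G) 3 3 [g, h, k] = [g, h]"
  by (simp_all add: sface_nerve One_nat_def numeral_2_eq_2 numeral_3_eq_3)

lemma sdegen_12: "sdegen (nerve G) 1 1 [g] = [g, \<one>]" "sdegen (nerve G) 2 1 [g, h] = [g, \<one>, h]"
  "sdegen (nerve G) 2 2 [g, h] = [g, h, \<one>]"
  by (simp_all add: sdegen_nerve One_nat_def numeral_2_eq_2)

lemma Suc_numerals: "Suc 0 = 1" "Suc 1 = 2" "Suc 2 = 3"
  by simp_all

lemma free_res_simps:
  "grp (free_res G) n = Fr n"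
  "\<delta> 1 0 = free_lift (Fr 0) (\<lambda>x. tau_G 0 (sface (nerve G) 2 1 x)
     \<otimes>\<^bsub>Fr 0\<^esub> inv\<^bsub>Fr 0\<^esub> tau_G 0 (sface (nerve G) 2 0 x))"
  "\<delta> 1 1 = free_lift (Fr 0) (\<lambda>x. tau_G 0 (sface (nerve G) 2 2 x))"
  "\<delta> 2 0 = free_lift (Fr 1) (\<lambda>x. tau_G 1 (sface (nerve G) 3 1 x)
     \<otimes>\<^bsub>Fr 1\<^esub> inv\<^bsub>Fr 1\<^esub> tau_G 1 (sface (nerve G) 3 0 x))"
  "\<delta> 2 1 = free_lift (Fr 1) (\<lambda>x. tau_G 1 (sface (nerve G) 3 2 x))"
  "\<delta> 2 2 = free_lift (Fr 1) (\<lambda>x. tau_G 1 (sface (nerve G) 3 3 x))"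
  "\<eta> 0 0 = free_lift (Fr 1) (\<lambda>x. tau_G 1 (sdegen (nerve G) 1 1 x))"
  "\<eta> 1 0 = free_lift (Fr 2) (\<lambda>x. tau_G 2 (sdegen (nerve G) 2 1 x))"
  "\<eta> 1 1 = free_lift (Fr 2) (\<lambda>x. tau_G 2 (sdegen (nerve G) 2 2 x))"
  by (simp_all add: free_res_def kan_loop_def Suc_numerals)

lemma tau_closed_explicit:
  "g \<in> carrier G \<Longrightarrow> tau_G 0 [g] \<in> carrier (Fr 0)"
  "g \<in> carrier G \<Longrightarrow> h \<in> carrier G \<Longrightarrow> tau_G 1 [g, h] \<in> carrier (Fr 1)"
  "g \<in> carrier G \<Longrightarrow> h \<in> carrier G \<Longrightarrow> k \<in> carrier G \<Longrightarrow> tau_G 2 [g, h, k] \<in> carrier (Fr 2)"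
  by (rule tau_closed, simp add: gens_eq Suc_numerals)+

lemma tau_degenerate:
  "tau_G 0 [\<one>] = \<one>\<^bsub>Fr 0\<^esub>"
  "h \<in> carrier G \<Longrightarrow> tau_G 1 [\<one>, h] = \<one>\<^bsub>Fr 1\<^esub>"
  "h \<in> carrier G \<Longrightarrow> k \<in> carrier G \<Longrightarrow> tau_G 2 [\<one>, h, k] = \<one>\<^bsub>Fr 2\<^esub>"
  by (subst tau_eq, simp_all add: gens_eq Suc_numerals)+

interpretation Fr: group "Fr n" for n
  by (rule Fr_group)

lemma Fr_lift_1:
  assumes "group H" "\<And>g. g \<in> carrier G \<Longrightarrow> f [g] \<in> carrier H" "f [\<one>] = \<one>\<^bsub>H\<^esub>"
  shows "group_hom (Fr 0) H (free_lift H f)"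
    "\<And>g. g \<in> carrier G \<Longrightarrow> free_lift H f (tau_G 0 [g]) = f [g]"
proof -
  have 1: "x \<in> gens (Suc 0) \<Longrightarrow> f x \<in> carrier H" for x
    using assms(2) unfolding Suc_numerals gens_1 by blast
  have 2: "x \<in> gens (Suc 0) \<Longrightarrow> hd x = \<one> \<Longrightarrow> f x = \<one>\<^bsub>H\<^esub>" for x
    using assms(3) unfolding Suc_numerals gens_1 by force
  note L = Fr_lift[of H 0 f, OF assms(1) 1 2]
  show "group_hom (Fr 0) H (free_lift H f)" by (rule L(1))
  show "free_lift H f (tau_G 0 [g]) = f [g]" if "g \<in> carrier G" for g
    using L(2) that unfolding Suc_numerals gens_1 by blast
qed

lemma Fr_lift_2:
  assumes "group H" "\<And>g h. g \<in> carrier G \<Longrightarrow> h \<in> carrier G \<Longrightarrow> f [g, h] \<in> carrier H"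
    "\<And>h. h \<in> carrier G \<Longrightarrow> f [\<one>, h] = \<one>\<^bsub>H\<^esub>"
  shows "group_hom (Fr 1) H (free_lift H f)"
    "\<And>g h. g \<in> carrier G \<Longrightarrow> h \<in> carrier G \<Longrightarrow> free_lift H f (tau_G 1 [g, h]) = f [g, h]"
proof -
  have 1: "x \<in> gens (Suc 1) \<Longrightarrow> f x \<in> carrier H" for x
    using assms(2) unfolding Suc_numerals gens_2 by blast
  have 2: "x \<in> gens (Suc 1) \<Longrightarrow> hd x = \<one> \<Longrightarrow> f x = \<one>\<^bsub>H\<^esub>" for x
    using assms(3) unfolding Suc_numerals gens_2 by force
  note L = Fr_lift[of H 1 f, OF assms(1) 1 2]
  show "group_hom (Fr 1) H (free_lift H f)" by (rule L(1))
  show "free_lift H f (tau_G 1 [g, h]) = f [g, h]" if "g \<in> carrier G" "h \<in> carrier G" for g h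
    using L(2) that unfolding Suc_numerals gens_2 by blast
qed

lemma Fr_lift_3:
  assumes "group H"
    "\<And>g h k. g \<in> carrier G \<Longrightarrow> h \<in> carrier G \<Longrightarrow> k \<in> carrier G \<Longrightarrow> f [g, h, k] \<in> carrier H"
    "\<And>h k. h \<in> carrier G \<Longrightarrow> k \<in> carrier G \<Longrightarrow> f [\<one>, h, k] = \<one>\<^bsub>H\<^esub>"
  shows "group_hom (Fr 2) H (free_lift H f)"
    "\<And>g h k. g \<in> carrier G \<Longrightarrow> h \<in> carrier G \<Longrightarrow> k \<in> carrier G \<Longrightarrow>
      free_lift H f (tau_G 2 [g, h, k]) = f [g, h, k]"
proof -
  have 1: "x \<in> gens (Suc 2) \<Longrightarrow> f x \<in> carrier H" for x
    using assms(2) unfolding Suc_numerals gens_3 by blast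
  have 2: "x \<in> gens (Suc 2) \<Longrightarrow> hd x = \<one> \<Longrightarrow> f x = \<one>\<^bsub>H\<^esub>" for x
    using assms(3) unfolding Suc_numerals gens_3 by force
  note L = Fr_lift[of H 2 f, OF assms(1) 1 2]
  show "group_hom (Fr 2) H (free_lift H f)" by (rule L(1))
  show "free_lift H f (tau_G 2 [g, h, k]) = f [g, h, k]"
    if "g \<in> carrier G" "h \<in> carrier G" "k \<in> carrier G" for g h k
    using L(2) that unfolding Suc_numerals gens_3 by blast
qed

text \<open>The twisted face respects the relation for a bar starting with the neutral element
  because the two factors cancel there; the untwisted faces send such bars to bars of the same
  kind.\<close>

lemma face_10:
  "group_hom (Fr 1) (Fr 0) (\<delta> 1 0)"
  "g \<in> carrier G \<Longrightarrow> h \<in> carrier G \<Longrightarrow>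
     \<delta> 1 0 (tau_G 1 [g, h]) = tau_G 0 [g \<otimes> h] \<otimes>\<^bsub>Fr 0\<^esub> inv\<^bsub>Fr 0\<^esub> tau_G 0 [h]"
  unfolding free_res_simps
  by (rule Fr_lift_2 trans[OF Fr_lift_2(2)]; simp add: Fr_group sface_2 tau_closed_explicit)+

lemma face_11:
  "group_hom (Fr 1) (Fr 0) (\<delta> 1 1)"
  "g \<in> carrier G \<Longrightarrow> h \<in> carrier G \<Longrightarrow> \<delta> 1 1 (tau_G 1 [g, h]) = tau_G 0 [g]"
  unfolding free_res_simps
  by (rule Fr_lift_2 trans[OF Fr_lift_2(2)]; simp add: Fr_group sface_2 tau_closed_explicit tau_degenerate)+

lemma face_20:
  "group_hom (Fr 2) (Fr 1) (\<delta> 2 0)"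
  "g \<in> carrier G \<Longrightarrow> h \<in> carrier G \<Longrightarrow> k \<in> carrier G \<Longrightarrow>
     \<delta> 2 0 (tau_G 2 [g, h, k]) = tau_G 1 [g \<otimes> h, k] \<otimes>\<^bsub>Fr 1\<^esub> inv\<^bsub>Fr 1\<^esub> tau_G 1 [h, k]"
  unfolding free_res_simps
  by (rule Fr_lift_3 trans[OF Fr_lift_3(2)]; simp add: Fr_group sface_3 tau_closed_explicit)+

lemma face_21:
  "group_hom (Fr 2) (Fr 1) (\<delta> 2 1)"
  "g \<in> carrier G \<Longrightarrow> h \<in> carrier G \<Longrightarrow> k \<in> carrier G \<Longrightarrow>
     \<delta> 2 1 (tau_G 2 [g, h, k]) = tau_G 1 [g, h \<otimes> k]"
  unfolding free_res_simps
  by (rule Fr_lift_3 trans[OF Fr_lift_3(2)]; simp add: Fr_group sface_3 tau_closed_explicit tau_degenerate)+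

lemma face_22:
  "group_hom (Fr 2) (Fr 1) (\<delta> 2 2)"
  "g \<in> carrier G \<Longrightarrow> h \<in> carrier G \<Longrightarrow> k \<in> carrier G \<Longrightarrow>
     \<delta> 2 2 (tau_G 2 [g, h, k]) = tau_G 1 [g, h]"
  unfolding free_res_simps
  by (rule Fr_lift_3 trans[OF Fr_lift_3(2)]; simp add: Fr_group sface_3 tau_closed_explicit tau_degenerate)+

lemma degen_00:
  "group_hom (Fr 0) (Fr 1) (\<eta> 0 0)"
  "g \<in> carrier G \<Longrightarrow> \<eta> 0 0 (tau_G 0 [g]) = tau_G 1 [g, \<one>]"
  unfolding free_res_simps
  by (rule Fr_lift_1 trans[OF Fr_lift_1(2)]; simp add: Fr_group sdegen_12 tau_closed_explicit tau_degenerate)+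

lemma degen_10:
  "group_hom (Fr 1) (Fr 2) (\<eta> 1 0)"
  "g \<in> carrier G \<Longrightarrow> h \<in> carrier G \<Longrightarrow> \<eta> 1 0 (tau_G 1 [g, h]) = tau_G 2 [g, \<one>, h]"
  unfolding free_res_simps
  by (rule Fr_lift_2 trans[OF Fr_lift_2(2)]; simp add: Fr_group sdegen_12 tau_closed_explicit tau_degenerate)+

lemma degen_11:
  "group_hom (Fr 1) (Fr 2) (\<eta> 1 1)"
  "g \<in> carrier G \<Longrightarrow> h \<in> carrier G \<Longrightarrow> \<eta> 1 1 (tau_G 1 [g, h]) = tau_G 2 [g, h, \<one>]"
  unfolding free_res_simps
  by (rule Fr_lift_2 trans[OF Fr_lift_2(2)]; simp add: Fr_group sdegen_12 tau_closed_explicit tau_degenerate)+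

text \<open>Both sides of a simplicial identity are composites of homomorphisms out of a free group,
  so it is checked on the generators tau(x). Where a side is the identity, it enters as a composite
  of identity maps.\<close>

lemma Fr_hom_comp_eq:
  assumes h: "group_hom (Fr n) K h" and h': "group_hom K H h'"
    and k: "group_hom (Fr n) L k" and k': "group_hom L H k'"
    and gen: "\<And>x. x \<in> gens (Suc n) \<Longrightarrow> h' (h (tau_G n x)) = k' (k (tau_G n x))"
    and w: "w \<in> carrier (Fr n)"
  shows "h' (h w) = k' (k w)"
proof -
  have "group_hom (Fr n) H (h' \<circ> h)" "group_hom (Fr n) H (k' \<circ> k)"
    by (rule group_hom_comp[OF h h'] group_hom_comp[OF k k'])+
  then show ?thesis using Fr_hom_eq[of n H "h' \<circ> h" "k' \<circ> k" w] gen w by simp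
qed

lemma free_res_trunc: "trunc_sgroup (grp (free_res G) 0) (grp (free_res G) 1) (grp (free_res G) 2)
    (\<delta> 1 0) (\<delta> 1 1)
    (\<delta> 2 0) (\<delta> 2 1) (\<delta> 2 2)
    (\<eta> 0 0) (\<eta> 1 0) (\<eta> 1 1)"
  unfolding free_res_simps(1)
proof (rule trunc_sgroup.intro; (rule face_10(1) face_11(1) face_20(1) face_21(1) face_22(1)
        degen_00(1) degen_10(1) degen_11(1))?)
  interpret d0: group_hom "Fr 1" "Fr 0" "\<delta> 1 0" by (rule face_10(1))
  interpret d1: group_hom "Fr 1" "Fr 0" "\<delta> 1 1" by (rule face_11(1))
  interpret s: group_hom "Fr 0" "Fr 1" "\<eta> 0 0" by (rule degen_00(1))
  note on_tau = face_10(2) face_11(2) face_20(2) face_21(2) face_22(2) degen_00(2) degen_10(2) degen_11(2)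
    tau_closed_explicit tau_degenerate
  note id0 = group.id_group_hom[OF Fr_group[of 0]] and id1 = group.id_group_hom[OF Fr_group[of 1]]
  {
    fix w assume w: "w \<in> carrier (Fr 0)"
    show "\<delta> 1 0 (\<eta> 0 0 w) = w"
      by (rule Fr_hom_comp_eq[OF degen_00(1) face_10(1) id0 id0 _ w]) (auto simp: Suc_numerals gens_1 on_tau)
    show "\<delta> 1 1 (\<eta> 0 0 w) = w"
      by (rule Fr_hom_comp_eq[OF degen_00(1) face_11(1) id0 id0 _ w]) (auto simp: Suc_numerals gens_1 on_tau)
  }
  {
    fix w assume w: "w \<in> carrier (Fr 1)"
    show "\<delta> 2 0 (\<eta> 1 0 w) = w"
      by (rule Fr_hom_comp_eq[OF degen_10(1) face_20(1) id1 id1 _ w]) (auto simp: Suc_numerals gens_2 on_tau)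
    show "\<delta> 2 1 (\<eta> 1 0 w) = w"
      by (rule Fr_hom_comp_eq[OF degen_10(1) face_21(1) id1 id1 _ w]) (auto simp: Suc_numerals gens_2 on_tau)
    show "\<delta> 2 2 (\<eta> 1 0 w) = \<eta> 0 0 (\<delta> 1 1 w)"
      by (rule Fr_hom_comp_eq[OF degen_10(1) face_22(1) face_11(1) degen_00(1) _ w]) (auto simp: Suc_numerals gens_2 on_tau)
    show "\<delta> 2 0 (\<eta> 1 1 w) = \<eta> 0 0 (\<delta> 1 0 w)"
      by (rule Fr_hom_comp_eq[OF degen_11(1) face_20(1) face_10(1) degen_00(1) _ w]) (auto simp: Suc_numerals gens_2 on_tau)
    show "\<delta> 2 1 (\<eta> 1 1 w) = w"
      by (rule Fr_hom_comp_eq[OF degen_11(1) face_21(1) id1 id1 _ w]) (auto simp: Suc_numerals gens_2 on_tau)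
    show "\<delta> 2 2 (\<eta> 1 1 w) = w"
      by (rule Fr_hom_comp_eq[OF degen_11(1) face_22(1) id1 id1 _ w]) (auto simp: Suc_numerals gens_2 on_tau)
  }
  {
    fix w assume w: "w \<in> carrier (Fr 2)"
    \<comment> \<open>Two twisted faces meet here: on tau[g|h|k] the factors tau[k] cancel, and both
      sides become tau[ghk] tau[hk]^-1.\<close>
    show "\<delta> 1 0 (\<delta> 2 1 w) = \<delta> 1 0 (\<delta> 2 0 w)"
      by (rule Fr_hom_comp_eq[OF face_21(1) face_10(1) face_20(1) face_10(1) _ w])
        (auto simp: Suc_numerals gens_3 on_tau m_assoc Fr.m_assoc Fr.inv_mult_group)
    show "\<delta> 1 0 (\<delta> 2 2 w) = \<delta> 1 1 (\<delta> 2 0 w)"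
      by (rule Fr_hom_comp_eq[OF face_22(1) face_10(1) face_20(1) face_11(1) _ w])
        (auto simp: Suc_numerals gens_3 on_tau)
    show "\<delta> 1 1 (\<delta> 2 2 w) = \<delta> 1 1 (\<delta> 2 1 w)"
      by (rule Fr_hom_comp_eq[OF face_22(1) face_11(1) face_21(1) face_11(1) _ w])
        (auto simp: Suc_numerals gens_3 on_tau)
  }
qed

lemma free_res_simplicial_group: "simplicial_group (free_res G)"
  by (rule simplicial_group.intro[OF free_res_trunc])

lemma res_aug_hom: "group_hom (grp (free_res G) 0) G (res_aug G)"
  and res_aug_tau: "g \<in> carrier G \<Longrightarrow> res_aug G (tau_G 0 [g]) = g"
  using Fr_lift_1[of G hd] group_axioms unfolding res_aug_def free_res_simps(1) by simp_all

text \<open>An inverse to the augmentation on pi_0 sends g to the class of tau[g] modulo boundaries.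
  Comparison on generators shows that the class of x is the image of its augmentation under this
  map.\<close>

lemma res_aug_kernel:
  assumes x: "x \<in> carrier (grp (free_res G) 0)"
  shows "res_aug G x = \<one> \<longleftrightarrow> x \<in> trunc_sgroup.B0 (grp (free_res G) 0) (grp (free_res G) 1)
    (\<delta> 1 0) (\<delta> 1 1)"
proof -
  interpret T: trunc_sgroup "grp (free_res G) 0" "grp (free_res G) 1" "grp (free_res G) 2"
    "\<delta> 1 0" "\<delta> 1 1"
    "\<delta> 2 0" "\<delta> 2 1" "\<delta> 2 2"
    "\<eta> 0 0" "\<eta> 1 0" "\<eta> 1 1"
    by (rule free_res_trunc)
  interpret aug: group_hom "grp (free_res G) 0" G "res_aug G" by (rule res_aug_hom)
  note [simp] = tau_closed_explicit[folded free_res_simps(1)]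
  have faces: "res_aug G (\<delta> 1 0 y) = res_aug G (\<delta> 1 1 y)"
    if "y \<in> carrier (grp (free_res G) 1)" for y
    by (rule Fr_hom_comp_eq[OF face_10(1) aug.group_hom_axioms[unfolded free_res_simps(1)]
          face_11(1) aug.group_hom_axioms[unfolded free_res_simps(1)] _ that[unfolded free_res_simps(1)]])
      (auto simp: Suc_numerals gens_2 face_10(2)[folded free_res_simps(1)] face_11(2) res_aug_tau m_assoc)
  let ?F = "grp (free_res G) 0"
  let ?Q = "?F Mod T.B0" and ?q = "r_coset ?F T.B0"
  interpret q: group_hom ?F ?Q ?q by (rule normal.rcos_hom[OF T.B0_normal])
  define \<psi> where "\<psi> g = ?q (tau_G 0 [g])" for g
  have \<psi>: "group_hom G ?Q \<psi>"
  proof -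
    have "\<psi> \<in> hom G ?Q"
    proof (rule homI)
      fix g assume g: "g \<in> carrier G"
      then show "\<psi> g \<in> carrier ?Q" unfolding \<psi>_def by (intro q.hom_closed) simp
      fix h assume h: "h \<in> carrier G"
      \<comment> \<open>The 1-simplex tau[g|h] has faces tau[gh] tau[h]^-1 and tau[g]. That their
        classes agree is the multiplicativity of \<open>\<psi>\<close>.\<close>
      have "?q (tau_G 0 [g \<otimes> h] \<otimes>\<^bsub>?F\<^esub> inv\<^bsub>?F\<^esub> tau_G 0 [h]) = ?q (tau_G 0 [g])"
        using T.faces_B0_equal[of "tau_G 1 [g, h]"] g h by (simp add: face_10(2)[folded free_res_simps(1)] face_11(2))
      then have "\<psi> (g \<otimes> h) \<otimes>\<^bsub>?Q\<^esub> inv\<^bsub>?Q\<^esub> \<psi> h = \<psi> g"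
        unfolding \<psi>_def using g h q.hom_mult[of "tau_G 0 [g \<otimes> h]" "inv\<^bsub>?F\<^esub> tau_G 0 [h]"]
          q.hom_inv[of "tau_G 0 [h]"] by (simp del: q.hom_mult q.hom_inv mult_FactGroup)
      moreover have "\<psi> (g \<otimes> h) \<in> carrier ?Q" "\<psi> h \<in> carrier ?Q"
        unfolding \<psi>_def using g h by (intro q.hom_closed; simp)+
      ultimately show "\<psi> (g \<otimes> h) = \<psi> g \<otimes>\<^bsub>?Q\<^esub> \<psi> h"
        by (metis q.H.inv_closed q.H.l_inv q.H.m_assoc q.H.r_one)
    qed
    then show ?thesis
      by (simp add: group_hom_def group_hom_axioms_def q.H.group_axioms group_axioms)
  qed
  have psi_aug: "\<psi> (res_aug G x) = ?q x"
  proof (rule Fr_hom_comp_eq[of 0 G "res_aug G" ?Q \<psi> ?F "\<lambda>x. x" ?q x])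
    show "group_hom (Fr 0) G (res_aug G)" using res_aug_hom unfolding free_res_simps(1) .
    show "group_hom (Fr 0) ?F (\<lambda>x. x)"
      unfolding free_res_simps(1) by (rule group.id_group_hom[OF Fr_group])
    show "x \<in> carrier (Fr 0)" using x unfolding free_res_simps(1) .
    show "\<psi> (res_aug G (tau_G 0 y)) = ?q (tau_G 0 y)" if "y \<in> gens (Suc 0)" for y
      using that by (auto simp: Suc_numerals gens_1 res_aug_tau \<psi>_def)
  qed (rule \<psi> q.group_hom_axioms)+
  show ?thesis
  proof
    assume "res_aug G x = \<one>"
    then have "?q x = \<one>\<^bsub>?Q\<^esub>" using psi_aug group_hom.hom_one[OF \<psi>] by simp
    then show "x \<in> T.B0" using normal.rcos_eq_self_iff[OF T.B0_normal x] by simp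
  next
    assume "x \<in> T.B0"
    then obtain y where y: "y \<in> T.N1" "x = \<delta> 1 1 y" by (rule T.B0_E)
    show "res_aug G x = \<one>"
      unfolding y(2) faces[OF T.N1_D(1)[OF y(1)], symmetric] T.N1_D(2)[OF y(1)] by (rule aug.hom_one)
  qed
qed

section \<open>The abelianization\<close>

lemma nu_1_comm_group: "comm_group (nu 1 G)"
proof (rule group.group_comm_groupI[OF nu_group])
  fix x y assume xy: "x \<in> carrier (nu 1 G)" "y \<in> carrier (nu 1 G)"
  obtain a where a: "a \<in> carrier G" "y = lcs G 1 #> a" by (rule nu_carrierE[OF xy(2)])
  show "x \<otimes>\<^bsub>nu 1 G\<^esub> y = y \<otimes>\<^bsub>nu 1 G\<^esub> x"
    unfolding a(2) using nu_central[of a 0 x] xy(1) a(1) by (simp add: One_nat_def)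
qed

text \<open>The nerve has a single vertex, so the two faces of a 1-simplex cancel and all 1-chains
  are cycles.\<close>

lemma boundary_1:
  assumes "c \<in> carrier (free_Abelian_group (gens 1))"
  shows "boundary (nerve G) 1 c = 0"
proof -
  have "(\<Sum>i\<le>1. frag_cmul ((- 1) ^ i) (frag_of (sface (nerve G) 1 i x))) = 0"
    if "x \<in> Poly_Mapping.keys c" for x
  proof -
    have "x \<in> gens 1" using assms that by auto
    then obtain g where "x = [g]" unfolding gens_1 by blast
    then show ?thesis by (simp add: One_nat_def sface_nerve)
  qed
  then show ?thesis by (simp add: boundary_def frag_extend_eq_0)
qed

lemma boundary_2_frag:
  assumes "g \<in> carrier G" "h \<in> carrier G"
  shows "boundary (nerve G) 2 (frag_of [g, h]) = frag_of [h] - frag_of [g \<otimes> h] + frag_of [g]"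
proof -
  have "{..2} = {0, 1, 2::nat}" by auto
  then show ?thesis by (simp add: boundary_def sface_2)
qed

lemma boundary_diff: "boundary X n (a - b) = boundary X n a - boundary X n b"
  by (simp add: boundary_def frag_extend_diff)

text \<open>The map from H_1 G to G / [G, G] sends the class of [g] to the coset of g. It is onto,
  so representatives in G of the images of finitely many generators of H_1 G generate G modulo
  commutators.\<close>

lemma fin_gen_abelianization:
  assumes fg: "fin_gen (group_H 1 G)"
  obtains X where "finite X" "X \<subseteq> carrier G" "generate G (X \<union> lcs G 1) = carrier G"
proof -
  let ?C1 = "free_Abelian_group (gens 1)" and ?C2 = "free_Abelian_group (gens 2)"
  let ?B = "boundary (nerve G) 2 ` carrier ?C2" and ?A = "nu 1 G" and ?p = "r_coset G (lcs G 1)"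
  interpret A: comm_group ?A by (rule nu_1_comm_group)
  interpret p: group_hom G ?A ?p by (rule nu_hom)
  have "(\<lambda>x. ?p (hd x)) ` gens 1 \<subseteq> carrier ?A"
    unfolding gens_1 using p.hom_closed by auto
  then obtain \<psi> where \<psi>: "\<psi> \<in> hom ?C1 ?A" "\<And>x. x \<in> gens 1 \<Longrightarrow> \<psi> (frag_of x) = ?p (hd x)"
    using A.free_Abelian_group_universal[of "\<lambda>x. ?p (hd x)" "gens 1"] by blast
  interpret psi: group_hom ?C1 ?A \<psi>
    using \<psi>(1) by (simp add: group_hom_def group_hom_axioms_def A.group_axioms)
  have psi_diff: "\<psi> (a - b) = \<psi> a \<otimes>\<^bsub>?A\<^esub> inv\<^bsub>?A\<^esub> \<psi> b"
    if "a \<in> carrier ?C1" "b \<in> carrier ?C1" for a b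
    using psi.hom_mult[of a "- b"] psi.hom_inv[of b] that by simp
  \<comment> \<open>The boundary of [g|h] is [h] - [gh] + [g], which \<open>\<psi>\<close> sends to
    the neutral element of the abelian group \<open>nu 1 G\<close>; chain induction extends this to
    all 2-chains.\<close>
  have bd: "boundary (nerve G) 2 c \<in> carrier ?C1 \<and> \<psi> (boundary (nerve G) 2 c) = \<one>\<^bsub>?A\<^esub>"
    if "Poly_Mapping.keys c \<subseteq> gens 2" for c
    using that
  proof (induction c rule: free_Abelian_group_induct[consumes 1, case_names zero diff one])
    case zero
    show ?case using psi.hom_one by (simp add: boundary_def)
  next
    case (diff a b)
    let ?a = "boundary (nerve G) 2 a" and ?b = "boundary (nerve G) 2 b"
    have ab: "?a \<in> carrier ?C1" "?b \<in> carrier ?C1" "\<psi> ?a = \<one>\<^bsub>?A\<^esub>" "\<psi> ?b = \<one>\<^bsub>?A\<^esub>"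
      using diff.IH by blast+
    have "Poly_Mapping.keys (?a - ?b) \<subseteq> gens 1"
      by (rule order_trans[OF keys_diff Un_least]) (use ab in simp_all)
    moreover have "\<psi> (?a - ?b) = \<one>\<^bsub>?A\<^esub>"
      unfolding psi_diff[OF ab(1,2)] ab(3,4) by simp
    ultimately show ?case unfolding boundary_diff by simp
  next
    case (one x)
    then obtain g h where x: "x = [g, h]" "g \<in> carrier G" "h \<in> carrier G" unfolding gens_2 by blast
    have mem: "[k] \<in> gens 1" if "k \<in> carrier G" for k using that by (simp add: gens_eq)
    note m = mem[OF x(2)] mem[OF x(3)] mem[OF m_closed[OF x(2,3)]]
    let ?a = "frag_of [h] - frag_of [g \<otimes> h]"
    have a: "?a \<in> carrier ?C1" using m keys_diff[of "frag_of [h]" "frag_of [g \<otimes> h]"] by (auto simp: keys_frag_of)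
    have gC: "frag_of [g] \<in> carrier ?C1" using m by simp
    have "?a + frag_of [g] \<in> carrier ?C1"
      using monoid.m_closed[OF group.is_monoid[OF group_free_Abelian_group] a gC] by simp
    moreover have "\<psi> (?a + frag_of [g]) = \<psi> ?a \<otimes>\<^bsub>?A\<^esub> \<psi> (frag_of [g])"
      using psi.hom_mult[OF a gC] by simp
    moreover have "\<psi> ?a = ?p h \<otimes>\<^bsub>?A\<^esub> inv\<^bsub>?A\<^esub> ?p (g \<otimes> h)"
      using psi_diff[of "frag_of [h]" "frag_of [g \<otimes> h]"] m \<psi>(2) by simp
    moreover have "?p (g \<otimes> h) = ?p g \<otimes>\<^bsub>?A\<^esub> ?p h" by (rule p.hom_mult[OF x(2,3)])
    moreover have "?p h \<otimes>\<^bsub>?A\<^esub> inv\<^bsub>?A\<^esub> (?p g \<otimes>\<^bsub>?A\<^esub> ?p h) \<otimes>\<^bsub>?A\<^esub> ?p g = \<one>\<^bsub>?A\<^esub>"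
      using p.hom_closed[OF x(2)] p.hom_closed[OF x(3)] by (simp only: A.inv_mult_group A.m_assoc A.mult_inv_cancel A.l_inv A.inv_closed A.m_closed)
    ultimately show ?case unfolding x(1) boundary_2_frag[OF x(2,3)] using m \<psi>(2) by simp
  qed
  have B_sub: "subgroup ?B ?C1"
  proof (rule group.subgroupI[OF group_free_Abelian_group])
    show "?B \<subseteq> carrier ?C1" using bd by auto
    have "0 \<in> carrier ?C2" by simp
    then show "?B \<noteq> {}" by blast
    fix a assume "a \<in> ?B"
    then obtain a' where a': "Poly_Mapping.keys a' \<subseteq> gens 2" "a = boundary (nerve G) 2 a'" by auto
    have "- a = boundary (nerve G) 2 (- a')" using a'(2) by (simp add: boundary_def frag_extend_minus)
    moreover have "Poly_Mapping.keys (- a') \<subseteq> gens 2" using a'(1) by simp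
    ultimately have "- a \<in> ?B" by (intro image_eqI[of _ _ "- a'"]) simp_all
    moreover have "a \<in> carrier ?C1" using a' bd by simp
    ultimately show "inv\<^bsub>?C1\<^esub> a \<in> ?B" by simp
    fix b assume "b \<in> ?B"
    then obtain b' where b': "Poly_Mapping.keys b' \<subseteq> gens 2" "b = boundary (nerve G) 2 b'" by auto
    have "a + b = boundary (nerve G) 2 (a' + b')" using a'(2) b'(2) by (simp add: boundary_def frag_extend_add)
    moreover have "Poly_Mapping.keys (a' + b') \<subseteq> gens 2" using a'(1) b'(1) keys_add[of a' b'] by blast
    ultimately show "a \<otimes>\<^bsub>?C1\<^esub> b \<in> ?B" by (intro image_eqI[of _ _ "a' + b'"]) simp_all
  qed
  have B_normal: "?B \<lhd> ?C1"
    by (rule comm_group.normal_iff_subgroup[OF abelian_free_Abelian_group, THEN iffD2, OF B_sub])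
  have H1: "group_H 1 G = ?C1 Mod ?B"
  proof -
    have "{c \<in> carrier ?C1. boundary (nerve G) 1 c = 0} = carrier ?C1" using boundary_1 by blast
    then show ?thesis by (simp add: group_H_def homology_def Suc_numerals)
  qed
  have Bker: "?B \<subseteq> kernel ?C1 ?A \<psi>" unfolding kernel_def using bd by (intro image_subsetI CollectI) simp
  obtain \<phi> where \<phi>: "\<phi> \<in> hom (?C1 Mod ?B) ?A" "\<And>x. x \<in> carrier ?C1 \<Longrightarrow> \<phi> (r_coset ?C1 ?B x) = \<psi> x"
    using psi.FactGroup_universal_kernel[OF B_normal Bker] by metis
  interpret phi: group_hom "?C1 Mod ?B" ?A \<phi>
    using \<phi>(1) normal.factorgroup_is_group[OF B_normal]
    by (simp add: group_hom_def group_hom_axioms_def A.group_axioms)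
  obtain T where T: "finite T" "T \<subseteq> carrier (?C1 Mod ?B)" "generate (?C1 Mod ?B) T = carrier (?C1 Mod ?B)"
    using fg unfolding fin_gen_def H1 by blast
  have "\<forall>y\<in>\<phi> ` T. \<exists>g\<in>carrier G. ?p g = y"
  proof
    fix y assume "y \<in> \<phi> ` T"
    then have "y \<in> carrier ?A" by (elim imageE) (use phi.hom_closed subsetD[OF T(2)] in simp)
    then obtain g where "g \<in> carrier G" "y = ?p g" by (rule nu_carrierE)
    then show "\<exists>g\<in>carrier G. ?p g = y" by (intro bexI[of _ g]) simp_all
  qed
  then obtain r where r: "\<And>y. y \<in> \<phi> ` T \<Longrightarrow> r y \<in> carrier G \<and> ?p (r y) = y" by metis
  let ?X = "r ` \<phi> ` T"
  have X: "?X \<subseteq> carrier G" by (intro image_subsetI) (use r in simp)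
  have XL: "?X \<union> lcs G 1 \<subseteq> carrier G" by (rule Un_least[OF X subgroup.subset[OF lcs_subgroup]])
  have "?p ` ?X = (\<lambda>y. y) ` \<phi> ` T"
    unfolding image_image[of ?p r] by (rule image_cong[OF refl]) (use r in simp)
  then have pX: "?p ` ?X = \<phi> ` T" by simp
  have "x \<in> generate G (?X \<union> lcs G 1)" if x: "x \<in> carrier G" for x
  proof -
    have xg: "[x] \<in> gens 1" using x by (simp add: gens_eq)
    have "?p x = \<phi> (r_coset ?C1 ?B (frag_of [x]))" using \<phi>(2)[of "frag_of [x]"] \<psi>(2)[OF xg] xg by simp
    moreover have "r_coset ?C1 ?B (frag_of [x]) \<in> generate (?C1 Mod ?B) T"
      unfolding T(3) carrier_FactGroup using xg by (intro imageI) simp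
    ultimately have "?p x \<in> \<phi> ` generate (?C1 Mod ?B) T" by (rule image_eqI)
    moreover have "\<phi> ` generate (?C1 Mod ?B) T = ?p ` generate G ?X"
      by (rule trans[OF phi.generate_img[OF T(2), symmetric] trans[OF _ p.generate_img[OF X]]])
        (simp only: pX)
    ultimately have "?p x \<in> ?p ` generate G ?X" by simp
    then obtain y where y: "y \<in> generate G ?X" "?p x = ?p y" by (elim imageE)
    have yc: "y \<in> carrier G" by (rule generate_in_carrier[OF X y(1)])
    have "x \<otimes> inv y \<in> lcs G 1" using y(2) lcs_rcos_eq_iff[OF x yc] by simp
    then have 1: "x \<otimes> inv y \<in> generate G (?X \<union> lcs G 1)" by (intro generate.incl) simp
    have "y \<in> generate G (?X \<union> lcs G 1)"
      by (rule subsetD[OF mono_generate[OF Un_upper1] y(1)])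
    from generate.eng[OF 1 this] show ?thesis using x yc by (simp add: m_assoc)
  qed
  then have "generate G (?X \<union> lcs G 1) = carrier G"
    by (intro subset_antisym subsetI generate_in_carrier[OF XL])
  with T(1) X show ?thesis by (intro that[of ?X]) simp_all
qed

end

theorem proposition3p14:
  fixes G :: "('a, 'b) monoid_scheme"
  assumes "group G"
    and "fin_gen (group_H 1 G)"
  shows
    \<comment> \<open>the natural maps are homomorphisms and induce isomorphisms of nilpotent quotients\<close>
    "to_Zinf G \<in> hom G (Zinf G) \<and>
     Zinf_to_pronil G \<in> hom (Zinf G) (pronil G) \<and>
     (\<forall>n. nu_map (Zinf G) n (to_Zinf G) \<in> iso (nu n G) (nu n (Zinf G)) \<and>
          nu_map (pronil G) n (Zinf_to_pronil G) \<in> iso (nu n (Zinf G)) (nu n (pronil G))) \<and>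
    \<comment> \<open>the short exact sequence\<close>
     lim1_baer_to_Zinf G \<in> hom (lim1_baer G) (Zinf G) \<and>
     inj_on (lim1_baer_to_Zinf G) (carrier (lim1_baer G)) \<and>
     lim1_baer_to_Zinf G ` carrier (lim1_baer G) = kernel (Zinf G) (pronil G) (Zinf_to_pronil G) \<and>
     Zinf_to_pronil G ` carrier (Zinf G) = carrier (pronil G) \<and>
    \<comment> \<open>its maps define isomorphisms\<close>
     lim1_baer_to_Zinf G \<in> iso (lim1_baer G) ((Zinf G)\<lparr>carrier := lcs_omega (Zinf G)\<rparr>) \<and>
     (\<lambda>C. the_elem (Zinf_to_pronil G ` C)) \<in> iso (nu_omega (Zinf G)) (pronil G)"
proof -
  interpret G: group G by fact
  obtain X where X: "finite X" "X \<subseteq> carrier G" "generate G (X \<union> lcs G 1) = carrier G"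
    by (rule G.fin_gen_abelianization[OF assms(2)])
  \<comment> \<open>With tau[g] as the section, \<open>to_Z\<close> of the locale becomes the unit
    map \<open>to_Zinf\<close>.\<close>
  interpret R: resolution "free_res G" G "res_aug G" "\<lambda>g. tau (nerve G) 0 [g]" X
  proof (intro resolution.intro resolution_axioms.intro)
    show "simplicial_group (free_res G)" by (rule G.free_res_simplicial_group)
    show "group_hom (grp (free_res G) 0) G (res_aug G)" by (rule G.res_aug_hom)
  qed (use G.res_aug_kernel G.tau_closed_explicit(1) G.res_aug_tau X in \<open>simp_all add: G.free_res_simps(1)\<close>)
  have Z: "Zinf G = R.Z" by (simp add: Zinf_def)
  have to_Z: "to_Zinf G = R.to_Z"
    by (simp add: fun_eq_iff to_Zinf_def R.to_Z_def R.moore_bounds_spronil_0 R.spronil_0)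
  have from_Z: "Zinf_to_pronil G = R.Z_to_pronil"
    by (simp add: fun_eq_iff Zinf_to_pronil_def R.Z_to_pronil_def)
  have L: "lim1_baer G = R.lim1_S"
    by (simp add: lim1_baer_def baer_def[abs_def] baer_map_def[abs_def])
  show ?thesis
    unfolding Z to_Z from_Z L lim1_baer_to_Zinf_def
    using R.to_Z.homh R.phi.homh R.to_Z_nu_iso R.Z_to_pronil_nu_iso R.milnor_delta_hom
      R.milnor_delta_inj R.milnor_delta_image R.phi_surj R.milnor_delta_iso R.Z_to_pronil_nu_omega_iso
    by blast
qed

end
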